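(* Let $X\subset\mathbb{R}^n$ be compact, let $\mu_0$ be a probability measure with support $X$, and for each $N$ let $H^{(N)}$ be an $N$-particle Hamiltonian on $X^N$, the sequence $H^{(N)}$ being uniformly Lipschitz continuous. Assume that there exists a sequence $\beta_N$ of positive real numbers tending to infinity such that, for every $u\in C^0(X)$, $-\frac{1}{\beta_N N}\log Z_{N,\beta_N}[u]$ converges, as $N\to\infty$, to a functional $\mathcal{F}(u)$ which is Gateaux differentiable on $C^0(X)$. Then, for any fixed $\beta>0$, the law of the empirical measure $\delta_N=\frac1N\sum_{i=1}^N\delta_{x_i}$ for the random point process on $X$ defined by the Gibbs measure $\mu^{(N)}_\beta$ satisfies a large deviation principle on $\mathcal{M}_1(X)$ with speed $\beta N$ and good rate functional $$F_\beta(\mu)=E(\mu)+\frac1\beta D_{\mu_0}(\mu)-C_\beta,$$ where $C_\beta$ is the normalizing constant (making $\inf F_\beta=0$), the functional $$E(\mu)=\sup_{u\in C^0(X)}\Big(\mathcal{F}(u)-\int_X u\,\mu\Big),$$ which only depends on the support $X$ of $\mu_0$, is the Legendre transform of $\mathcal{F}$, and $D_{\mu_0}(\mu)$ is the entropy of $\mu$ relative to $\mu_0$. In particular, $\delta_N$ converges in probability to the unique minimizer $\mu_\beta$ of $F_\beta$.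
   Context: An $N$-particle Hamiltonian is a continuous function $H^{(N)}:X^N\to\mathbb{R}$ invariant under permutations of the coordinates. Uniformly Lipschitz: there is a constant $L$ independent of $N$ such that $|H^{(N)}(x)-H^{(N)}(y)|\le L\sum_{i=1}^N|x_i-y_i|$ for all $x,y\in X^N$. The Gibbs measure at inverse temperature $\beta$ is $\mu_\beta^{(N)}=e^{-\beta H^{(N)}}\mu_0^{\otimes N}/Z_{N,\beta}$, with $Z_{N,\beta}=\int_{X^N}e^{-\beta H^{(N)}}\mu_0^{\otimes N}$. The tilted partition function is $Z_{N,\beta_N}[u]=\int_{X^N}e^{-\beta_N(H^{(N)}+\sum_i u(x_i))}\mu_0^{\otimes N}$. Gateaux differentiable means differentiable along all affine lines in $C^0(X)$. $D_{\mu_0}(\mu)=\int\log(d\mu/d\mu_0)\,d\mu$ if $\mu\ll\mu_0$, and $+\infty$ otherwise. $\mathcal{M}_1(X)$ is the space of Borel probability measures on $X$ with the weak topology. LDP: a sequence $\Gamma_N$ of Borel measures on $\mathcal{M}$ satisfies an LDP with speed $r_N$ and (lower semicontinuous) rate functional $I$ if $\limsup\frac1{r_N}\log\Gamma_N(\mathcal A)\le-\inf_{\mathcal A}I$ for closed $\mathcal A$ and $\liminf\frac1{r_N}\log\Gamma_N(\mathcal G)\ge-\inf_{\mathcal G}I$ for open $\mathcal G$; $I$ is good if its sublevel sets are compact. *)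

theory Defs
  imports "HOL-Probability.Probability"
begin

section \<open>Borel probability measures with the weak topology\<close>

text \<open>Measures on \<open>X\<close> have underlying space \<open>X\<close> itself (not the ambient space), so that only the
  values on \<open>X\<close> of the functions to be integrated matter.\<close>

definition prob_measures :: "'a::topological_space set \<Rightarrow> 'a measure set" where
  "prob_measures X = {\<mu>. prob_space \<mu> \<and> sets \<mu> = sets (restrict_space borel X)}"

definition measure_support :: "'a::topological_space measure \<Rightarrow> 'a set" where
  "measure_support \<mu> =
     {x \<in> space \<mu>. \<forall>U. open U \<and> x \<in> U \<longrightarrow> emeasure \<mu> (U \<inter> space \<mu>) > 0}"

text \<open>The test functions are those of \<open>C\<^sup>0(X)\<close>; they are automatically bounded when \<open>X\<close> is compact,
  the only case of interest.\<close>

definition weak_topology :: "'a::topological_space set \<Rightarrow> 'a measure topology" where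
  "weak_topology X = topology_generated_by
     {{\<mu> \<in> prob_measures X. (\<integral>x. u x \<partial>\<mu>) \<in> U} | (u :: 'a \<Rightarrow> real) U.
        continuous_on X u \<and> open U}"

lemma topspace_weak_topology: "topspace (weak_topology X) = prob_measures X"
proof -
  have "\<exists>A. prob_measures X = A \<and> (\<exists>(u :: 'a \<Rightarrow> real) U. A = {\<mu> \<in> prob_measures X. (\<integral>x. u x \<partial>\<mu>) \<in> U} \<and>
      continuous_on X u \<and> open U)"
    by (intro exI[of _ "prob_measures X"] conjI refl exI[of _ "\<lambda>_. 0"] exI[of _ UNIV]) auto
  then show ?thesis
    unfolding weak_topology_def topology_generated_by_topspace by blast
qed

definition borel_of_topology :: "'a topology \<Rightarrow> 'a measure" where
  "borel_of_topology T = sigma (topspace T) {U. openin T U}"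

section \<open>Large deviation principles\<close>

definition log_ereal :: "real \<Rightarrow> ereal" where
  "log_ereal p = (if p = 0 then -\<infinity> else ereal (ln p))"

definition lower_semicontinuous_fun :: "'a topology \<Rightarrow> ('a \<Rightarrow> ereal) \<Rightarrow> bool" where
  "lower_semicontinuous_fun T I \<longleftrightarrow> (\<forall>c::real. closedin T {x \<in> topspace T. I x \<le> ereal c})"

definition good_rate_functional :: "'a topology \<Rightarrow> ('a \<Rightarrow> ereal) \<Rightarrow> bool" where
  "good_rate_functional T I \<longleftrightarrow> (\<forall>c::real. compactin T {x \<in> topspace T. I x \<le> ereal c})"

text \<open>The infimum over the empty set is \<open>\<infinity>\<close>.\<close>

definition satisfies_LDP ::
    "'a topology \<Rightarrow> (nat \<Rightarrow> 'a measure) \<Rightarrow> (nat \<Rightarrow> real) \<Rightarrow> ('a \<Rightarrow> ereal) \<Rightarrow> bool" where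
  "satisfies_LDP T \<Gamma> r I \<longleftrightarrow>
     lower_semicontinuous_fun T I \<and>
     (\<forall>A. closedin T A \<longrightarrow>
        limsup (\<lambda>N. ereal (1 / r N) * log_ereal (measure (\<Gamma> N) A)) \<le> - (INF x\<in>A. I x)) \<and>
     (\<forall>G. openin T G \<longrightarrow>
        liminf (\<lambda>N. ereal (1 / r N) * log_ereal (measure (\<Gamma> N) G)) \<ge> - (INF x\<in>G. I x))"

text \<open>Convergence in probability to a constant, for laws on a topological space that is not given
  with a preferred metric.\<close>

definition converges_in_probability_to ::
    "'a topology \<Rightarrow> (nat \<Rightarrow> 'a measure) \<Rightarrow> 'a \<Rightarrow> bool" where
  "converges_in_probability_to T \<Gamma> m \<longleftrightarrow>
     (\<forall>U. openin T U \<and> m \<in> U \<longrightarrow> (\<lambda>N. measure (\<Gamma> N) (topspace T - U)) \<longlonglongrightarrow> 0)"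

section \<open>Hamiltonians and Gibbs measures\<close>

text \<open>The configuration space \<open>X\<^sup>N\<close> is the set of extensional functions from \<open>{..<N}\<close> to \<open>X\<close>; on it the
  topology inherited from the function space is the usual product topology.\<close>

abbreviation config :: "'a set \<Rightarrow> nat \<Rightarrow> (nat \<Rightarrow> 'a) set" where
  "config X N \<equiv> {..<N} \<rightarrow>\<^sub>E X"

definition is_hamiltonian ::
    "'a::topological_space set \<Rightarrow> nat \<Rightarrow> ((nat \<Rightarrow> 'a) \<Rightarrow> real) \<Rightarrow> bool" where
  "is_hamiltonian X N h \<longleftrightarrow>
     continuous_on (config X N) h \<and>
     (\<forall>\<pi>. \<pi> permutes {..<N} \<longrightarrow> (\<forall>x \<in> config X N. h (x \<circ> \<pi>) = h x))"

definition uniformly_lipschitz ::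
    "'a::real_normed_vector set \<Rightarrow> (nat \<Rightarrow> (nat \<Rightarrow> 'a) \<Rightarrow> real) \<Rightarrow> bool" where
  "uniformly_lipschitz X H \<longleftrightarrow>
     (\<exists>L. \<forall>N. \<forall>x \<in> config X N. \<forall>y \<in> config X N.
        \<bar>H N x - H N y\<bar> \<le> L * (\<Sum>i<N. norm (x i - y i)))"

definition partition_function ::
    "'a measure \<Rightarrow> nat \<Rightarrow> ((nat \<Rightarrow> 'a) \<Rightarrow> real) \<Rightarrow> real \<Rightarrow> real" where
  "partition_function \<mu>0 N h \<beta> = (\<integral>x. exp (- \<beta> * h x) \<partial>(\<Pi>\<^sub>M i\<in>{..<N}. \<mu>0))"

definition gibbs_measure ::
    "'a measure \<Rightarrow> nat \<Rightarrow> ((nat \<Rightarrow> 'a) \<Rightarrow> real) \<Rightarrow> real \<Rightarrow> (nat \<Rightarrow> 'a) measure" where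
  "gibbs_measure \<mu>0 N h \<beta> =
     density (\<Pi>\<^sub>M i\<in>{..<N}. \<mu>0)
       (\<lambda>x. ennreal (exp (- \<beta> * h x) / partition_function \<mu>0 N h \<beta>))"

definition tilted_partition_function ::
    "'a measure \<Rightarrow> nat \<Rightarrow> ((nat \<Rightarrow> 'a) \<Rightarrow> real) \<Rightarrow> real \<Rightarrow> ('a \<Rightarrow> real) \<Rightarrow> real" where
  "tilted_partition_function \<mu>0 N h \<beta> u =
     partition_function \<mu>0 N (\<lambda>x. h x + (\<Sum>i<N. u (x i))) \<beta>"

definition empirical_measure ::
    "'a::topological_space set \<Rightarrow> nat \<Rightarrow> (nat \<Rightarrow> 'a) \<Rightarrow> 'a measure" where
  "empirical_measure X N x =
     measure_of X (sets (restrict_space borel X))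
       (\<lambda>A. (\<Sum>i<N. emeasure (return (restrict_space borel X) (x i)) A) / of_nat N)"

definition empirical_law ::
    "'a::topological_space set \<Rightarrow> 'a measure \<Rightarrow> nat \<Rightarrow> ((nat \<Rightarrow> 'a) \<Rightarrow> real) \<Rightarrow> real \<Rightarrow>
     'a measure measure" where
  "empirical_law X \<mu>0 N h \<beta> =
     distr (gibbs_measure \<mu>0 N h \<beta>) (borel_of_topology (weak_topology X)) (empirical_measure X N)"

section \<open>The functionals\<close>

text \<open>\<open>\<F>\<close> is a total function in HOL; only its values on functions continuous on \<open>X\<close> are used.\<close>

definition converges_to_free_energy ::
    "'a::topological_space set \<Rightarrow> 'a measure \<Rightarrow> (nat \<Rightarrow> (nat \<Rightarrow> 'a) \<Rightarrow> real) \<Rightarrow> (nat \<Rightarrow> real) \<Rightarrow>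
     (('a \<Rightarrow> real) \<Rightarrow> real) \<Rightarrow> bool" where
  "converges_to_free_energy X \<mu>0 H b \<F> \<longleftrightarrow>
     (\<forall>u. continuous_on X u \<longrightarrow>
        (\<lambda>N. - (1 / (b N * real N)) * ln (tilted_partition_function \<mu>0 N (H N) (b N) u))
          \<longlonglongrightarrow> \<F> u)"

definition gateaux_differentiable_on_C0 ::
    "'a::topological_space set \<Rightarrow> (('a \<Rightarrow> real) \<Rightarrow> real) \<Rightarrow> bool" where
  "gateaux_differentiable_on_C0 X \<F> \<longleftrightarrow>
     (\<forall>u v. continuous_on X u \<and> continuous_on X v \<longrightarrow>
        (\<forall>t::real. (\<lambda>s. \<F> (\<lambda>x. u x + s * v x)) differentiable (at t)))"

definition energy ::
    "'a::topological_space set \<Rightarrow> (('a \<Rightarrow> real) \<Rightarrow> real) \<Rightarrow> 'a measure \<Rightarrow> ereal" where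
  "energy X \<F> \<mu> = (SUP u\<in>{u. continuous_on X u}. ereal (\<F> u - (\<integral>x. u x \<partial>\<mu>)))"

text \<open>\<^const>\<open>KL_divergence\<close> is a Bochner integral, hence \<open>0\<close> in the absence of integrability. Since
  \<open>t * ln t \<ge> - 1 / exp 1\<close>, the negative part of \<open>ln (d\<mu>/d\<mu>0)\<close> is always \<open>\<mu>\<close>-integrable for
  probability measures, so for \<open>\<mu> \<lless> \<mu>0\<close> a failure of integrability means that the integral is
  \<open>\<infinity>\<close>.\<close>

definition rel_entropy :: "'a measure \<Rightarrow> 'a measure \<Rightarrow> ereal" where
  "rel_entropy \<mu>0 \<mu> =
     (if absolutely_continuous \<mu>0 \<mu> \<and> integrable \<mu> (entropy_density (exp 1) \<mu>0 \<mu>)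
      then ereal (KL_divergence (exp 1) \<mu>0 \<mu>) else \<infinity>)"

definition free_energy_functional ::
    "'a::topological_space set \<Rightarrow> 'a measure \<Rightarrow> (('a \<Rightarrow> real) \<Rightarrow> real) \<Rightarrow> real \<Rightarrow> real \<Rightarrow>
     'a measure \<Rightarrow> ereal" where
  "free_energy_functional X \<mu>0 \<F> \<beta> C \<mu> =
     energy X \<F> \<mu> + ereal (1 / \<beta>) * rel_entropy \<mu>0 \<mu> - ereal C"

end

theory Submission
  imports Defs
begin

text \<open>By Laplace's method \<open>\<F>(u)\<close> is the limit of the minima of \<open>(H\<^sup>(\<^sup>N\<^sup>) + \<Sum> u(x\<^sub>i)) / N\<close>,
  whatever the reference measure, as long as its support is \<open>X\<close>. The upper bound of the large deviation
  principle then follows from exponential Chebyshev inequalities and compactness. For the lower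
  bound one needs configurations near \<open>\<mu>\<close> whose energy per particle is nearly \<open>E(\<mu>)\<close>: differentiability of
  \<open>\<F>\<close> makes minimisers of the energy tilted by \<open>u\<close> concentrate at the derivative of \<open>\<F>\<close> at \<open>u\<close>, and
  derivatives of \<open>\<F>\<close> come close to \<open>\<mu>\<close> along a penalised dual maximisation. The Lipschitz bound and the
  permutation invariance propagate the energy bound to every configuration near \<open>\<mu>\<close>, and a change of
  measure from \<open>\<mu>0\<close> to \<open>\<mu>\<close> costs the relative entropy. Compactness of the
  space of probability measures is not used: a finitely additive mean with a finite rate is
  automatically countably additive, and the finitely additive means are compact by Tychonoff.\<close>

subsection \<open>Relative entropy\<close>

text \<open>Up to the factor \<beta> and a constant the rate functional is
  \<open>\<beta> E + D\<close>, and both terms are suprema of affine functions of the measure: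
  \<open>E\<close> over continuous \<open>u\<close>, \<open>D\<close> over bounded Borel
  \<open>w\<close>. A sublevel set is thus an intersection of half-spaces indexed by pairs
  \<open>(u, w)\<close>. This joint duality carries the upper bound, the compactness of sublevel
  sets and the existence of a minimiser. The obstacle is the lower bound: a Legendre transform sees
  only convex hulls, so configurations near \<mu> might all have energy per particle well above
  \<open>E(\<mu>)\<close>. Differentiability of \<F> excludes this. The supremum defining
  \<open>E\<close> need not be attained; the quadratic penalty in finitely many parameters forces
  attainment, with an error in the derivative that can be tuned. At fixed \<beta> energy and entropy
  are both of order \<open>N\<close>, so one configuration of low energy is not enough: a set of
  sufficient volume is needed, hence the energy bound on a whole weak neighbourhood. Estimates are
  made for unnormalised weights, so that applied to the full space they also give the normalising
  constant.\<close>

lemma ln_young: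
  fixes t y :: real
  assumes "t > 0"
  shows "y \<le> ln t - 1 + exp y / t"
proof -
  have "1 + (y - ln t) \<le> exp (y - ln t)" by (rule exp_ge_add_one_self)
  also have "\<dots> = exp y / t" using assms by (simp add: exp_diff)
  finally show ?thesis by simp
qed

lemma mult_ln_ge_minus_one:
  fixes t :: real
  assumes "t \<ge> 0"
  shows "- 1 \<le> t * ln t"
proof (cases "t = 0")
  case False
  then have "0 \<le> ln t - 1 + 1 / t"
    using assms ln_young[of t 0] by simp
  then have "0 \<le> t * (ln t - 1 + 1 / t)" using assms by simp
  then show ?thesis using False assms by (simp add: algebra_simps)
qed simp

lemma mult_ln_strict_midpoint:
  fixes s t :: real
  assumes "s \<ge> 0" "t \<ge> 0" "s \<noteq> t"
  shows "(s + t) / 2 * ln ((s + t) / 2) < (s * ln s + t * ln t) / 2"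
proof -
  define g where "g = (s + t) / 2"
  have g: "g > 0" "s \<noteq> g" "t \<noteq> g" using assms by (auto simp: g_def)
  have *: "r - g < r * ln r - r * ln g" if "r \<ge> 0" "r \<noteq> g" for r
  proof (cases "r = 0")
    case False
    with that have r: "r > 0" by simp
    have "ln (g / r) < g / r - 1"
      using ln_le_minus_one[of "g/r"] ln_eq_minus_one[of "g/r"] r g that by fastforce
    then have "r * ln (g / r) < r * (g / r - 1)" using r by simp
    also have "\<dots> = g - r" using r by (simp add: field_simps)
    finally show ?thesis using r g by (simp add: ln_div algebra_simps)
  qed (use g in simp)
  have "s - g + (t - g) < (s * ln s - s * ln g) + (t * ln t - t * ln g)"
    using *[of s] *[of t] assms g by linarith
  moreover have "s - g + (t - g) = 0" by (simp add: g_def)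
  moreover have "s * ln g + t * ln g = 2 * (g * ln g)" by (simp add: g_def algebra_simps)
  ultimately show ?thesis unfolding g_def[symmetric] by simp
qed

lemma prob_density_real:
  fixes f :: "'a \<Rightarrow> real"
  assumes "f \<in> borel_measurable M" "\<And>x. x \<in> space M \<Longrightarrow> 0 \<le> f x" "prob_space (density M f)"
  shows "integrable M f" "(\<integral>x. f x \<partial>M) = 1"
proof -
  interpret N: prob_space "density M f" by fact
  have "integrable (density M f) (\<lambda>x. 1::real)" by simp
  then show "integrable M f"
    using assms(1,2) by (subst (asm) integrable_real_density) auto
  have "(\<integral>x. 1 \<partial>density M f) = (1::real)" using N.prob_space by simp
  then show "(\<integral>x. f x \<partial>M) = 1"
    using assms(1,2) by (subst (asm) integral_real_density) auto
qed

text \<open>Easy half of the Donsker-Varadhan formula. Young's inequality \<open>ln_young\<close> is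
  used pointwise with \<open>t = f x\<close> and \<open>y = w x - L\<close>, multiplied by
  \<open>f x\<close> and integrated.\<close>

lemma (in prob_space) entropy_variational_le:
  fixes f w :: "'a \<Rightarrow> real"
  assumes f[measurable]: "f \<in> borel_measurable M" and f0: "\<And>x. x \<in> space M \<Longrightarrow> 0 \<le> f x"
    and p: "prob_space (density M f)"
    and ln_int: "integrable (density M f) (\<lambda>x. ln (f x))"
    and w[measurable]: "w \<in> borel_measurable M" and B: "\<And>x. x \<in> space M \<Longrightarrow> \<bar>w x\<bar> \<le> B"
  shows "(\<integral>x. w x \<partial>density M f) \<le> (\<integral>x. ln (f x) \<partial>density M f) + ln (\<integral>x. exp (w x) \<partial>M)"
proof -
  interpret N: prob_space "density M f" by fact
  have iw: "integrable M (\<lambda>x. exp (w x))"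
    by (rule integrable_const_bound[of _ "exp B"]) (use B in \<open>auto simp: abs_le_iff\<close>)
  have "exp (- B) \<le> (\<integral>x. exp (w x) \<partial>M)"
    by (rule integral_ge_const[OF iw]) (use B in \<open>force simp: abs_le_iff\<close>)
  then have Zpos: "(\<integral>x. exp (w x) \<partial>M) > 0"
    by (smt (verit) exp_gt_zero)
  \<comment> \<open>Subtracting \<open>L\<close> turns \<open>exp w\<close> into a probability
    density, so the two masses left over by Young's inequality, that of \<open>f\<close> and that of
    \<open>exp (w - L)\<close>, cancel.\<close>
  define L where "L = ln (\<integral>x. exp (w x) \<partial>M)"
  have iwL: "integrable M (\<lambda>x. exp (w x - L))" and eL: "(\<integral>x. exp (w x - L) \<partial>M) = 1"
    using iw Zpos by (simp_all add: exp_diff L_def)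
  have fi: "integrable M f" and "(\<integral>x. f x \<partial>M) = 1"
    using prob_density_real[OF f f0 p] by auto
  have ae0: "AE x in M. 0 \<le> f x" using f0 by simp
  have iN: "integrable (density M f) w"
    by (rule N.integrable_const_bound[of _ B]) (use B in auto)
  have i1: "integrable M (\<lambda>x. f x * w x)" and i2: "integrable M (\<lambda>x. f x * ln (f x))"
    using iN ln_int ae0 by (simp_all add: integrable_real_density)
  have "(\<integral>x. f x * w x \<partial>M) - L = (\<integral>x. f x * w x - L * f x \<partial>M)"
    using i1 fi \<open>(\<integral>x. f x \<partial>M) = 1\<close> by simp
  also have "\<dots> \<le> (\<integral>x. f x * ln (f x) - f x + exp (w x - L) \<partial>M)"
  proof (rule integral_mono_AE)
    show "AE x in M. f x * w x - L * f x \<le> f x * ln (f x) - f x + exp (w x - L)"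
    proof (rule AE_I2)
      fix x assume x: "x \<in> space M"
      show "f x * w x - L * f x \<le> f x * ln (f x) - f x + exp (w x - L)"
      proof (cases "f x = 0")
        case False
        then have "f x > 0" using f0[OF x] by simp
        from ln_young[OF this, of "w x - L"]
        have "f x * (w x - L) \<le> f x * (ln (f x) - 1 + exp (w x - L) / f x)"
          using \<open>f x > 0\<close> by simp
        then show ?thesis using \<open>f x > 0\<close> by (simp add: algebra_simps)
      qed simp
    qed
  qed (use i1 i2 fi iwL in auto)
  also have "\<dots> = (\<integral>x. f x * ln (f x) \<partial>M) - 1 + 1"
    using i2 fi iwL eL \<open>(\<integral>x. f x \<partial>M) = 1\<close> by simp
  finally have "(\<integral>x. f x * w x \<partial>M) \<le> (\<integral>x. f x * ln (f x) \<partial>M) + L" by simp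
  then show ?thesis
    using ae0 by (simp add: integral_real_density L_def)
qed

text \<open>\<open>rel_entropy\<close> goes through the Radon-Nikodym derivative, determined only
  almost everywhere; this moves it to a chosen real density. Points with \<open>f x = 0\<close>,
  where \<open>ln\<close> has a conventional value, are null for \<open>density M f\<close>.\<close>

lemma (in prob_space) rel_entropy_density:
  fixes f :: "'a \<Rightarrow> real"
  assumes f[measurable]: "f \<in> borel_measurable M" and f0: "\<And>x. x \<in> space M \<Longrightarrow> 0 \<le> f x"
    and ln_int: "integrable (density M f) (\<lambda>x. ln (f x))"
  shows "rel_entropy M (density M f) = ereal (\<integral>x. ln (f x) \<partial>density M f)"
proof -
  have nn: "AE x in M. 0 \<le> f x" using f0 by simp
  have [measurable]: "entropy_density (exp 1) M (density M (\<lambda>x. ennreal (f x))) \<in> borel_measurable M"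
    by (auto simp: comp_def entropy_density_def)
  have "density M (RN_deriv M (density M f)) = density M f"
    using f nn by (intro density_RN_deriv_density) auto
  then have eq: "AE x in M. RN_deriv M (density M f) x = f x"
    using f nn by (intro density_unique) auto
  have *: "AE x in density M f. entropy_density (exp 1) M (density M (\<lambda>x. ennreal (f x))) x = ln (f x)"
    using eq nn by (auto simp: AE_density entropy_density_def log_def)
  have "integrable (density M f) (entropy_density (exp 1) M (density M f))"
    using ln_int by (subst integrable_cong_AE[OF _ _ *]) auto
  moreover have "KL_divergence (exp 1) M (density M f) = (\<integral>x. ln (f x) \<partial>density M f)"
    unfolding KL_divergence_def by (rule integral_cong_AE[OF _ _ *]) auto
  moreover have "absolutely_continuous M (density M f)"
    by (rule absolutely_continuousI_density) simp
  ultimately show ?thesis unfolding rel_entropy_def by simp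
qed

lemma (in prob_space) real_density_of_absolutely_continuous:
  assumes N: "prob_space N" "sets N = sets M" "absolutely_continuous M N"
  obtains f :: "'a \<Rightarrow> real" where "f \<in> borel_measurable M" "\<And>x. 0 \<le> f x" "N = density M f"
proof -
  interpret N: prob_space N by fact
  obtain D :: "'a \<Rightarrow> real" where D: "D \<in> borel_measurable M" "AE x in M. RN_deriv M N x = ennreal (D x)"
      "\<And>x. 0 \<le> D x"
    using real_RN_deriv[OF N.finite_measure_axioms N(3,2)] by metis
  have "N = density M (RN_deriv M N)"
    using density_RN_deriv[OF N(3,2)] by simp
  also have "\<dots> = density M D"
    using D by (intro density_cong) auto
  finally show thesis using D that by blast
qed

lemma (in prob_space) rel_entropy_finiteE:
  assumes N: "prob_space N" "sets N = sets M" and fin: "rel_entropy M N \<noteq> \<infinity>"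
  obtains f :: "'a \<Rightarrow> real" where "f \<in> borel_measurable M" "\<And>x. 0 \<le> f x" "N = density M f"
    "integrable (density M f) (\<lambda>x. ln (f x))"
proof -
  have ac: "absolutely_continuous M N" and int: "integrable N (entropy_density (exp 1) M N)"
    using fin unfolding rel_entropy_def by (auto split: if_splits)
  obtain f :: "'a \<Rightarrow> real" where f[measurable]: "f \<in> borel_measurable M" and f0: "\<And>x. 0 \<le> f x" and Nf: "N = density M f"
    using real_density_of_absolutely_continuous[OF N ac] by metis
  have "density M (RN_deriv M (density M f)) = density M f"
    using f by (intro density_RN_deriv_density) auto
  then have eq: "AE x in M. RN_deriv M (density M f) x = f x"
    using f f0 by (intro density_unique) auto
  have [measurable]: "entropy_density (exp 1) M (density M (\<lambda>x. ennreal (f x))) \<in> borel_measurable M"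
    by (auto simp: comp_def entropy_density_def)
  have *: "AE x in density M f. entropy_density (exp 1) M (density M (\<lambda>x. ennreal (f x))) x = ln (f x)"
    using eq f0 by (auto simp: AE_density entropy_density_def log_def)
  have "integrable (density M f) (\<lambda>x. ln (f x))"
    using int unfolding Nf by (subst (asm) integrable_cong_AE[OF _ _ *]) auto
  with f f0 Nf that show thesis by blast
qed


text \<open>For a null set \<open>A\<close> of \<open>M\<close> the test function
  \<open>t * indicator A\<close> has exponential moment 1, so the bound reads
  \<open>t * measure N A \<le> d\<close> for every \<open>t > 0\<close>.\<close>

lemma (in prob_space) absolutely_continuous_if_variational_bound:
  assumes N: "prob_space N" "sets N = sets M"
    and le: "\<And>w B. w \<in> borel_measurable M \<Longrightarrow> (\<And>x. x \<in> space M \<Longrightarrow> \<bar>w x\<bar> \<le> B) \<Longrightarrow>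
        (\<integral>x. w x \<partial>N) - ln (\<integral>x. exp (w x) \<partial>M) \<le> (d::real)"
  shows "absolutely_continuous M N"
  unfolding absolutely_continuous_def
proof
  interpret N: prob_space N by fact
  fix A assume A: "A \<in> null_sets M"
  then have As: "A \<in> sets M" "A \<in> sets N" using N by auto
  have *: "t * measure N A \<le> d" if "t > 0" for t :: real
  proof -
    let ?w = "\<lambda>x. t * indicator A x :: real"
    have ae: "AE x in M. exp (?w x) = 1"
      using AE_not_in[OF A] by eventually_elim auto
    have "(\<integral>x. exp (?w x) \<partial>M) = (\<integral>x. 1 \<partial>M)"
      by (rule integral_cong_AE) (use As ae in auto)
    also have "\<dots> = 1" by (simp add: prob_space)
    finally have 1: "(\<integral>x. exp (?w x) \<partial>M) = 1" .
    have "(\<integral>x. ?w x \<partial>N) - ln (\<integral>x. exp (?w x) \<partial>M) \<le> d"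
      by (rule le[of _ t]) (use As that in \<open>auto simp: indicator_def\<close>)
    then show ?thesis using As unfolding 1 by simp
  qed
  have "measure N A = 0"
  proof (rule ccontr)
    assume "measure N A \<noteq> 0"
    then have pos: "measure N A > 0" using zero_less_measure_iff by blast
    have "(\<bar>d\<bar> + 1) / measure N A * measure N A \<le> d"
      by (rule *) (use pos in \<open>auto intro!: divide_pos_pos\<close>)
    then show False using pos by simp
  qed
  then show "A \<in> null_sets N" using As by (simp add: null_sets_def N.emeasure_eq_measure)
qed

text \<open>Hard half of the Donsker-Varadhan formula. The optimal test function \<open>ln f\<close>
  may be unbounded, but its truncations at height \<open>k\<close> are admissible, and
  \<open>exp (w k x) \<le> f x + exp (- real k)\<close> bounds their cumulant by
  \<open>exp (- real k)\<close>. Monotone convergence then makes the positive part of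
  \<open>ln f\<close> integrable, and dominated convergence passes to the limit.\<close>

lemma (in prob_space) rel_entropy_le_if_variational_bound:
  assumes N: "prob_space N" "sets N = sets M"
    and le: "\<And>w B. w \<in> borel_measurable M \<Longrightarrow> (\<And>x. x \<in> space M \<Longrightarrow> \<bar>w x\<bar> \<le> B) \<Longrightarrow>
        (\<integral>x. w x \<partial>N) - ln (\<integral>x. exp (w x) \<partial>M) \<le> d"
  shows "rel_entropy M N \<le> ereal d"
proof -
  have ac: "absolutely_continuous M N"
    by (rule absolutely_continuous_if_variational_bound[OF N le])
  obtain f :: "'a \<Rightarrow> real" where f[measurable]: "f \<in> borel_measurable M" and f0: "\<And>x. 0 \<le> f x" and Nf: "N = density M f"
    using real_density_of_absolutely_continuous[OF N ac] by metis
  interpret N: prob_space "density M f" using N Nf by simp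
  have fi: "integrable M f" and f1: "(\<integral>x. f x \<partial>M) = 1"
    using prob_density_real[OF f f0 N.prob_space_axioms] by auto
  \<comment> \<open>Where \<open>f\<close> vanishes the truncation is set to \<open>- real k\<close>
    explicitly, since \<open>ln 0\<close> does not stand for minus infinity; the estimate
    \<open>ew\<close> relies on it.\<close>
  define w where "w k x = max (- real k) (min (real k) (if f x = 0 then - real k else ln (f x)))" for k x
  have wm[measurable]: "w k \<in> borel_measurable M" for k
    unfolding w_def by measurable
  have wb: "\<bar>w k x\<bar> \<le> real k" for k x unfolding w_def by auto
  have wi: "integrable (density M f) (w k)" for k
    by (rule N.integrable_const_bound[of _ "real k"]) (use wb in auto)
  have ew: "exp (w k x) \<le> f x + exp (- real k)" for k x
  proof (cases "f x = 0")
    case False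
    then have fp: "f x > 0" using f0[of x] by simp
    have "w k x \<le> max (- real k) (ln (f x))" using False by (simp add: w_def)
    then have "exp (w k x) \<le> exp (max (- real k) (ln (f x)))" by simp
    also have "\<dots> \<le> f x + exp (- real k)" using fp by (auto simp: max_def)
    finally show ?thesis .
  qed (simp add: w_def)
  have bound: "(\<integral>x. w k x \<partial>density M f) \<le> d + exp (- real k)" for k
  proof -
    have ei: "integrable M (\<lambda>x. exp (w k x))"
      by (rule integrable_const_bound[of _ "exp (real k)"])
        (use wb in \<open>auto simp: abs_le_iff\<close>)
    have "(\<integral>x. exp (w k x) \<partial>M) \<le> (\<integral>x. f x + exp (- real k) \<partial>M)"
      by (rule integral_mono) (use ei ew fi in auto)
    also have "\<dots> = 1 + exp (- real k)" using fi f1 by (simp add: prob_space)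
    finally have le1: "(\<integral>x. exp (w k x) \<partial>M) \<le> 1 + exp (- real k)" .
    have "exp (- real k) \<le> (\<integral>x. exp (w k x) \<partial>M)"
      by (rule integral_ge_const[OF ei]) (use wb in \<open>auto simp: abs_le_iff minus_le_iff\<close>)
    then have "(\<integral>x. exp (w k x) \<partial>M) > 0" by (smt (verit) exp_gt_zero)
    then have "ln (\<integral>x. exp (w k x) \<partial>M) \<le> ln (1 + exp (- real k))"
      using le1 by simp
    also have "\<dots> \<le> exp (- real k)" by (rule ln_add_one_self_le_self) simp
    finally have "ln (\<integral>x. exp (w k x) \<partial>M) \<le> exp (- real k)" .
    moreover have "(\<integral>x. w k x \<partial>N) - ln (\<integral>x. exp (w k x) \<partial>M) \<le> d"
      using le[OF wm wb] .
    ultimately show ?thesis unfolding Nf by linarith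
  qed
  have pos: "AE x in density M f. f x > 0"
    using f0 by (simp add: AE_density less_le)
  define p where "p x = max 0 (ln (f x))" for x
  define q where "q x = max 0 (- ln (f x))" for x
  have [measurable]: "p \<in> borel_measurable M" "q \<in> borel_measurable M" unfolding p_def q_def by measurable
  have qM: "f x * q x \<le> 1" "0 \<le> f x * q x" for x
    using mult_ln_ge_minus_one[OF f0, of x] f0[of x] by (auto simp: q_def max_def algebra_simps)
  have qMi: "integrable M (\<lambda>x. f x * q x)"
    by (rule integrable_const_bound[of _ 1]) (use qM in auto)
  have qi: "integrable (density M f) q"
    using qMi f0 by (subst integrable_real_density) auto
  have "(\<integral>x. f x * q x \<partial>M) \<le> 1"
    by (rule integral_le_const[OF qMi]) (use qM in auto)
  then have q1: "(\<integral>x. q x \<partial>density M f) \<le> 1"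
    using f0 by (subst integral_real_density) auto
  have pi: "integrable (density M f) p"
  proof (rule integrableI_bounded)
    have "(\<integral>\<^sup>+ x. ennreal (norm (p x)) \<partial>density M f) = (\<integral>\<^sup>+ x. (SUP k. ennreal (min (real k) (p x))) \<partial>density M f)"
    proof (rule nn_integral_cong)
      fix x
      obtain k where k: "p x \<le> real k" using real_arch_simple by blast
      show "ennreal (norm (p x)) = (SUP k. ennreal (min (real k) (p x)))"
      proof (rule antisym)
        show "ennreal (norm (p x)) \<le> (SUP k. ennreal (min (real k) (p x)))"
          by (rule SUP_upper2[of k]) (use k in \<open>auto simp: p_def\<close>)
        show "(SUP k. ennreal (min (real k) (p x))) \<le> ennreal (norm (p x))"
          by (rule SUP_least, rule ennreal_leI, rule min.coboundedI2) simp
      qed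
    qed
    also have "\<dots> = (SUP k. (\<integral>\<^sup>+ x. ennreal (min (real k) (p x)) \<partial>density M f))"
      by (rule nn_integral_monotone_convergence_SUP)
        (auto simp: incseq_def le_fun_def intro!: ennreal_leI)
    \<comment> \<open>The truncation bound gives \<open>d + exp (- real k) \<le> d + 1\<close>, and
      the negative part of \<open>ln f\<close> contributes at most 1 more.\<close>
    also have "\<dots> \<le> ennreal (d + 2)"
    proof (rule SUP_least)
      fix k
      have i: "integrable (density M f) (\<lambda>x. min (real k) (p x))"
        by (rule N.integrable_const_bound[of _ "real k"]) (auto simp: p_def)
      have "(\<integral>x. min (real k) (p x) \<partial>density M f) \<le> (\<integral>x. w k x + q x \<partial>density M f)"
      proof (rule integral_mono_AE)
        show "AE x in density M f. min (real k) (p x) \<le> w k x + q x"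
          using pos
        proof eventually_elim
          case (elim x)
          have "min K (max 0 y) \<le> max (- K) (min K y) + max 0 (- y)" if "K \<ge> 0" for K y :: real
            using that by (auto simp: min_def max_def)
          from this[of "real k" "ln (f x)"] show ?case
            using elim by (simp add: p_def q_def w_def)
        qed
      qed (use i wi qi in auto)
      also have "\<dots> = (\<integral>x. w k x \<partial>density M f) + (\<integral>x. q x \<partial>density M f)"
        using wi qi by simp
      also have "\<dots> \<le> d + exp (- real k) + 1" using bound q1 by (intro add_mono)
      also have "\<dots> \<le> d + 2" by simp
      finally have "(\<integral>x. min (real k) (p x) \<partial>density M f) \<le> d + 2" .
      then show "(\<integral>\<^sup>+ x. ennreal (min (real k) (p x)) \<partial>density M f) \<le> ennreal (d + 2)"
        by (subst nn_integral_eq_integral[OF i]) (auto simp: p_def intro!: ennreal_leI)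
    qed
    finally show "(\<integral>\<^sup>+ x. ennreal (norm (p x)) \<partial>density M f) < \<infinity>"
      by (simp add: order_le_less_trans)
  qed simp
  have li: "integrable (density M f) (\<lambda>x. ln (f x))"
  proof -
    have "(\<lambda>x. ln (f x)) = (\<lambda>x. p x - q x)" by (auto simp: p_def q_def)
    then show ?thesis using pi qi by simp
  qed
  have lim: "(\<lambda>k. \<integral>x. w k x \<partial>density M f) \<longlonglongrightarrow> (\<integral>x. ln (f x) \<partial>density M f)"
  proof (rule integral_dominated_convergence[where w="\<lambda>x. \<bar>ln (f x)\<bar>"])
    show "AE x in density M f. (\<lambda>k. w k x) \<longlonglongrightarrow> ln (f x)"
      using pos
    proof eventually_elim
      case (elim x)
      obtain K where K: "\<bar>ln (f x)\<bar> \<le> real K" using real_arch_simple by blast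
      have "eventually (\<lambda>k. w k x = ln (f x)) sequentially"
        using eventually_ge_at_top[of K]
      proof eventually_elim
        case (elim k)
        then have "real K \<le> real k" by simp
        then show ?case using K \<open>f x > 0\<close> by (auto simp: w_def)
      qed
      then show ?case by (rule tendsto_eventually)
    qed
    show "AE x in density M f. norm (w k x) \<le> \<bar>ln (f x)\<bar>" for k
      using pos by eventually_elim (auto simp: w_def)
  qed (use li in auto)
  have "(\<lambda>k. d + exp (- real k)) \<longlonglongrightarrow> d + 0"
    by (intro tendsto_intros filterlim_compose[OF exp_at_bot] filterlim_compose[OF filterlim_uminus_at_bot_at_top]
        filterlim_real_sequentially)
  then have "(\<integral>x. ln (f x) \<partial>density M f) \<le> d"
    using LIMSEQ_le[OF lim] bound by auto
  then show ?thesis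
    unfolding Nf by (subst rel_entropy_density) (use f0 li in auto)
qed

text \<open>Serves the uniqueness of the minimiser. The midpoint measure has density
  \<open>(f + g) / 2\<close>; by strict convexity of \<open>t ln t\<close>, equality of the
  integrals would force \<open>f = g\<close> almost everywhere. The last conclusion lets convex
  functionals of integrals, such as the energy, be compared at the same measure.\<close>

lemma (in prob_space) rel_entropy_strict_midpoint:
  assumes N1: "prob_space N1" "sets N1 = sets M" and N2: "prob_space N2" "sets N2 = sets M"
    and e1: "rel_entropy M N1 = ereal d1" and e2: "rel_entropy M N2 = ereal d2" and "N1 \<noteq> N2"
  obtains N where "prob_space N" "sets N = sets M" "rel_entropy M N < ereal ((d1 + d2) / 2)"
    "\<And>(u::'a \<Rightarrow> real) B. u \<in> borel_measurable M \<Longrightarrow> (\<And>x. x \<in> space M \<Longrightarrow> \<bar>u x\<bar> \<le> B) \<Longrightarrow>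
      (\<integral>x. u x \<partial>N) = ((\<integral>x. u x \<partial>N1) + (\<integral>x. u x \<partial>N2)) / 2"
proof -
  obtain f where f[measurable]: "f \<in> borel_measurable M" and f0: "\<And>x. 0 \<le> f x"
    and Nf: "N1 = density M f" and fl: "integrable (density M f) (\<lambda>x. ln (f x))"
    using rel_entropy_finiteE[OF N1] e1 by (metis PInfty_neq_ereal(1))
  obtain g where g[measurable]: "g \<in> borel_measurable M" and g0: "\<And>x. 0 \<le> g x"
    and Ng: "N2 = density M g" and gl: "integrable (density M g) (\<lambda>x. ln (g x))"
    using rel_entropy_finiteE[OF N2] e2 by (metis PInfty_neq_ereal(1))
  interpret F: prob_space "density M f" using N1 Nf by simp
  interpret G: prob_space "density M g" using N2 Ng by simp
  have fi: "integrable M f" "(\<integral>x. f x \<partial>M) = 1" and gi: "integrable M g" "(\<integral>x. g x \<partial>M) = 1"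
    using prob_density_real[OF f f0 F.prob_space_axioms] prob_density_real[OF g g0 G.prob_space_axioms]
    by auto
  define h where "h x = (f x + g x) / 2" for x
  have h[measurable]: "h \<in> borel_measurable M" unfolding h_def by measurable
  have h0: "0 \<le> h x" for x using f0 g0 by (simp add: h_def)
  have hi: "integrable M h" "(\<integral>x. h x \<partial>M) = 1"
    using fi gi by (simp_all add: h_def[abs_def])
  have ph: "prob_space (density M h)"
    by (rule prob_spaceI) (use hi h0 in \<open>simp add: emeasure_density nn_integral_eq_integral cong: nn_integral_cong\<close>)
  interpret H: prob_space "density M h" by fact
  have fl': "integrable M (\<lambda>x. f x * ln (f x))" and gl': "integrable M (\<lambda>x. g x * ln (g x))"
    using fl gl f0 g0 by (simp_all add: integrable_real_density)
  have d1: "d1 = (\<integral>x. f x * ln (f x) \<partial>M)"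
    using e1 rel_entropy_density[OF f f0 fl] f0 unfolding Nf by (simp add: integral_real_density)
  have d2: "d2 = (\<integral>x. g x * ln (g x) \<partial>M)"
    using e2 rel_entropy_density[OF g g0 gl] g0 unfolding Ng by (simp add: integral_real_density)
  have le: "h x * ln (h x) \<le> (f x * ln (f x) + g x * ln (g x)) / 2" for x
    using mult_ln_strict_midpoint[OF f0 g0, of x x] by (cases "f x = g x") (auto simp: h_def)
  have avgi: "integrable M (\<lambda>x. (f x * ln (f x) + g x * ln (g x)) / 2)" using fl' gl' by simp
  have hl': "integrable M (\<lambda>x. h x * ln (h x))"
  proof (rule Bochner_Integration.integrable_bound)
    show "integrable M (\<lambda>x. \<bar>(f x * ln (f x) + g x * ln (g x)) / 2\<bar> + 1)"
      by (intro Bochner_Integration.integrable_add integrable_abs avgi) simp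
    show "AE x in M. norm (h x * ln (h x)) \<le> norm (\<bar>(f x * ln (f x) + g x * ln (g x)) / 2\<bar> + 1)"
    proof (rule AE_I2)
      fix x show "norm (h x * ln (h x)) \<le> norm (\<bar>(f x * ln (f x) + g x * ln (g x)) / 2\<bar> + 1)"
        using le[of x] mult_ln_ge_minus_one[OF h0, of x] by (simp only: real_norm_def)
    qed
  qed simp
  have hl: "integrable (density M h) (\<lambda>x. ln (h x))"
    using hl' h0 by (simp add: integrable_real_density)
  have lt: "(\<integral>x. h x * ln (h x) \<partial>M) < (d1 + d2) / 2"
  proof (rule ccontr)
    assume "\<not> ?thesis"
    moreover have "(d1 + d2) / 2 = (\<integral>x. (f x * ln (f x) + g x * ln (g x)) / 2 \<partial>M)"
      using fl' gl' by (simp add: d1 d2)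
    ultimately have "(\<integral>x. (f x * ln (f x) + g x * ln (g x)) / 2 - h x * ln (h x) \<partial>M) \<le> 0"
      using avgi hl' by (subst Bochner_Integration.integral_diff) auto
    moreover have "(\<integral>x. (f x * ln (f x) + g x * ln (g x)) / 2 - h x * ln (h x) \<partial>M) \<ge> 0"
      by (rule integral_nonneg_AE) (use le in simp)
    ultimately have "(\<integral>x. (f x * ln (f x) + g x * ln (g x)) / 2 - h x * ln (h x) \<partial>M) = 0" by simp
    then have "AE x in M. (f x * ln (f x) + g x * ln (g x)) / 2 - h x * ln (h x) = 0"
      by (subst (asm) integral_nonneg_eq_0_iff_AE) (use avgi hl' le in auto)
    then have "AE x in M. f x = g x"
    proof eventually_elim
      case (elim x)
      then show ?case
        using mult_ln_strict_midpoint[OF f0 g0, of x x] by (auto simp: h_def)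
    qed
    then have "density M f = density M g" by (intro density_cong) auto
    then show False using \<open>N1 \<noteq> N2\<close> Nf Ng by simp
  qed
  show thesis
  proof (rule that[of "density M h"])
    show "rel_entropy M (density M h) < ereal ((d1 + d2) / 2)"
      using lt h0 hl by (subst rel_entropy_density) (auto simp: integral_real_density)
    fix u :: "'a \<Rightarrow> real" and B
    assume u[measurable]: "u \<in> borel_measurable M" and B: "\<And>x. x \<in> space M \<Longrightarrow> \<bar>u x\<bar> \<le> B"
    have "integrable (density M f) u" "integrable (density M g) u"
      using B by (auto intro!: F.integrable_const_bound[of _ B] G.integrable_const_bound[of _ B] AE_I2)
    then have "integrable M (\<lambda>x. f x * u x)" "integrable M (\<lambda>x. g x * u x)"
      using f0 g0 by (simp_all add: integrable_real_density)
    then show "(\<integral>x. u x \<partial>density M h) = ((\<integral>x. u x \<partial>N1) + (\<integral>x. u x \<partial>N2)) / 2"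
      using integral_real_density[OF h _ u] f0 g0 h0
      by (simp add: Nf Ng integral_real_density) (simp add: h_def add_divide_distrib distrib_right)
  qed (use ph in auto)
qed

subsection \<open>Bounded Borel functions and the weak topology\<close>

lemma prob_measuresD:
  assumes "\<mu> \<in> prob_measures X"
  shows "prob_space \<mu>" "sets \<mu> = sets (restrict_space borel X)" "space \<mu> = X"
    "borel_measurable \<mu> = borel_measurable (restrict_space borel X)"
  using assms by (auto simp: prob_measures_def space_restrict_space dest: sets_eq_imp_space_eq cong: measurable_cong_sets)

lemma compact_continuous_bounded:
  fixes u :: "'a::topological_space \<Rightarrow> real"
  assumes "compact X" "continuous_on X u"
  obtains B where "B > 0" "\<And>x. x \<in> X \<Longrightarrow> \<bar>u x\<bar> \<le> B"
proof -
  have "bounded (u ` X)"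
    by (rule compact_imp_bounded[OF compact_continuous_image[OF assms(2,1)]])
  then show thesis using that by (auto simp: bounded_pos)
qed

text \<open>Test functions for the entropy half of the duality. They contain the indicators, from
  which a set function can be read off. The bound is asked on \<open>X\<close> only, matching
  measures whose space is \<open>X\<close>.\<close>

definition bounded_borel :: "'a::topological_space set \<Rightarrow> ('a \<Rightarrow> real) set" where
  "bounded_borel X = {w \<in> borel_measurable (restrict_space borel X). \<exists>B. \<forall>x\<in>X. \<bar>w x\<bar> \<le> B}"

lemma bounded_borelE:
  assumes "w \<in> bounded_borel X"
  obtains B where "B > 0" "\<And>x. x \<in> X \<Longrightarrow> \<bar>w x\<bar> \<le> B"
proof -
  obtain B where "\<forall>x\<in>X. \<bar>w x\<bar> \<le> B" using assms by (auto simp: bounded_borel_def)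
  then show thesis using that[of "max B 1"] by fastforce
qed

lemma bounded_borel_measurable:
  "w \<in> bounded_borel X \<Longrightarrow> w \<in> borel_measurable (restrict_space borel X)"
  by (simp add: bounded_borel_def)

lemma bounded_borelI:
  "w \<in> borel_measurable (restrict_space borel X) \<Longrightarrow> (\<And>x. x \<in> X \<Longrightarrow> \<bar>w x\<bar> \<le> B) \<Longrightarrow> w \<in> bounded_borel X"
  by (auto simp: bounded_borel_def)

lemma continuous_bounded_borel:
  "compact X \<Longrightarrow> continuous_on X u \<Longrightarrow> u \<in> bounded_borel X"
  by (metis bounded_borelI borel_measurable_continuous_on_restrict compact_continuous_bounded)

lemma bounded_borel_add:
  assumes "v \<in> bounded_borel X" "w \<in> bounded_borel X"
  shows "(\<lambda>x. v x + w x) \<in> bounded_borel X"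
proof -
  obtain A where A: "\<And>x. x \<in> X \<Longrightarrow> \<bar>v x\<bar> \<le> A"
    using bounded_borelE[OF assms(1)] by blast
  obtain B where B: "\<And>x. x \<in> X \<Longrightarrow> \<bar>w x\<bar> \<le> B"
    using bounded_borelE[OF assms(2)] by blast
  have "\<bar>v x + w x\<bar> \<le> A + B" if "x \<in> X" for x
    using A[OF that] B[OF that] by linarith
  then show ?thesis
    using borel_measurable_add[OF assms[THEN bounded_borel_measurable]]
    unfolding bounded_borel_def by blast
qed

lemma bounded_borel_cmult:
  assumes "w \<in> bounded_borel X"
  shows "(\<lambda>x. c * w x) \<in> bounded_borel X"
proof -
  obtain B where B: "\<And>x. x \<in> X \<Longrightarrow> \<bar>w x\<bar> \<le> B"
    using bounded_borelE[OF assms] by blast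
  have "\<bar>c * w x\<bar> \<le> \<bar>c\<bar> * B" if "x \<in> X" for x
    using B[OF that] by (simp add: abs_mult mult_left_mono)
  moreover have "(\<lambda>x. c * w x) \<in> borel_measurable (restrict_space borel X)"
    using bounded_borel_measurable[OF assms] by simp
  ultimately show ?thesis unfolding bounded_borel_def by blast
qed

lemma bounded_borel_diff:
  assumes "v \<in> bounded_borel X" "w \<in> bounded_borel X"
  shows "(\<lambda>x. v x - w x) \<in> bounded_borel X"
  using bounded_borel_add[OF assms(1) bounded_borel_cmult[OF assms(2), of "-1"]] by simp

lemma bounded_borel_const: "(\<lambda>x. c) \<in> bounded_borel X"
  by (rule bounded_borelI[of _ _ "\<bar>c\<bar>"]) auto

lemma bounded_borel_indicator:
  "A \<in> sets (restrict_space borel X) \<Longrightarrow> indicator A \<in> bounded_borel X"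
  by (rule bounded_borelI[of _ _ 1]) (auto simp: indicator_def)

lemma bounded_borel_sum:
  "(\<And>i. i \<in> I \<Longrightarrow> w i \<in> bounded_borel X) \<Longrightarrow> (\<lambda>x. \<Sum>i\<in>I. w i x) \<in> bounded_borel X"
  by (induction I rule: infinite_finite_induct) (auto intro: bounded_borel_const bounded_borel_add)

lemma integrable_bounded_borel:
  assumes "\<mu> \<in> prob_measures X" "w \<in> bounded_borel X"
  shows "integrable \<mu> w"
proof -
  interpret prob_space \<mu> using prob_measuresD[OF assms(1)] by simp
  obtain B where "\<And>x. x \<in> X \<Longrightarrow> \<bar>w x\<bar> \<le> B"
    using bounded_borelE[OF assms(2)] by blast
  then show ?thesis
    using prob_measuresD[OF assms(1)] bounded_borel_measurable[OF assms(2)]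
    by (intro integrable_const_bound[of _ B]) auto
qed

text \<open>Induction over the generation of the topology: an intersection takes the union of both
  test families and the smaller radius, a union keeps the data of a member that contains the
  point.\<close>

lemma weak_topology_neighbourhood:
  assumes "openin (weak_topology X) G" "\<mu> \<in> G"
  obtains U \<eta> where "finite U" "\<And>u. u \<in> U \<Longrightarrow> continuous_on X u" "\<eta> > (0::real)"
    "\<And>\<nu>. \<nu> \<in> prob_measures X \<Longrightarrow> (\<And>u. u \<in> U \<Longrightarrow> \<bar>(\<integral>x. u x \<partial>\<nu>) - (\<integral>x. u x \<partial>\<mu>)\<bar> < \<eta>) \<Longrightarrow> \<nu> \<in> G"
proof -
  let ?S = "{{\<mu> \<in> prob_measures X. (\<integral>x. u x \<partial>\<mu>) \<in> U} | (u :: 'a \<Rightarrow> real) U. continuous_on X u \<and> open U}"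
  have "generate_topology_on ?S G"
    using assms(1) unfolding weak_topology_def openin_topology_generated_by_iff .
  then have "\<mu> \<in> G \<Longrightarrow> \<exists>U \<eta>. finite U \<and> (\<forall>u\<in>U. continuous_on X u) \<and> \<eta> > (0::real) \<and>
    (\<forall>\<nu>\<in>prob_measures X. (\<forall>u\<in>U. \<bar>(\<integral>x. u x \<partial>\<nu>) - (\<integral>x. u x \<partial>\<mu>)\<bar> < \<eta>) \<longrightarrow> \<nu> \<in> G)"
  proof (induction rule: generate_topology_on.induct)
    case (Int a b)
    then obtain U \<eta> V \<zeta> where *: "finite U" "\<forall>u\<in>U. continuous_on X u" "\<eta> > (0::real)"
      "\<forall>\<nu>\<in>prob_measures X. (\<forall>u\<in>U. \<bar>(\<integral>x. u x \<partial>\<nu>) - (\<integral>x. u x \<partial>\<mu>)\<bar> < \<eta>) \<longrightarrow> \<nu> \<in> a"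
      "finite V" "\<forall>u\<in>V. continuous_on X u" "\<zeta> > (0::real)"
      "\<forall>\<nu>\<in>prob_measures X. (\<forall>u\<in>V. \<bar>(\<integral>x. u x \<partial>\<nu>) - (\<integral>x. u x \<partial>\<mu>)\<bar> < \<zeta>) \<longrightarrow> \<nu> \<in> b"
      by auto
    show ?case
      by (rule exI[of _ "U \<union> V"], rule exI[of _ "min \<eta> \<zeta>"]) (use * in auto)
  next
    case (UN K)
    then obtain k where k: "k \<in> K" "\<mu> \<in> k" by auto
    from UN.IH[OF this] obtain U \<eta> where *: "finite U" "\<forall>u\<in>U. continuous_on X u" "\<eta> > (0::real)"
      "\<forall>\<nu>\<in>prob_measures X. (\<forall>u\<in>U. \<bar>(\<integral>x. u x \<partial>\<nu>) - (\<integral>x. u x \<partial>\<mu>)\<bar> < \<eta>) \<longrightarrow> \<nu> \<in> k"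
      by blast
    show ?case
      by (rule exI[of _ U], rule exI[of _ \<eta>]) (use * k in blast)
  next
    case (Basis s)
    then obtain u :: "'a \<Rightarrow> real" and U where u: "s = {\<mu> \<in> prob_measures X. (\<integral>x. u x \<partial>\<mu>) \<in> U}" "continuous_on X u" "open U"
      by blast
    then have "(\<integral>x. u x \<partial>\<mu>) \<in> U" using Basis by auto
    then obtain \<eta> where "\<eta> > 0" "\<And>y. \<bar>y - (\<integral>x. u x \<partial>\<mu>)\<bar> < \<eta> \<Longrightarrow> y \<in> U"
      using u(3) by (metis open_real_def dist_real_def open_dist)
    then show ?case
      using u by (intro exI[of _ "{u}"] exI[of _ \<eta>]) auto
  qed simp
  then show thesis using that assms(2) by metis
qed

lemma openin_weak_topology_basis:
  fixes u :: "'a::topological_space \<Rightarrow> real"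
  assumes "continuous_on X u" "open U"
  shows "openin (weak_topology X) {\<mu> \<in> prob_measures X. (\<integral>x. u x \<partial>\<mu>) \<in> U}"
  unfolding weak_topology_def by (rule topology_generated_by_Basis) (use assms in blast)

text \<open>Indicators of closed sets are decreasing limits of continuous functions.\<close>

lemma prob_measures_eqI:
  fixes X :: "'a::metric_space set"
  assumes X: "X \<in> sets borel" and \<mu>: "\<mu> \<in> prob_measures X" and \<nu>: "\<nu> \<in> prob_measures X"
    and eq: "\<And>u :: 'a \<Rightarrow> real. continuous_on X u \<Longrightarrow> (\<integral>x. u x \<partial>\<mu>) = (\<integral>x. u x \<partial>\<nu>)"
  shows "\<mu> = \<nu>"
proof -
  note M = prob_measuresD[OF \<mu>] and N = prob_measuresD[OF \<nu>]
  interpret M: prob_space \<mu> by (rule M)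
  interpret N: prob_space \<nu> by (rule N)
  have closed_eq: "emeasure \<mu> (X \<inter> C) = emeasure \<nu> (X \<inter> C)" if C: "closed C" for C
  \<comment> \<open>\<open>infdist\<close> to the empty set is 0 by convention, so the functions
    \<open>v k\<close> below would not tend to its indicator.\<close>
  proof (cases "C = {}")
    case False
    define v where "v k x = max 0 (1 - real k * infdist x C)" for k and x :: 'a
    have vc: "continuous_on A (v k)" for k A unfolding v_def by (intro continuous_intros)
    have vm: "v k \<in> borel_measurable (restrict_space borel X)" for k
      by (rule borel_measurable_continuous_on_restrict[OF vc])
    have lim: "(\<lambda>k. v k x) \<longlonglongrightarrow> indicator (X \<inter> C) x" if "x \<in> X" for x
    proof (cases "x \<in> C")
      case True
      then show ?thesis using that by (simp add: v_def)
    next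
      case out: False
      have "infdist x C > 0" using out False C by (metis infdist_pos_not_in_closed)
      then obtain K where K: "1 < real K * infdist x C" using reals_Archimedean3 by blast
      have "eventually (\<lambda>k. v k x = 0) sequentially"
        using eventually_ge_at_top[of K]
      proof eventually_elim
        case (elim k)
        then have "real K * infdist x C \<le> real k * infdist x C"
          by (intro mult_right_mono) (auto simp: infdist_nonneg)
        then show ?case using K by (simp add: v_def)
      qed
      then show ?thesis using out by (simp add: tendsto_eventually)
    qed
    have XC: "X \<inter> C \<in> sets (restrict_space borel X)"
      using C by (auto simp: sets_restrict_space)
    have *: "(\<lambda>k. \<integral>x. v k x \<partial>\<rho>) \<longlonglongrightarrow> measure \<rho> (X \<inter> C)" if \<rho>: "\<rho> \<in> prob_measures X" for \<rho>
    proof -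
      note R = prob_measuresD[OF \<rho>]
      interpret R: prob_space \<rho> by (rule R)
      have "(\<lambda>k. \<integral>x. v k x \<partial>\<rho>) \<longlonglongrightarrow> (\<integral>x. indicator (X \<inter> C) x \<partial>\<rho>)"
      proof (rule integral_dominated_convergence[where w="\<lambda>_. 1"])
        show "AE x in \<rho>. (\<lambda>k. v k x) \<longlonglongrightarrow> indicator (X \<inter> C) x"
          using lim R by (intro AE_I2) simp
        show "AE x in \<rho>. norm (v k x) \<le> 1" for k
          by (auto simp: v_def infdist_nonneg)
      qed (use vm XC R in auto)
      moreover have "X \<inter> C \<inter> X = X \<inter> C" by blast
      ultimately show ?thesis using XC R by simp
    qed
    have "measure \<mu> (X \<inter> C) = measure \<nu> (X \<inter> C)"
      using LIMSEQ_unique[OF *[OF \<mu>]] *[OF \<nu>] eq[OF vc] by simp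
    then show ?thesis by (simp add: M.emeasure_eq_measure N.emeasure_eq_measure)
  qed simp
  show ?thesis
  proof (rule measure_eqI_generator_eq[where \<Omega>=X and A="\<lambda>_. X" and E="(\<inter>) X ` {C. closed C}"])
    show "Int_stable ((\<inter>) X ` {C. closed C})"
    proof (rule Int_stableI_image)
      fix C D :: "'a set" assume "C \<in> {C. closed C}" "D \<in> {C. closed C}"
      then show "\<exists>k\<in>{C. closed C}. X \<inter> C \<inter> (X \<inter> D) = X \<inter> k"
        by (intro bexI[of _ "C \<inter> D"]) auto
    qed
    have "sets (restrict_space borel X) = (\<inter>) X ` sigma_sets UNIV (Collect closed)"
      by (simp add: sets_restrict_space borel_eq_closed)
    also have "\<dots> = sigma_sets X ((\<inter>) X ` {C. closed C})"
      by (rule sigma_sets_Int) (use X in \<open>simp_all add: borel_eq_closed\<close>)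
    finally have "sets (restrict_space borel X) = sigma_sets X ((\<inter>) X ` {C. closed C})" .
    then show "sets \<mu> = sigma_sets X ((\<inter>) X ` {C. closed C})" "sets \<nu> = sigma_sets X ((\<inter>) X ` {C. closed C})"
      using M N by auto
  qed (use closed_eq M N in auto)
qed

text \<open>Needed to conclude that compact sublevel sets are closed, hence lower semicontinuity. A
  single continuous test function separates two distinct measures.\<close>

lemma Hausdorff_weak_topology: "X \<in> sets borel \<Longrightarrow> Hausdorff_space (weak_topology (X :: 'a::metric_space set))"
  unfolding Hausdorff_space_def topspace_weak_topology
proof (intro allI impI)
  assume X: "X \<in> sets borel"
  fix \<mu> \<nu> assume *: "\<mu> \<in> prob_measures X \<and> \<nu> \<in> prob_measures X \<and> \<mu> \<noteq> \<nu>"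
  then obtain u :: "'a \<Rightarrow> real" where u: "continuous_on X u" "(\<integral>x. u x \<partial>\<mu>) \<noteq> (\<integral>x. u x \<partial>\<nu>)"
    using prob_measures_eqI[OF X] by metis
  obtain U V where UV: "open U" "open V" "(\<integral>x. u x \<partial>\<mu>) \<in> U" "(\<integral>x. u x \<partial>\<nu>) \<in> V" "U \<inter> V = {}"
    using hausdorff[OF u(2)] by blast
  show "\<exists>U V. openin (weak_topology X) U \<and> openin (weak_topology X) V \<and> \<mu> \<in> U \<and> \<nu> \<in> V \<and> disjnt U V"
    using openin_weak_topology_basis[OF u(1) UV(1)] openin_weak_topology_basis[OF u(1) UV(2)] UV *
    by (intro exI[of _ "{\<mu> \<in> prob_measures X. (\<integral>x. u x \<partial>\<mu>) \<in> U}"]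
        exI[of _ "{\<mu> \<in> prob_measures X. (\<integral>x. u x \<partial>\<mu>) \<in> V}"]) (auto simp: disjnt_def)
qed

subsection \<open>Finitely additive means\<close>

text \<open>Finitely additive probabilities, encoded as functionals on all bounded Borel functions; the
  value \<open>0\<close> off \<^const>\<open>bounded_borel\<close> keeps the set compact. Being positive is the one-sided
  bound by suprema.\<close>

definition mean_functionals :: "'a::topological_space set \<Rightarrow> (('a \<Rightarrow> real) \<Rightarrow> real) set" where
  "mean_functionals X = {l.
     (\<forall>v\<in>bounded_borel X. \<forall>w\<in>bounded_borel X. l (\<lambda>x. v x + w x) = l v + l w) \<and>
     (\<forall>c. \<forall>w\<in>bounded_borel X. l (\<lambda>x. c * w x) = c * l w) \<and>
     (\<forall>w\<in>bounded_borel X. \<forall>c. (\<forall>x\<in>X. w x \<le> c) \<longrightarrow> l w \<le> c) \<and>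
     (\<forall>w. w \<notin> bounded_borel X \<longrightarrow> l w = 0)}"

context
  fixes X :: "'a::topological_space set" and l
  assumes l: "l \<in> mean_functionals X"
begin

lemma mean_functional_add: "v \<in> bounded_borel X \<Longrightarrow> w \<in> bounded_borel X \<Longrightarrow> l (\<lambda>x. v x + w x) = l v + l w"
  and mean_functional_cmult: "w \<in> bounded_borel X \<Longrightarrow> l (\<lambda>x. c * w x) = c * l w"
  and mean_functional_le: "w \<in> bounded_borel X \<Longrightarrow> (\<And>x. x \<in> X \<Longrightarrow> w x \<le> c) \<Longrightarrow> l w \<le> c"
  using l by (auto simp: mean_functionals_def)

lemma mean_functional_diff:
  assumes "v \<in> bounded_borel X" "w \<in> bounded_borel X"
  shows "l (\<lambda>x. v x - w x) = l v - l w"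
  using mean_functional_add[OF assms(1) bounded_borel_cmult[OF assms(2), of "-1"]]
    mean_functional_cmult[OF assms(2), of "-1"] by simp

lemma mean_functional_ge:
  assumes "w \<in> bounded_borel X" "\<And>x. x \<in> X \<Longrightarrow> c \<le> w x"
  shows "c \<le> l w"
  using mean_functional_le[OF bounded_borel_cmult[OF assms(1), of "-1"], of "- c"] assms(2)
    mean_functional_cmult[OF assms(1), of "-1"] by simp

lemma mean_functional_const: "l (\<lambda>x. c) = c"
  using mean_functional_le[OF bounded_borel_const, of c c] mean_functional_ge[OF bounded_borel_const, of c c]
  by simp

lemma mean_functional_close:
  assumes "v \<in> bounded_borel X" "w \<in> bounded_borel X" "\<And>x. x \<in> X \<Longrightarrow> \<bar>v x - w x\<bar> \<le> \<epsilon>"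
  shows "\<bar>l v - l w\<bar> \<le> \<epsilon>"
proof -
  note d = bounded_borel_diff[OF assms(1,2)]
  have "l (\<lambda>x. v x - w x) \<le> \<epsilon>"
    by (rule mean_functional_le[OF d]) (use assms(3) in \<open>auto simp: abs_le_iff\<close>)
  moreover have "- \<epsilon> \<le> l (\<lambda>x. v x - w x)"
    by (rule mean_functional_ge[OF d]) (use assms(3) in \<open>force simp: abs_le_iff\<close>)
  ultimately show ?thesis using mean_functional_diff[OF assms(1,2)] by simp
qed

lemma mean_functional_cong:
  assumes "v \<in> bounded_borel X" "w \<in> bounded_borel X" "\<And>x. x \<in> X \<Longrightarrow> v x = w x"
  shows "l v = l w"
  using mean_functional_close[OF assms(1,2), of 0] assms(3) by simp

lemma mean_functional_sum:
  "(\<And>i. i \<in> I \<Longrightarrow> w i \<in> bounded_borel X) \<Longrightarrow> l (\<lambda>x. \<Sum>i\<in>I. w i x) = (\<Sum>i\<in>I. l (w i))"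
proof (induction I rule: infinite_finite_induct)
  case (insert i I)
  then show ?case
    using mean_functional_add[of "w i" "\<lambda>x. \<Sum>i\<in>I. w i x"] bounded_borel_sum[of I w X] by simp
qed (simp_all add: mean_functional_const)

end

text \<open>The one-sided bounds, applied to \<open>w\<close> and its negative, confine the value at
  \<open>w\<close> to a compact interval. Each defining condition is an equation or weak inequality
  between finitely many coordinates, hence closed in the product topology, so the means form a
  closed subset of a product of intervals.\<close>

lemma compact_mean_functionals: "compact (mean_functionals X)"
proof -
  define b where "b w = (if w \<in> bounded_borel X then (SOME b. \<forall>x\<in>X. \<bar>w x\<bar> \<le> b) else 0)" for w :: "'a \<Rightarrow> real"
  have b: "\<bar>w x\<bar> \<le> b w" if "w \<in> bounded_borel X" "x \<in> X" for w x
  proof -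
    have "\<exists>b. \<forall>x\<in>X. \<bar>w x\<bar> \<le> b" using that by (auto simp: bounded_borel_def)
    from someI_ex[OF this] show ?thesis using that by (simp add: b_def)
  qed
  have sub: "mean_functionals X \<subseteq> PiE UNIV (\<lambda>w. {- b w..b w})"
  proof
    fix l assume l: "l \<in> mean_functionals X"
    have "l w \<in> {- b w..b w}" for w
    proof (cases "w \<in> bounded_borel X")
      case True
      show ?thesis
        using mean_functional_le[OF l True, of "b w"] mean_functional_ge[OF l True, of "- b w"] b[OF True]
        by (force simp: abs_le_iff)
    next
      case False
      then show ?thesis using l by (simp add: mean_functionals_def b_def)
    qed
    then show "l \<in> PiE UNIV (\<lambda>w. {- b w..b w})" by (simp add: PiE_UNIV_domain)
  qed
  have box: "compact (PiE UNIV (\<lambda>w :: 'a \<Rightarrow> real. {- b w..b w}))"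
  proof -
    have "compactin (product_topology (\<lambda>_. euclidean) UNIV) (PiE UNIV (\<lambda>w :: 'a \<Rightarrow> real. {- b w..b w}))"
      by (subst compactin_PiE) simp
    then show ?thesis by (simp add: euclidean_product_topology)
  qed
  note [continuous_intros] = continuous_on_product_coordinates
  have "closed (mean_functionals X)"
    unfolding mean_functionals_def Ball_def
    by (intro closed_Collect_conj closed_Collect_all closed_Collect_imp closed_Collect_eq closed_Collect_le
        continuous_intros open_Collect_const)
  then show ?thesis
    using compact_Int_closed[OF box, of "mean_functionals X"] sub by (simp add: inf_absorb2)
qed

lemma integral_in_mean_functionals:
  assumes \<mu>: "\<mu> \<in> prob_measures X"
  shows "(\<lambda>w. if w \<in> bounded_borel X then \<integral>x. w x \<partial>\<mu> else 0) \<in> mean_functionals X"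
proof -
  interpret prob_space \<mu> using prob_measuresD[OF \<mu>] by simp
  show ?thesis
    using prob_measuresD[OF \<mu>] integrable_bounded_borel[OF \<mu>]
    by (auto simp: mean_functionals_def bounded_borel_add bounded_borel_cmult intro!: integral_le_const AE_I2)
qed

text \<open>A bound by the cumulant generating function of \<open>\<mu>0\<close> makes \<open>A \<mapsto> l 1\<^sub>A\<close> uniformly absolutely
  continuous with respect to \<open>\<mu>0\<close>, hence countably additive.\<close>

lemma mean_functional_is_integral:
  assumes l: "l \<in> mean_functionals X" and \<mu>0: "\<mu>0 \<in> prob_measures X"
    and bound: "\<And>w. w \<in> bounded_borel X \<Longrightarrow> l w \<le> d + ln (\<integral>x. exp (w x) \<partial>\<mu>0)"
  obtains \<mu> where "\<mu> \<in> prob_measures X" "\<And>w. w \<in> bounded_borel X \<Longrightarrow> l w = (\<integral>x. w x \<partial>\<mu>)"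
proof -
  let ?R = "restrict_space borel X"
  note M0 = prob_measuresD[OF \<mu>0]
  interpret M0: prob_space \<mu>0 by (rule M0)
  define m where "m A = l (indicator A)" for A
  have bi: "A \<in> sets ?R \<Longrightarrow> indicator A \<in> bounded_borel X" for A by (rule bounded_borel_indicator)
  have m0: "0 \<le> m A" if "A \<in> sets ?R" for A
    unfolding m_def by (rule mean_functional_ge[OF l bi[OF that]]) simp
  have ac: "t * m A \<le> d + ln (1 + (exp t - 1) * measure \<mu>0 A)" if A: "A \<in> sets ?R" and "t > 0" for t A
  proof -
    have "t * m A = l (\<lambda>x. t * indicator A x)"
      using mean_functional_cmult[OF l bi[OF A], of t] by (simp add: m_def)
    also have "\<dots> \<le> d + ln (\<integral>x. exp (t * indicator A x) \<partial>\<mu>0)"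
      by (rule bound) (rule bounded_borel_cmult[OF bi[OF A]])
    also have "(\<integral>x. exp (t * indicator A x) \<partial>\<mu>0) = (\<integral>x. 1 + (exp t - 1) * indicator A x \<partial>\<mu>0)"
      by (intro Bochner_Integration.integral_cong) (auto simp: indicator_def)
    also have "\<dots> = 1 + (exp t - 1) * measure \<mu>0 A"
      using A M0 M0.prob_space integrable_bounded_borel[OF \<mu>0 bi[OF A]]
      by (subst Bochner_Integration.integral_add) auto
    finally show ?thesis .
  qed
  have madd: "m (A \<union> B) = m A + m B" if "A \<in> sets ?R" "B \<in> sets ?R" "A \<inter> B = {}" for A B
  proof -
    have "indicator (A \<union> B) = (\<lambda>x. indicator A x + indicator B x :: real)"
      using that by (auto simp: indicator_def fun_eq_iff)
    then show ?thesis using mean_functional_add[OF l bi[OF that(1)] bi[OF that(2)]] by (simp add: m_def)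
  qed
  have m_empty: "m {} = 0"
    using madd[of "{}" "{}"] by simp
  have lim0: "(\<lambda>i. m (A i)) \<longlonglongrightarrow> 0"
    if A: "range A \<subseteq> sets ?R" "decseq A" "(\<Inter>i. A i) = {}" for A :: "nat \<Rightarrow> 'a set"
  proof (rule order_tendstoI)
    fix a :: real assume "a < 0"
    then show "eventually (\<lambda>i. a < m (A i)) sequentially"
      using m0 A by (intro always_eventually) (smt (verit) range_subsetD)
  next
    fix a :: real assume a: "0 < a"
    \<comment> \<open>Chosen so that \<open>t * a > d\<close>. As the \<mu>0-measure of
      \<open>A i\<close> tends to 0, the right-hand side of \<open>ac\<close> tends to
      \<open>d\<close>, drops below \<open>t * a\<close>, and so forces
      \<open>m (A i) < a\<close>.\<close>
    define t where "t = (\<bar>d\<bar> + 1) / a"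
    have t: "t > 0" "t * a > d" using a by (auto simp: t_def intro!: divide_pos_pos)
    have "(\<lambda>i. measure \<mu>0 (A i)) \<longlonglongrightarrow> measure \<mu>0 (\<Inter>i. A i)"
      by (rule M0.finite_Lim_measure_decseq) (use A M0 in auto)
    then have "(\<lambda>i. d + ln (1 + (exp t - 1) * measure \<mu>0 (A i))) \<longlonglongrightarrow> d + ln (1 + (exp t - 1) * 0)"
      using A by (intro tendsto_intros) auto
    then have "eventually (\<lambda>i. d + ln (1 + (exp t - 1) * measure \<mu>0 (A i)) < t * a) sequentially"
      using t by (intro order_tendstoD(2)) auto
    then show "eventually (\<lambda>i. m (A i) < a) sequentially"
    proof eventually_elim
      case (elim i)
      have "t * m (A i) < t * a"
        by (rule le_less_trans[OF ac elim]) (use A t(1) in auto)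
      then show ?case using t by simp
    qed
  qed
  define \<mu> where "\<mu> = measure_of X (sets ?R) (\<lambda>A. ennreal (m A))"
  have sub: "sets ?R \<subseteq> Pow X" by (auto simp: sets_restrict_space)
  have sa: "sigma_algebra X (sets ?R)"
    using sets.sigma_algebra_axioms[of ?R] by (simp add: space_restrict_space)
  interpret R: sigma_algebra X "sets ?R" by (rule sa)
  have ca: "countably_additive (sets ?R) (\<lambda>A. ennreal (m A))"
  proof (rule R.empty_continuous_imp_countably_additive)
    show "positive (sets ?R) (\<lambda>A. ennreal (m A))" by (simp add: positive_def m_empty)
    show "additive (sets ?R) (\<lambda>A. ennreal (m A))"
      by (auto simp: additive_def madd m0 simp flip: ennreal_plus)
    show "(\<lambda>i. ennreal (m (A i))) \<longlonglongrightarrow> 0"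
      if "range A \<subseteq> sets ?R" "decseq A" "(\<Inter>i. A i) = {}" for A :: "nat \<Rightarrow> 'a set"
      using tendsto_ennrealI[OF lim0[OF that]] by simp
  qed simp
  have sets\<mu>: "sets \<mu> = sets ?R" "space \<mu> = X"
    using sub sets.sigma_sets_eq[of ?R] by (simp_all add: \<mu>_def space_restrict_space)
  have em: "emeasure \<mu> A = ennreal (m A)" if "A \<in> sets ?R" for A
    unfolding \<mu>_def
    by (rule emeasure_measure_of[OF refl]) (use sub ca that sets\<mu> in \<open>auto simp: positive_def m_empty \<mu>_def[symmetric]\<close>)
  \<comment> \<open>The indicator of \<open>X\<close> and the constant 1 may differ off
    \<open>X\<close>, and \<open>l\<close> acts on functions on the whole type; their values are
    identified by agreement on \<open>X\<close>.\<close>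
  have "m X = l (\<lambda>x. 1)"
    unfolding m_def by (rule mean_functional_cong[OF l bi bounded_borel_const]) auto
  then have "m X = 1" using mean_functional_const[OF l] by simp
  then have "prob_space \<mu>"
    by (intro prob_spaceI) (use em[of X] sets\<mu> in auto)
  then have \<mu>: "\<mu> \<in> prob_measures X" by (simp add: prob_measures_def sets\<mu>)
  interpret \<mu>: prob_space \<mu> by fact
  have ind: "(\<integral>x. indicator A x \<partial>\<mu>) = m A" if "A \<in> sets ?R" for A
    using em[OF that] that m0[OF that] sets\<mu> sub by (simp add: measure_def Int_absorb2 subset_eq)
  have "l w = (\<integral>x. w x \<partial>\<mu>)" if w: "w \<in> bounded_borel X" for w
  proof -
    obtain B where B: "B > 0" "\<And>x. x \<in> X \<Longrightarrow> \<bar>w x\<bar> \<le> B" using bounded_borelE[OF w] by blast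
    have wm[measurable]: "w \<in> borel_measurable ?R" using bounded_borel_measurable[OF w] .
    \<comment> \<open>Round \<open>w\<close> down to a multiple of \<open>1 / K\<close>. The result
      is a finite combination of indicators, on which \<open>l\<close> and the integral agree; each
      of the two moves by at most \<open>1 / K\<close>, whence the factor 2.\<close>
    have *: "\<bar>l w - (\<integral>x. w x \<partial>\<mu>)\<bar> \<le> 2 * inverse (real (Suc n))" for n
    proof -
      define K where "K = real (Suc n)"
      have K: "K > 0" by (simp add: K_def)
      define J where "J = {\<lfloor>K * (- B)\<rfloor>..\<lfloor>K * B\<rfloor>}"
      define S where "S j = {x \<in> X. \<lfloor>K * w x\<rfloor> = j}" for j
      define v where "v j x = (real_of_int j / K) * indicator (S j) x" for j x
      have Sm: "S j \<in> sets ?R" for j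
      proof -
        have "{x \<in> space ?R. \<lfloor>K * w x\<rfloor> = j} \<in> sets ?R" by measurable
        then show ?thesis by (simp add: S_def space_restrict_space)
      qed
      have vb: "v j \<in> bounded_borel X" for j
        unfolding v_def by (rule bounded_borel_cmult[OF bi[OF Sm]])
      have close: "\<bar>w x - (\<Sum>j\<in>J. v j x)\<bar> \<le> inverse (real (Suc n))" if x: "x \<in> X" for x
      proof -
        have "- B \<le> w x" "w x \<le> B" using B(2)[OF x] by linarith+
        then have "K * (- B) \<le> K * w x" "K * w x \<le> K * B"
          using K by (intro mult_left_mono; simp)+
        then have "\<lfloor>K * w x\<rfloor> \<in> J" unfolding J_def by (meson atLeastAtMost_iff floor_mono)
        then have "(\<Sum>j\<in>J. v j x) = real_of_int \<lfloor>K * w x\<rfloor> / K"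
          using x by (subst sum.remove[of _ "\<lfloor>K * w x\<rfloor>"]) (auto simp: J_def v_def S_def intro!: sum.neutral)
        moreover have "\<bar>w x - real_of_int \<lfloor>K * w x\<rfloor> / K\<bar> \<le> 1 / K"
        proof -
          have "\<bar>K * w x - real_of_int \<lfloor>K * w x\<rfloor>\<bar> \<le> 1" by linarith
          then have "\<bar>K * w x - real_of_int \<lfloor>K * w x\<rfloor>\<bar> / K \<le> 1 / K"
            using K by (intro divide_right_mono) auto
          moreover have "w x - real_of_int \<lfloor>K * w x\<rfloor> / K = (K * w x - real_of_int \<lfloor>K * w x\<rfloor>) / K"
            using K by (simp add: diff_divide_distrib)
          ultimately show ?thesis using K by (simp only: abs_divide abs_of_pos)
        qed
        ultimately show ?thesis by (simp add: K_def inverse_eq_divide)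
      qed
      have sb: "(\<lambda>x. \<Sum>j\<in>J. v j x) \<in> bounded_borel X" by (rule bounded_borel_sum) (rule vb)
      have "l (\<lambda>x. \<Sum>j\<in>J. v j x) = (\<Sum>j\<in>J. real_of_int j / K * m (S j))"
        unfolding mean_functional_sum[OF l vb]
        unfolding v_def m_def by (intro sum.cong refl mean_functional_cmult[OF l bi[OF Sm]])
      also have "\<dots> = (\<Sum>j\<in>J. \<integral>x. v j x \<partial>\<mu>)"
        unfolding v_def by (simp only: integral_mult_right_zero ind[OF Sm])
      also have "\<dots> = (\<integral>x. (\<Sum>j\<in>J. v j x) \<partial>\<mu>)"
        using integrable_bounded_borel[OF \<mu> vb]
        by (intro Bochner_Integration.integral_sum[symmetric])
      finally have eq: "l (\<lambda>x. \<Sum>j\<in>J. v j x) = (\<integral>x. (\<Sum>j\<in>J. v j x) \<partial>\<mu>)" .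
      have "\<bar>(\<integral>x. w x \<partial>\<mu>) - (\<integral>x. (\<Sum>j\<in>J. v j x) \<partial>\<mu>)\<bar> \<le> inverse (real (Suc n))"
        using mean_functional_close[OF integral_in_mean_functionals[OF \<mu>] w sb close] w sb by simp
      moreover have "\<bar>l w - l (\<lambda>x. \<Sum>j\<in>J. v j x)\<bar> \<le> inverse (real (Suc n))"
        by (rule mean_functional_close[OF l w sb close])
      ultimately show ?thesis using eq by linarith
    qed
    have "(\<lambda>n. 2 * inverse (real (Suc n))) \<longlonglongrightarrow> 2 * 0"
      by (intro tendsto_intros LIMSEQ_inverse_real_of_nat)
    then have "\<bar>l w - (\<integral>x. w x \<partial>\<mu>)\<bar> \<le> 2 * 0"
      by (rule LIMSEQ_le_const) (use * in blast)
    then show ?thesis by simp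
  qed
  with \<mu> that show thesis by blast
qed

subsection \<open>Configurations and empirical measures\<close>

lemma space_PiM_config:
  "\<mu> \<in> prob_measures X \<Longrightarrow> space (\<Pi>\<^sub>M i\<in>{..<N}. \<mu>) = config X N"
  by (simp add: space_PiM prob_measuresD)

lemma sets_PiM_config:
  "\<mu> \<in> prob_measures X \<Longrightarrow> sets (\<Pi>\<^sub>M i\<in>{..<N}. \<mu>) = sets (\<Pi>\<^sub>M i\<in>{..<N}. restrict_space borel X)"
  by (intro sets_PiM_cong) (simp_all add: prob_measuresD)

lemma measurable_PiM_config:
  "\<mu> \<in> prob_measures X \<Longrightarrow>
    measurable (\<Pi>\<^sub>M i\<in>{..<N}. \<mu>) M = measurable (\<Pi>\<^sub>M i\<in>{..<N}. restrict_space borel X) M"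
  by (intro measurable_cong_sets sets_PiM_config refl)

text \<open>The Borel sets of the function space are generated by its countably many coordinates,
  and a coordinate beyond \<open>N\<close> is constant on extensional functions. This turns
  continuity of a Hamiltonian, stated in the function space topology, into measurability for product
  measures.\<close>

lemma measurable_id_config:
  "(\<lambda>x. x) \<in> measurable (\<Pi>\<^sub>M i\<in>{..<N}. restrict_space borel X)
     (restrict_space borel (config (X :: 'a::second_countable_topology set) N))"
proof (rule measurable_restrict_space2)
  let ?P = "\<Pi>\<^sub>M i\<in>{..<N}. restrict_space borel X"
  show "(\<lambda>x. x) \<in> space ?P \<rightarrow> config X N" by (auto simp: space_PiM space_restrict_space)
  have "(\<lambda>x. x) \<in> measurable ?P (\<Pi>\<^sub>M i\<in>UNIV. borel)"
  proof (rule measurable_PiM_single')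
    fix i :: nat
    show "(\<lambda>x. x i) \<in> borel_measurable ?P"
    proof (cases "i < N")
      case True
      have "(\<lambda>x. x i) \<in> measurable ?P (restrict_space borel X)"
        using True by (intro measurable_component_singleton) simp
      then show ?thesis by (rule measurable_restrict_space2_iff[THEN iffD1, THEN conjunct1])
    next
      case False
      then have "x i = undefined" if "x \<in> space ?P" for x
        using that by (auto simp: space_PiM PiE_def extensional_def)
      then show ?thesis by (subst measurable_cong[of _ _ "\<lambda>_. undefined"]) auto
    qed
  qed auto
  then show "(\<lambda>x. x) \<in> borel_measurable ?P"
    using measurable_cong_sets[OF refl sets_PiM_equal_borel] by blast
qed

lemma continuous_on_config_measurable:
  fixes h :: "(nat \<Rightarrow> 'a::second_countable_topology) \<Rightarrow> 'b::topological_space"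
  assumes "continuous_on (config X N) h"
  shows "h \<in> borel_measurable (\<Pi>\<^sub>M i\<in>{..<N}. restrict_space borel X)"
  using measurable_compose[OF measurable_id_config borel_measurable_continuous_on_restrict[OF assms]] .

lemma openin_config_measurable:
  fixes X :: "'a::second_countable_topology set"
  assumes "openin (top_of_set (config X N)) S"
  shows "S \<in> sets (\<Pi>\<^sub>M i\<in>{..<N}. restrict_space borel X)"
proof -
  let ?P = "\<Pi>\<^sub>M i\<in>{..<N}. restrict_space borel X"
  obtain T where T: "open T" "S = config X N \<inter> T" using assms by (auto simp: openin_open)
  have "S \<in> sets (restrict_space borel (config X N))"
    using T by (auto simp: sets_restrict_space)
  from measurable_sets[OF measurable_id_config this] have "(\<lambda>x. x) -` S \<inter> space ?P \<in> sets ?P" .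
  moreover have "(\<lambda>x. x) -` S \<inter> space ?P = S" using T by (auto simp: space_PiM space_restrict_space)
  ultimately show ?thesis by simp
qed

text \<open>As the image of the uniform measure on the indices, the empirical measure is visibly a
  probability measure, and integrals against it become finite averages.\<close>

lemma empirical_measure_eq_distr:
  assumes x: "x \<in> config X N" and N: "N > 0"
  shows "empirical_measure X N x = distr (uniform_count_measure {..<N}) (restrict_space borel X) x"
proof -
  let ?R = "restrict_space borel X"
  have eq: "(\<Sum>i<N. emeasure (return ?R (x i)) A) / of_nat N
      = emeasure (uniform_count_measure {..<N}) (x -` A \<inter> space (uniform_count_measure {..<N}))"
    if A: "A \<in> sets ?R" for A
  proof -
    have "(\<Sum>i<N. emeasure (return ?R (x i)) A) = (\<Sum>i<N. if x i \<in> A then 1 else 0)"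
      using A by (intro sum.cong) (auto simp: indicator_def)
    also have "\<dots> = of_nat (card {i \<in> {..<N}. x i \<in> A})"
      by (subst sum.inter_filter[symmetric]) simp_all
    also have "{i \<in> {..<N}. x i \<in> A} = x -` A \<inter> {..<N}" by auto
    finally show ?thesis
      using N by (simp add: emeasure_uniform_count_measure space_uniform_count_measure divide_ennreal
          flip: ennreal_of_nat_eq_real_of_nat)
        (simp add: ennreal_of_nat_eq_real_of_nat divide_ennreal)
  qed
  have "empirical_measure X N x = measure_of X (sets ?R)
      (\<lambda>A. emeasure (uniform_count_measure {..<N}) (x -` A \<inter> space (uniform_count_measure {..<N})))"
    unfolding empirical_measure_def
    by (rule measure_of_eq) (use eq sets.sigma_sets_eq[of ?R] in \<open>auto simp: sets_restrict_space space_restrict_space\<close>)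
  then show ?thesis by (simp add: distr_def space_restrict_space)
qed

lemma config_measurable_count:
  "x \<in> config X N \<Longrightarrow> x \<in> measurable (uniform_count_measure {..<N}) (restrict_space borel X)"
  by (auto simp: measurable_def uniform_count_measure_def point_measure_def space_restrict_space)

lemma empirical_measure_in_prob_measures:
  assumes x: "x \<in> config X N" and N: "N > 0"
  shows "empirical_measure X N x \<in> prob_measures X"
proof -
  interpret prob_space "uniform_count_measure {..<N}"
    by (rule prob_space_uniform_count_measure) (use N in auto)
  show ?thesis
    unfolding empirical_measure_eq_distr[OF x N] prob_measures_def
    using prob_space_distr[OF config_measurable_count[OF x]] by simp
qed

lemma integral_empirical_measure:
  fixes w :: "'a::topological_space \<Rightarrow> real"
  assumes x: "x \<in> config X N" and N: "N > 0" and w: "w \<in> borel_measurable (restrict_space borel X)"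
  shows "(\<integral>y. w y \<partial>empirical_measure X N x) = (\<Sum>i<N. w (x i)) / real N"
  unfolding empirical_measure_eq_distr[OF x N]
  by (subst integral_distr[OF config_measurable_count[OF x] w]) (simp add: integral_uniform_count_measure)

lemma continuous_on_config_sum:
  assumes "continuous_on X u"
  shows "continuous_on (config X N) (\<lambda>x. \<Sum>i<N. u (x i) :: real)"
  by (intro continuous_intros continuous_on_compose2[OF assms] continuous_on_subset[OF continuous_on_product_coordinates])
    auto

text \<open>The target \<sigma>-algebra is generated by all weakly open sets, not only by the
  subbasic ones. Continuity makes their preimages open in the configuration space, and these are
  measurable.\<close>

lemma empirical_measure_continuous:
  fixes X :: "'a::topological_space set"
  assumes N: "N > 0"
  shows "continuous_map (top_of_set (config X N)) (weak_topology X) (empirical_measure X N)"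
  unfolding weak_topology_def
proof (rule continuous_on_generated_topo)
  let ?S = "{{\<mu> \<in> prob_measures X. (\<integral>x. u x \<partial>\<mu>) \<in> U} | (u :: 'a \<Rightarrow> real) U. continuous_on X u \<and> open U}"
  fix W assume "W \<in> ?S"
  then obtain u :: "'a \<Rightarrow> real" and U where u: "continuous_on X u" "open U"
    "W = {\<mu> \<in> prob_measures X. (\<integral>x. u x \<partial>\<mu>) \<in> U}" by blast
  have "empirical_measure X N -` W \<inter> topspace (top_of_set (config X N))
      = config X N \<inter> (\<lambda>x. (\<Sum>i<N. u (x i)) / real N) -` U"
    using integral_empirical_measure[OF _ N borel_measurable_continuous_on_restrict[OF u(1)]]
      empirical_measure_in_prob_measures[OF _ N] u(3) by auto
  also have "openin (top_of_set (config X N)) \<dots>"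
    by (rule continuous_openin_preimage_gen[OF _ u(2)])
      (intro continuous_intros continuous_on_config_sum u, use N in simp)
  finally show "openin (top_of_set (config X N)) (empirical_measure X N -` W \<inter> topspace (top_of_set (config X N)))" .
next
  show "empirical_measure X N ` topspace (top_of_set (config X N)) \<subseteq>
    \<Union> {{\<mu> \<in> prob_measures X. (\<integral>x. u x \<partial>\<mu>) \<in> U} | (u :: 'a \<Rightarrow> real) U. continuous_on X u \<and> open U}"
    using topspace_weak_topology[of X] empirical_measure_in_prob_measures[OF _ N]
    unfolding weak_topology_def topology_generated_by_topspace by auto
qed

lemma space_borel_of_topology [simp]: "space (borel_of_topology T) = topspace T"
  unfolding borel_of_topology_def by (rule space_measure_of) (auto dest: openin_subset)

lemma sets_borel_of_topology: "sets (borel_of_topology T) = sigma_sets (topspace T) {U. openin T U}"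
  unfolding borel_of_topology_def by (rule sets_measure_of) (auto dest: openin_subset)

lemma openin_borel_of_topology: "openin T U \<Longrightarrow> U \<in> sets (borel_of_topology T)"
  by (simp add: sets_borel_of_topology)

lemma closedin_borel_of_topology: "closedin T A \<Longrightarrow> A \<in> sets (borel_of_topology T)"
  using sets.compl_sets[OF openin_borel_of_topology[of T "topspace T - A"]] closedin_subset[of T A]
  by (simp add: closedin_def double_diff)

lemma measurable_empirical_measure:
  fixes X :: "'a::second_countable_topology set"
  assumes N: "N > 0"
  shows "empirical_measure X N \<in>
    measurable (\<Pi>\<^sub>M i\<in>{..<N}. restrict_space borel X) (borel_of_topology (weak_topology X))"
  unfolding borel_of_topology_def
proof (rule measurable_measure_of)
  let ?P = "\<Pi>\<^sub>M i\<in>{..<N}. restrict_space borel X"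
  have sp: "space ?P = config X N" by (simp add: space_PiM space_restrict_space)
  show "{U. openin (weak_topology X) U} \<subseteq> Pow (topspace (weak_topology X))" by (auto dest: openin_subset)
  show "empirical_measure X N \<in> space ?P \<rightarrow> topspace (weak_topology X)"
    using empirical_measure_in_prob_measures[OF _ N] sp by (auto simp: topspace_weak_topology)
  fix G assume "G \<in> {U. openin (weak_topology X) U}"
  then have "openin (top_of_set (config X N)) {x \<in> topspace (top_of_set (config X N)). empirical_measure X N x \<in> G}"
    using empirical_measure_continuous[OF N] by (auto simp: continuous_map_def)
  from openin_config_measurable[OF this]
  show "empirical_measure X N -` G \<inter> space ?P \<in> sets ?P"
    unfolding sp by (simp add: vimage_def Int_def conj_commute)
qed

subsection \<open>Minimal energies and the Laplace principle\<close>

text \<open>A ball of radius \<delta> about a point of \<open>X\<close> contains one of finitely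
  many balls of radius \<delta>/2 that cover \<open>X\<close>, each of positive measure. Uniformity
  in the centre later gives \<open>c ^ N\<close> for a product of \<open>N\<close> balls.\<close>

lemma full_support_uniform_lower_bound:
  fixes X :: "'a::metric_space set"
  assumes X: "compact X" and \<nu>: "\<nu> \<in> prob_measures X" "measure_support \<nu> = X" and "\<delta> > 0"
  obtains c where "c > 0" "\<And>x. x \<in> X \<Longrightarrow> c \<le> measure \<nu> (ball x \<delta> \<inter> X)"
proof -
  note N = prob_measuresD[OF \<nu>(1)]
  interpret prob_space \<nu> by (rule N)
  have meas: "ball x r \<inter> X \<in> sets \<nu>" for x r
    unfolding N(2) sets_restrict_space by (rule image_eqI[of _ _ "ball x r"]) (simp_all only: Int_commute borel_open open_ball)
  have pos: "measure \<nu> (ball x r \<inter> X) > 0" if "x \<in> X" "r > 0" for x r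
  proof -
    have "emeasure \<nu> (ball x r \<inter> X) > 0"
    proof -
      have "x \<in> measure_support \<nu>" using that \<nu>(2) by simp
      then have "\<forall>U. open U \<and> x \<in> U \<longrightarrow> emeasure \<nu> (U \<inter> space \<nu>) > 0" by (simp add: measure_support_def)
      then show ?thesis using that N(3) by simp
    qed
    then show ?thesis by (simp add: emeasure_eq_measure)
  qed
  have "X \<subseteq> (\<Union>x\<in>X. ball x (\<delta>/2))" using \<open>\<delta> > 0\<close> by auto
  then obtain F where F: "F \<subseteq> X" "finite F" "X \<subseteq> (\<Union>x\<in>F. ball x (\<delta>/2))"
    using compactE_image[OF X, of X "\<lambda>x. ball x (\<delta>/2)"] by auto
  define c where "c = Min (insert 1 ((\<lambda>x. measure \<nu> (ball x (\<delta>/2) \<inter> X)) ` F))"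
  show thesis
  proof (rule that[of c])
    show "c > 0"
      unfolding c_def using F pos \<open>\<delta> > 0\<close> by (subst Min_gr_iff) auto
    fix x assume x: "x \<in> X"
    then obtain y where y: "y \<in> F" "x \<in> ball y (\<delta>/2)" using F by auto
    have sub: "ball y (\<delta>/2) \<inter> X \<subseteq> ball x \<delta> \<inter> X"
    proof -
      have "ball y (\<delta>/2) \<subseteq> ball x \<delta>"
      proof
        fix z assume "z \<in> ball y (\<delta>/2)"
        then have "dist y z < \<delta>/2" "dist y x < \<delta>/2" using y by auto
        then have "dist x z < \<delta>" by (rule dist_triangle_half_r[rotated])
        then show "z \<in> ball x \<delta>" by simp
      qed
      then show ?thesis by blast
    qed
    have "c \<le> measure \<nu> (ball y (\<delta>/2) \<inter> X)"
      unfolding c_def using F(2) y(1) by (intro Min_le) auto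
    also have "\<dots> \<le> measure \<nu> (ball x \<delta> \<inter> X)"
      by (rule finite_measure_mono[OF sub meas])
    finally show "c \<le> measure \<nu> (ball x \<delta> \<inter> X)" .
  qed
qed

section \<open>Minimal energy per particle and its identification with the limiting free
  energy\<close>

locale particle_system =
  fixes X :: "'a::euclidean_space set" and H :: "nat \<Rightarrow> (nat \<Rightarrow> 'a) \<Rightarrow> real" and L :: real
  assumes compact_X: "compact X" and X_nonempty: "X \<noteq> {}"
    and ham: "\<And>N. is_hamiltonian X N (H N)"
    and L_nonneg: "0 \<le> L"
    and lip: "\<And>N x y. x \<in> config X N \<Longrightarrow> y \<in> config X N \<Longrightarrow>
      \<bar>H N x - H N y\<bar> \<le> L * (\<Sum>i<N. norm (x i - y i))"
begin

abbreviation conf_energy :: "nat \<Rightarrow> ('a \<Rightarrow> real) \<Rightarrow> (nat \<Rightarrow> 'a) \<Rightarrow> real" where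
  "conf_energy N u x \<equiv> H N x + (\<Sum>i<N. u (x i))"

text \<open>The free energy per particle at zero temperature. It involves neither a reference
  measure nor a sequence of inverse temperatures, and its limit inherits this independence.\<close>

definition min_energy :: "nat \<Rightarrow> ('a \<Rightarrow> real) \<Rightarrow> real" where
  "min_energy N u = (INF x\<in>config X N. conf_energy N u x / real N)"

lemma config_nonempty: "config X N \<noteq> {}"
  using X_nonempty by (simp add: PiE_eq_empty_iff)

lemma X_borel: "X \<in> sets borel"
  using compact_X by (simp add: borel_closed compact_imp_closed)

lemma H_diff_le:
  assumes "x \<in> config X N" "y \<in> config X N"
  shows "\<bar>H N x - H N y\<bar> \<le> real N * (L * diameter X)"
proof -
  have "(\<Sum>i<N. norm (x i - y i)) \<le> (\<Sum>i<N. diameter X)"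
    by (intro sum_mono diameter_bounded_bound[OF compact_imp_bounded[OF compact_X], unfolded dist_norm])
      (use assms in auto)
  then have "L * (\<Sum>i<N. norm (x i - y i)) \<le> L * (real N * diameter X)"
    using L_nonneg by (intro mult_left_mono) auto
  then show ?thesis using lip[OF assms] by (simp add: algebra_simps)
qed

lemma conf_energy_bounded:
  assumes "continuous_on X u"
  obtains B where "\<And>x. x \<in> config X N \<Longrightarrow> \<bar>conf_energy N u x\<bar> \<le> B"
proof -
  obtain B where B: "\<And>x. x \<in> X \<Longrightarrow> \<bar>u x\<bar> \<le> B"
    using compact_continuous_bounded[OF compact_X assms] by metis
  obtain x0 where x0: "x0 \<in> config X N" using config_nonempty by blast
  show thesis
  proof (rule that)
    fix x assume x: "x \<in> config X N"
    have "\<bar>\<Sum>i<N. u (x i)\<bar> \<le> (\<Sum>i<N. \<bar>u (x i)\<bar>)" by (rule sum_abs)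
    also have "\<dots> \<le> (\<Sum>i<N. B)" by (intro sum_mono B) (use x in auto)
    finally have "\<bar>\<Sum>i<N. u (x i)\<bar> \<le> real N * B" by simp
    then show "\<bar>conf_energy N u x\<bar> \<le> \<bar>H N x0\<bar> + real N * (L * diameter X) + real N * B"
      using H_diff_le[OF x x0] by linarith
  qed
qed

lemma min_energy_le:
  assumes u: "continuous_on X u" and x: "x \<in> config X N"
  shows "min_energy N u \<le> conf_energy N u x / real N"
  unfolding min_energy_def
proof (rule cINF_lower[OF _ x])
  obtain B where B: "\<And>x. x \<in> config X N \<Longrightarrow> \<bar>conf_energy N u x\<bar> \<le> B"
    using conf_energy_bounded[OF u] by metis
  have "- B / real N \<le> conf_energy N u x / real N" if "x \<in> config X N" for x
    using B[OF that] by (intro divide_right_mono) (auto simp: abs_le_iff)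
  then show "bdd_below ((\<lambda>x. conf_energy N u x / real N) ` config X N)"
    by (intro bdd_belowI2[of _ "- B / real N"]) 
qed

lemma min_energy_approx:
  assumes "\<epsilon> > 0"
  obtains x where "x \<in> config X N" "conf_energy N u x / real N < min_energy N u + \<epsilon>"
proof -
  have "(INF x\<in>config X N. conf_energy N u x / real N) < min_energy N u + \<epsilon>"
    using assms by (simp add: min_energy_def)
  from cInf_lessD[OF _ this] config_nonempty that show thesis by blast
qed

lemma continuous_conf_energy:
  assumes "continuous_on X u"
  shows "continuous_on (config X N) (conf_energy N u)"
  using ham[of N] continuous_on_config_sum[OF assms, of N]
  by (intro continuous_on_add) (auto simp: is_hamiltonian_def)

lemma integrable_exp_conf_energy:
  assumes \<nu>: "\<nu> \<in> prob_measures X" and u: "continuous_on X u"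
  shows "integrable (\<Pi>\<^sub>M i\<in>{..<N}. \<nu>) (\<lambda>x. exp (- \<beta> * conf_energy N u x))"
proof -
  interpret prob_space "\<Pi>\<^sub>M i\<in>{..<N}. \<nu>"
    by (rule prob_space_PiM) (rule prob_measuresD[OF \<nu>])
  obtain B where B: "\<And>x. x \<in> config X N \<Longrightarrow> \<bar>conf_energy N u x\<bar> \<le> B"
    using conf_energy_bounded[OF u] by metis
  have "- \<beta> * conf_energy N u x \<le> \<bar>\<beta>\<bar> * B" if "x \<in> config X N" for x
  proof -
    have "- \<beta> * conf_energy N u x \<le> \<bar>\<beta>\<bar> * \<bar>conf_energy N u x\<bar>"
      by (metis abs_ge_self abs_minus_cancel abs_mult)
    also have "\<dots> \<le> \<bar>\<beta>\<bar> * B" using B[OF that] by (intro mult_left_mono) auto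
    finally show ?thesis .
  qed
  moreover have "(\<lambda>x. exp (- \<beta> * conf_energy N u x)) \<in> borel_measurable (\<Pi>\<^sub>M i\<in>{..<N}. \<nu>)"
    unfolding measurable_PiM_config[OF \<nu>]
    by (intro continuous_on_config_measurable continuous_intros continuous_conf_energy u)
  ultimately show ?thesis
    by (intro integrable_const_bound[of _ "exp (\<bar>\<beta>\<bar> * B)"]) (auto simp: space_PiM_config[OF \<nu>])
qed

text \<open>From above, the integrand is at most the exponential of \<open>- b N\<close> times the
  minimal energy. From below, integrate only over a product of small balls around a near-minimiser:
  the Lipschitz bound and uniform continuity of \<open>u\<close> keep the energy nearly minimal
  there, and the volume \<open>c ^ N\<close> adds \<open>- ln c / b N\<close>, which vanishes
  because \<open>b N\<close> tends to infinity.\<close>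

lemma laplace_principle:
  assumes \<nu>: "\<nu> \<in> prob_measures X" "measure_support \<nu> = X"
    and b: "\<And>N. b N > 0" "filterlim b at_top sequentially"
    and u: "continuous_on X u"
  shows "(\<lambda>N. - (1 / (b N * real N)) * ln (tilted_partition_function \<nu> N (H N) (b N) u) - min_energy N u)
    \<longlonglongrightarrow> 0"
proof (rule tendstoI)
  fix \<epsilon>0 :: real assume "\<epsilon>0 > 0"
  \<comment> \<open>The energy on the product of balls costs \<open>3 * \<epsilon>\<close>
    (near-minimality, \<open>H\<close>, \<open>u\<close>), the volume one more; the fifth part is
    slack.\<close>
  define \<epsilon> where "\<epsilon> = \<epsilon>0 / 5"
  have \<epsilon>: "\<epsilon> > 0" using \<open>\<epsilon>0 > 0\<close> by (simp add: \<epsilon>_def)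
  have "uniformly_continuous_on X u" by (rule compact_uniformly_continuous[OF u compact_X])
  from this[unfolded uniformly_continuous_on_def, rule_format, OF \<epsilon>]
  obtain \<delta>1 where \<delta>1: "\<delta>1 > 0" "\<And>x y. x \<in> X \<Longrightarrow> y \<in> X \<Longrightarrow> dist y x < \<delta>1 \<Longrightarrow> \<bar>u y - u x\<bar> < \<epsilon>"
    by (auto simp: dist_real_def)
  define \<delta> where "\<delta> = min \<delta>1 (\<epsilon> / (L + 1))"
  have \<delta>: "\<delta> > 0" "\<delta> \<le> \<delta>1" using \<delta>1 \<epsilon> L_nonneg by (auto simp: \<delta>_def)
  have L\<delta>: "L * \<delta> \<le> \<epsilon>"
  proof -
    have "L * \<delta> \<le> (L + 1) * (\<epsilon> / (L + 1))"
      using \<delta> L_nonneg by (intro mult_mono) (auto simp: \<delta>_def)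
    then show ?thesis using L_nonneg by simp
  qed
  obtain c where c: "c > 0" "\<And>x. x \<in> X \<Longrightarrow> c \<le> measure \<nu> (ball x \<delta> \<inter> X)"
    using full_support_uniform_lower_bound[OF compact_X \<nu> \<delta>(1)] by metis
  note M = prob_measuresD[OF \<nu>(1)]
  interpret M: prob_space \<nu> by (rule M)
  have "eventually (\<lambda>N. b N > - ln c / \<epsilon>) sequentially"
    using b(2) by (simp add: filterlim_at_top_dense)
  then show "eventually (\<lambda>N. dist (- (1 / (b N * real N)) * ln (tilted_partition_function \<nu> N (H N) (b N) u)
      - min_energy N u) 0 < \<epsilon>0) sequentially"
    using eventually_gt_at_top[of 0]
  proof eventually_elim
    case (elim N)
    let ?P = "\<Pi>\<^sub>M i\<in>{..<N}. \<nu>"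
    let ?h = "conf_energy N u"
    define m where "m = min_energy N u"
    define Z where "Z = tilted_partition_function \<nu> N (H N) (b N) u"
    have Z: "Z = (\<integral>x. exp (- b N * ?h x) \<partial>?P)"
      by (simp add: Z_def tilted_partition_function_def partition_function_def)
    interpret P: finite_product_prob_space "\<lambda>_. \<nu>" "{..<N}"
      by unfold_locales auto
    have N: "real N > 0" using elim by simp
    have hm: "real N * m \<le> ?h x" if "x \<in> config X N" for x
      using min_energy_le[OF u that] N by (simp add: m_def field_simps)
    note int = integrable_exp_conf_energy[OF \<nu>(1) u, of N "b N"]
    have up: "Z \<le> exp (- b N * (real N * m))"
      unfolding Z
    proof (rule P.integral_le_const[OF int])
      show "AE x in ?P. exp (- b N * ?h x) \<le> exp (- b N * (real N * m))"
        using hm b(1)[of N] by (intro AE_I2) (auto simp: space_PiM_config[OF \<nu>(1)])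
    qed
    obtain x0 where x0: "x0 \<in> config X N" "?h x0 / real N < m + \<epsilon>"
      using min_energy_approx[OF \<epsilon>] m_def by metis
    have h0: "?h x0 \<le> real N * (m + \<epsilon>)" 
      using x0(2) N by (simp add: pos_divide_less_eq mult.commute)
    define S where "S = (\<Pi>\<^sub>E i\<in>{..<N}. ball (x0 i) \<delta> \<inter> X)"
    have Bm: "ball (x0 i) \<delta> \<inter> X \<in> sets \<nu>" for i
      unfolding M(2) sets_restrict_space by (rule image_eqI[of _ _ "ball (x0 i) \<delta>"]) (simp_all only: Int_commute borel_open open_ball)
    have Sm: "S \<in> sets ?P" unfolding S_def by (rule sets_PiM_I_finite) (simp_all only: finite_lessThan Bm)
    have hS: "?h x \<le> real N * (m + 3 * \<epsilon>)" if x: "x \<in> S" for x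
    proof -
      have xc: "x \<in> config X N" using x by (auto simp: S_def PiE_iff)
      have d: "norm (x i - x0 i) \<le> \<delta>" "u (x i) \<le> u (x0 i) + \<epsilon>" if "i < N" for i
      proof -
        have *: "dist (x i) (x0 i) < \<delta>" "x i \<in> X" "x0 i \<in> X"
          using x x0(1) that by (auto simp: S_def PiE_iff dist_commute)
        then show "norm (x i - x0 i) \<le> \<delta>" by (simp add: dist_norm)
        show "u (x i) \<le> u (x0 i) + \<epsilon>" using \<delta>1(2)[of "x0 i" "x i"] * \<delta>(2) by auto
      qed
      have "(\<Sum>i<N. norm (x i - x0 i)) \<le> (\<Sum>i<N. \<delta>)" using d by (intro sum_mono) auto
      then have "L * (\<Sum>i<N. norm (x i - x0 i)) \<le> L * (real N * \<delta>)"
        using L_nonneg by (intro mult_left_mono) auto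
      also have "\<dots> \<le> real N * \<epsilon>" using L\<delta> N by (simp add: mult.left_commute mult_left_mono)
      finally have 1: "H N x \<le> H N x0 + real N * \<epsilon>" using lip[OF xc x0(1)] by linarith
      have "(\<Sum>i<N. u (x i)) \<le> (\<Sum>i<N. u (x0 i) + \<epsilon>)" using d by (intro sum_mono) auto
      then have 2: "(\<Sum>i<N. u (x i)) \<le> (\<Sum>i<N. u (x0 i)) + real N * \<epsilon>" by (simp add: sum.distrib)
      show ?thesis using 1 2 h0 by (simp add: algebra_simps)
    qed
    have "c ^ N = (\<Prod>i<N. c)" by simp
    also have "\<dots> \<le> (\<Prod>i<N. measure \<nu> (ball (x0 i) \<delta> \<inter> X))"
      using c x0(1) by (intro prod_mono) (auto simp: PiE_iff less_imp_le)
    also have "\<dots> = measure ?P S" unfolding S_def using Bm by (subst P.prob_times) auto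
    finally have cS: "c ^ N \<le> measure ?P S" .
    have low: "exp (- b N * (real N * (m + 3 * \<epsilon>))) * c ^ N \<le> Z"
    proof -
      have "exp (- b N * (real N * (m + 3 * \<epsilon>))) * c ^ N
          \<le> exp (- b N * (real N * (m + 3 * \<epsilon>))) * measure ?P S" using cS by simp
      also have "\<dots> = (\<integral>x. exp (- b N * (real N * (m + 3 * \<epsilon>))) * indicator S x \<partial>?P)"
        using Sm by (simp add: sets.Int_space_eq2)
      also have "\<dots> \<le> Z" unfolding Z
      proof (rule integral_mono[OF _ int])
        have "integrable ?P (indicator S :: _ \<Rightarrow> real)"
          by (rule P.integrable_const_bound[of _ 1]) (use Sm in \<open>auto simp: indicator_def\<close>)
        then show "integrable ?P (\<lambda>x. exp (- b N * (real N * (m + 3 * \<epsilon>))) * indicator S x)"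
          by (rule integrable_mult_right)
        show "exp (- b N * (real N * (m + 3 * \<epsilon>))) * indicator S x \<le> exp (- b N * ?h x)" for x
          using hS[of x] b(1)[of N] by (auto simp: indicator_def)
      qed
      finally show ?thesis .
    qed
    have "0 < exp (- b N * (real N * (m + 3 * \<epsilon>))) * c ^ N" using c by simp
    then have Zpos: "Z > 0" using low by linarith
    have l1: "ln Z \<le> - b N * (real N * m)"
      using up Zpos by (metis ln_exp ln_le_cancel_iff exp_gt_zero)
    have "ln (exp (- b N * (real N * (m + 3 * \<epsilon>))) * c ^ N) \<le> ln Z"
      using low Zpos c by (subst ln_le_cancel_iff) auto
    then have l2: "- b N * (real N * (m + 3 * \<epsilon>)) + real N * ln c \<le> ln Z"
      using c by (simp add: ln_mult ln_realpow)
    have bN: "b N * real N > 0" using b(1) N by simp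
    have "m \<le> - (1 / (b N * real N)) * ln Z"
      using l1 bN by (simp add: field_simps)
    moreover have "- (1 / (b N * real N)) * ln Z \<le> m + 3 * \<epsilon> + (- ln c) / b N"
    proof -
      have "- ln Z \<le> b N * real N * (m + 3 * \<epsilon> + (- ln c) / b N)"
      proof -
        have "b N * real N * (m + 3 * \<epsilon> + (- ln c) / b N) = b N * (real N * (m + 3 * \<epsilon>)) - real N * ln c"
          using b(1)[of N] by (simp add: distrib_left right_diff_distrib mult.assoc)
        then show ?thesis using l2 by simp
      qed
      then have "(- ln Z) / (b N * real N) \<le> m + 3 * \<epsilon> + (- ln c) / b N"
        using bN by (subst pos_divide_le_eq) (simp_all only: mult.commute)
      then show ?thesis by simp
    qed
    moreover have "(- ln c) / b N < \<epsilon>"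
      using elim(1) b(1)[of N] \<epsilon> by (simp add: field_simps)
    moreover have "\<epsilon>0 = 5 * \<epsilon>" by (simp add: \<epsilon>_def)
    ultimately have "\<bar>- (1 / (b N * real N)) * ln Z - m - 0\<bar> < \<epsilon>0"
      using \<epsilon> by linarith
    then show ?case
      unfolding Z_def m_def dist_real_def .
  qed
qed

text \<open>The right-hand side mentions neither \<nu> nor \<open>b\<close>. This is the source of
  the claim that the energy depends only on the support of the reference measure.\<close>

lemma converges_to_free_energy_iff:
  assumes "\<nu> \<in> prob_measures X" "measure_support \<nu> = X"
    and "\<And>N. b N > 0" "filterlim b at_top sequentially"
  shows "converges_to_free_energy X \<nu> H b \<F> \<longleftrightarrow>
    (\<forall>u. continuous_on X u \<longrightarrow> (\<lambda>N. min_energy N u) \<longlonglongrightarrow> \<F> u)"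
proof -
  have "(\<lambda>N. - (1 / (b N * real N)) * ln (tilted_partition_function \<nu> N (H N) (b N) u)) \<longlonglongrightarrow> \<F> u
    \<longleftrightarrow> (\<lambda>N. min_energy N u) \<longlonglongrightarrow> \<F> u" if "continuous_on X u" for u
    by (rule Lim_transform_eq[OF laplace_principle[OF assms that]])
  then show ?thesis unfolding converges_to_free_energy_def by simp
qed

end

subsection \<open>Matching of configurations\<close>

text \<open>Within each label class choose \<open>a k\<close> indices on both sides and match them
  by a bijection; the remaining index sets have equal cardinality and are matched arbitrarily. Two
  configurations with similar cell counts thus agree up to a permutation and a small displacement,
  apart from few particles.\<close>

lemma matching_permutation:
  fixes f g :: "nat \<Rightarrow> 'k" and a :: "'k \<Rightarrow> nat"
  assumes K: "finite K"
    and af: "\<And>k. k \<in> K \<Longrightarrow> a k \<le> card {i. i < N \<and> f i = k}"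
    and ag: "\<And>k. k \<in> K \<Longrightarrow> a k \<le> card {i. i < N \<and> g i = k}"
  obtains \<pi> S where "\<pi> permutes {..<N}" "S \<subseteq> {..<N}" "card S = (\<Sum>k\<in>K. a k)"
    "\<And>i. i \<in> S \<Longrightarrow> f i \<in> K \<and> g (\<pi> i) = f i"
proof -
  have "\<exists>A. A \<subseteq> {i. i < N \<and> f i = k} \<and> card A = a k" if "k \<in> K" for k
    using obtain_subset_with_card_n[OF af[OF that]] by metis
  then obtain S where S: "\<And>k. k \<in> K \<Longrightarrow> S k \<subseteq> {i. i < N \<and> f i = k}" "\<And>k. k \<in> K \<Longrightarrow> card (S k) = a k"
    by metis
  have "\<exists>A. A \<subseteq> {i. i < N \<and> g i = k} \<and> card A = a k" if "k \<in> K" for k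
    using obtain_subset_with_card_n[OF ag[OF that]] by metis
  then obtain T where T: "\<And>k. k \<in> K \<Longrightarrow> T k \<subseteq> {i. i < N \<and> g i = k}" "\<And>k. k \<in> K \<Longrightarrow> card (T k) = a k"
    by metis
  have fin: "finite (S k)" "finite (T k)" if "k \<in> K" for k
    by (rule finite_subset[OF S(1)[OF that]], simp, rule finite_subset[OF T(1)[OF that]], simp)
  have "\<exists>h. bij_betw h (S k) (T k)" if "k \<in> K" for k
    using finite_same_card_bij[OF fin[OF that]] S(2)[OF that] T(2)[OF that] by simp
  then obtain h where h: "\<And>k. k \<in> K \<Longrightarrow> bij_betw (h k) (S k) (T k)" by metis
  define S' where "S' = (\<Union>k\<in>K. S k)"
  define T' where "T' = (\<Union>k\<in>K. T k)"
  define h' where "h' i = h (f i) i" for i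
  have disj: "S k \<inter> S l = {}" "T k \<inter> T l = {}" if "k \<in> K" "l \<in> K" "k \<noteq> l" for k l
    using S(1)[OF that(1)] S(1)[OF that(2)] T(1)[OF that(1)] T(1)[OF that(2)] that(3) by blast+
  have "card S' = (\<Sum>k\<in>K. card (S k))" "card T' = (\<Sum>k\<in>K. card (T k))"
    unfolding S'_def T'_def by (rule card_UN_disjoint; use K fin disj in simp)+
  then have cS: "card S' = (\<Sum>k\<in>K. a k)" and cT: "card T' = (\<Sum>k\<in>K. a k)"
    using S(2) T(2) by simp_all
  have bS: "bij_betw h' S' T'"
    unfolding S'_def T'_def
  proof (rule bij_betw_UNION_disjoint)
    show "disjoint_family_on T K"
      using disj(2) by (simp add: disjoint_family_on_def)
    fix k assume k: "k \<in> K"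
    have "h' i = h k i" if "i \<in> S k" for i
      using S(1)[OF k] that by (auto simp: h'_def)
    then show "bij_betw h' (S k) (T k)" using h[OF k] by (simp cong: bij_betw_cong)
  qed
  have subN: "S' \<subseteq> {..<N}" "T' \<subseteq> {..<N}" using S(1) T(1) unfolding S'_def T'_def by blast+
  have "card ({..<N} - S') = card ({..<N} - T')"
    using subN cS cT by (simp add: card_Diff_subset finite_subset[OF subN(1)] finite_subset[OF subN(2)])
  then obtain r where r: "bij_betw r ({..<N} - S') ({..<N} - T')"
    using finite_same_card_bij[of "{..<N} - S'" "{..<N} - T'"] by auto
  define \<pi> where "\<pi> i = (if i \<in> S' then h' i else if i < N then r i else i)" for i
  have "bij_betw \<pi> (S' \<union> ({..<N} - S')) (T' \<union> ({..<N} - T'))"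
  proof (rule bij_betw_combine)
    show "bij_betw \<pi> S' T'" using bS by (simp add: \<pi>_def cong: bij_betw_cong)
    have "bij_betw \<pi> ({..<N} - S') ({..<N} - T') \<longleftrightarrow> bij_betw r ({..<N} - S') ({..<N} - T')"
      by (rule bij_betw_cong) (simp add: \<pi>_def)
    then show "bij_betw \<pi> ({..<N} - S') ({..<N} - T')" using r by simp
  qed auto
  then have "bij_betw \<pi> {..<N} {..<N}" using subN by (simp add: Un_absorb1)
  then have "\<pi> permutes {..<N}"
    by (rule bij_imp_permutes) (use subN in \<open>auto simp: \<pi>_def\<close>)
  moreover have "f i \<in> K \<and> g (\<pi> i) = f i" if iS: "i \<in> S'" for i
  proof -
    obtain k where k: "k \<in> K" "i \<in> S k" using iS by (auto simp: S'_def)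
    have "f i = k" using S(1)[OF k(1)] k(2) by auto
    moreover have "h k i \<in> T k" using h[OF k(1)] k(2) by (auto simp: bij_betw_def)
    then have "g (h k i) = k" using T(1)[OF k(1)] by auto
    ultimately show ?thesis using iS k by (simp add: \<pi>_def h'_def)
  qed
  ultimately show thesis using that subN(1) cS by blast
qed

text \<open>Pushed forward along the inclusion of \<open>X\<close>, the measure becomes a finite
  Borel measure on a Polish space, where inner regularity by compact sets is available.\<close>

lemma prob_measures_inner_regular:
  fixes X :: "'a::{second_countable_topology, complete_space} set"
  assumes X: "compact X" and \<mu>: "\<mu> \<in> prob_measures X" and A: "A \<in> sets borel" "A \<subseteq> X" and "e > 0"
  obtains C where "C \<subseteq> A" "compact C" "measure \<mu> A - e < measure \<mu> C"
proof -
  note M = prob_measuresD[OF \<mu>]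
  interpret prob_space \<mu> by (rule M)
  have Xb: "X \<in> sets borel" using X by (simp add: borel_closed compact_imp_closed)
  have m: "(\<lambda>x. x) \<in> measurable \<mu> borel"
    using M(2) by (subst measurable_cong_sets[OF M(2) refl]) (auto intro: measurable_restrict_space1)
  define \<nu> where "\<nu> = distr \<mu> borel (\<lambda>x. x)"
  have \<nu>: "emeasure \<nu> B = emeasure \<mu> B" if "B \<in> sets borel" "B \<subseteq> X" for B
    unfolding \<nu>_def using that M by (subst emeasure_distr[OF m]) (auto intro: arg_cong[where f="emeasure \<mu>"])
  interpret N: prob_space \<nu> unfolding \<nu>_def by (rule prob_space_distr[OF m])
  have eq: "emeasure \<nu> A = (SUP K \<in> {K. K \<subseteq> A \<and> compact K}. emeasure \<nu> K)"
    by (rule inner_regular) (use A in \<open>auto simp: \<nu>_def[symmetric] N.emeasure_eq_measure, auto simp: \<nu>_def\<close>)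
  show thesis
  proof (cases "measure \<nu> A < e")
    case True
    then have "measure \<mu> A < e" using \<nu>[OF A] by (simp add: measure_def)
    then show thesis using that[of "{}"] by auto
  next
    case False
    have "ennreal (measure \<nu> A - e) < ennreal (measure \<nu> A)"
      using False \<open>e > 0\<close> by (intro ennreal_lessI) (auto intro: less_le_trans)
    then have "ennreal (measure \<nu> A - e) < (SUP K \<in> {K. K \<subseteq> A \<and> compact K}. emeasure \<nu> K)"
      using eq N.emeasure_eq_measure by simp
    then obtain C where C: "C \<subseteq> A" "compact C" "ennreal (measure \<nu> A - e) < emeasure \<nu> C"
      by (auto simp: less_SUP_iff)
    have Cb: "C \<in> sets borel" using C by (simp add: borel_closed compact_imp_closed)
    have "measure \<nu> A - e < measure \<nu> C"
      using C(3) False by (simp add: N.emeasure_eq_measure ennreal_less_iff)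
    then have "measure \<mu> A - e < measure \<mu> C"
      using \<nu>[OF A] \<nu>[OF Cb] C A by (auto simp: measure_def)
    then show thesis using that C by blast
  qed
qed

text \<open>Counting the points in a cell is not weakly continuous. Each cell of a partition is
  therefore shrunk to a compact set with little loss of mass; these sets are at positive mutual
  distance, so continuous bumps with disjoint neighbourhoods fit around them. A bump lies below the
  indicator of its label class, while its integral is at least the mass of its compact set.\<close>

lemma cell_functions:
  fixes X :: "'a::{second_countable_topology, heine_borel} set"
  assumes X: "compact X" and \<mu>: "\<mu> \<in> prob_measures X" and \<epsilon>: "\<epsilon> > 0" and \<eta>: "\<eta> > 0"
  obtains K :: "nat set" and u :: "nat \<Rightarrow> 'a \<Rightarrow> real" and lab :: "'a \<Rightarrow> nat" where
    "finite K" "\<And>k S. k \<in> K \<Longrightarrow> continuous_on S (u k)"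
    "\<And>k x. k \<in> K \<Longrightarrow> u k x \<le> (if lab x = k then 1 else 0)"
    "\<And>x y. lab x \<in> K \<Longrightarrow> lab x = lab y \<Longrightarrow> dist x y \<le> \<epsilon>"
    "1 - \<eta> \<le> (\<Sum>k\<in>K. \<integral>x. u k x \<partial>\<mu>)"
proof -
  note M = prob_measuresD[OF \<mu>]
  interpret prob_space \<mu> by (rule M)
  have Xb: "X \<in> sets borel" using X by (simp add: borel_closed compact_imp_closed)
  have "X \<subseteq> (\<Union>x\<in>X. ball x (\<epsilon>/4))" using \<epsilon> by auto
  then obtain F where F: "F \<subseteq> X" "finite F" "X \<subseteq> (\<Union>x\<in>F. ball x (\<epsilon>/4))"
    using compactE_image[OF X, of X "\<lambda>x. ball x (\<epsilon>/4)"] by auto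
  obtain c :: "nat \<Rightarrow> 'a" and m where c: "F = c ` {..<m}"
    using finite_imp_nat_seg_image_inj_on[OF F(2)] by (auto simp: lessThan_def)
  define A where "A j = X \<inter> ball (c j) (\<epsilon>/4) - (\<Union>i<j. ball (c i) (\<epsilon>/4))" for j
  have Ab: "A j \<in> sets borel" "A j \<subseteq> X" for j
    using Xb by (auto simp: A_def intro!: sets.Diff sets.Int sets.finite_UN)
  have disjA: "disjoint_family A"
  proof -
    have "A i \<inter> A j = {}" if "i < j" for i j using that by (auto simp: A_def)
    then show ?thesis unfolding disjoint_family_on_def by (metis Int_commute linorder_neqE_nat)
  qed
  have UA: "X = (\<Union>j<m. A j)"
  proof
    show "X \<subseteq> (\<Union>j<m. A j)"
    proof
      fix x assume x: "x \<in> X"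
      then have ex: "\<exists>j. j < m \<and> x \<in> ball (c j) (\<epsilon>/4)" using F(3) c by blast
      define j where "j = (LEAST j. j < m \<and> x \<in> ball (c j) (\<epsilon>/4))"
      have j: "j < m" "x \<in> ball (c j) (\<epsilon>/4)" using LeastI_ex[OF ex] by (simp_all add: j_def)
      have "x \<notin> ball (c i) (\<epsilon>/4)" if "i < j" for i
        using not_less_Least[of i "\<lambda>j. j < m \<and> x \<in> ball (c j) (\<epsilon>/4)"] that j(1) unfolding j_def[symmetric] by auto
      then show "x \<in> (\<Union>j<m. A j)" using x j by (auto simp: A_def)
    qed
  qed (use Ab in auto)
  define e where "e = \<eta> / (real m + 1)"
  have e: "e > 0" using \<eta> by (simp add: e_def)
  have "\<exists>C. C \<subseteq> A j \<and> compact C \<and> measure \<mu> (A j) - e < measure \<mu> C" for j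
    using prob_measures_inner_regular[OF X \<mu> Ab e] by metis
  then obtain C where C: "\<And>j. C j \<subseteq> A j" "\<And>j. compact (C j)" "\<And>j. measure \<mu> (A j) - e < measure \<mu> (C j)"
    by metis
  define K where "K = {j. j < m \<and> C j \<noteq> {}}"
  have K: "finite K" by (simp add: K_def)
  have "\<exists>d>0. \<forall>x\<in>C i. \<forall>y\<in>C j. d \<le> dist x y" if "i \<noteq> j" for i j
  proof (rule separate_compact_closed)
    have "A i \<inter> A j = {}" using disjA that by (auto simp: disjoint_family_on_def)
    then show "C i \<inter> C j = {}" using C(1) by blast
  qed (use C in \<open>auto simp: compact_imp_closed\<close>)
  then obtain d where d: "\<And>i j. i \<noteq> j \<Longrightarrow> d i j > 0" "\<And>i j x y. i \<noteq> j \<Longrightarrow> x \<in> C i \<Longrightarrow> y \<in> C j \<Longrightarrow> d i j \<le> dist x y"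
    by metis
  \<comment> \<open>At most half of every mutual distance, so the \<delta>-neighbourhoods are
    disjoint; at most \<open>\<epsilon>/4\<close>, so two points with the same label in
    \<open>K\<close> are within \<open>\<epsilon>/4 + \<epsilon>/2 + \<epsilon>/4\<close>.\<close>
  define \<delta> where "\<delta> = Min (insert (\<epsilon>/4) ((\<lambda>(i, j). d i j / 2) ` {p \<in> K \<times> K. fst p \<noteq> snd p}))"
  have finp: "finite {p \<in> K \<times> K. fst p \<noteq> snd p}" using K by simp
  have \<delta>: "\<delta> > 0" "\<delta> \<le> \<epsilon>/4" "\<And>i j. i \<in> K \<Longrightarrow> j \<in> K \<Longrightarrow> i \<noteq> j \<Longrightarrow> \<delta> \<le> d i j / 2"
  proof -
    show "\<delta> > 0" unfolding \<delta>_def using finp \<epsilon> d by (subst Min_gr_iff) auto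
    show "\<delta> \<le> \<epsilon>/4" unfolding \<delta>_def using finp by (intro Min_le) auto
    show "\<delta> \<le> d i j / 2" if "i \<in> K" "j \<in> K" "i \<noteq> j" for i j
      unfolding \<delta>_def using finp that by (intro Min_le) (auto intro!: image_eqI[of _ _ "(i, j)"])
  qed
  define u where "u k x = max 0 (1 - infdist x (C k) / \<delta>)" for k x
  \<comment> \<open>Points outside all neighbourhoods receive the label \<open>m\<close>, which is
    not in \<open>K\<close>.\<close>
  define lab where "lab x = (if \<exists>k\<in>K. infdist x (C k) < \<delta> then SOME k. k \<in> K \<and> infdist x (C k) < \<delta> else m)" for x
  have near: "\<exists>p\<in>C k. dist x p < \<delta>" if "k \<in> K" "infdist x (C k) < \<delta>" for k x
  proof -
    have ne: "C k \<noteq> {}" using that by (simp add: K_def)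
    obtain p where "p \<in> C k" "infdist x (C k) = dist x p"
      using infdist_attains_inf[OF compact_imp_closed[OF C(2)] ne] by metis
    then show ?thesis using that by auto
  qed
  have uniq: "k = l" if kl: "k \<in> K" "infdist x (C k) < \<delta>" "l \<in> K" "infdist x (C l) < \<delta>" for k l x
  proof (rule ccontr)
    assume "k \<noteq> l"
    obtain p where p: "p \<in> C k" "dist x p < \<delta>" using near[OF kl(1,2)] by blast
    obtain q where q: "q \<in> C l" "dist x q < \<delta>" using near[OF kl(3,4)] by blast
    note pq = p q
    have "d k l \<le> dist p q" using d(2) \<open>k \<noteq> l\<close> pq by blast
    also have "\<dots> < \<delta> + \<delta>" using dist_triangle3[of p q x] pq by linarith
    also have "\<dots> \<le> d k l" using \<delta>(3)[OF kl(1,3) \<open>k \<noteq> l\<close>] by simp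
    finally show False by simp
  qed
  have mK: "m \<notin> K" by (simp add: K_def)
  have lab1: "infdist x (C (lab x)) < \<delta>" if "lab x \<in> K" for x
  proof -
    have ex: "\<exists>k. k \<in> K \<and> infdist x (C k) < \<delta>" using that mK by (auto simp: lab_def split: if_splits)
    then show ?thesis using someI_ex[OF ex] by (auto simp: lab_def)
  qed
  have lab2: "lab x = k" if "k \<in> K" "infdist x (C k) < \<delta>" for x k
  proof -
    have ex: "\<exists>k. k \<in> K \<and> infdist x (C k) < \<delta>" using that by blast
    then have "lab x = (SOME k. k \<in> K \<and> infdist x (C k) < \<delta>)" by (auto simp: lab_def)
    then show ?thesis using someI_ex[OF ex] uniq that by metis
  qed
  have uc: "continuous_on S (u k)" for k S
    unfolding u_def by (intro continuous_intros) (use \<delta>(1) in auto)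
  have u01: "u k x \<le> 1" "0 \<le> u k x" for k x using \<delta>(1) by (auto simp: u_def infdist_nonneg)
  show thesis
  proof (rule that[of K u lab])
    show "finite K" by (rule K)
    show "continuous_on S (u k)" for k S by (rule uc)
    show "u k x \<le> (if lab x = k then 1 else 0)" if "k \<in> K" for k x
    proof (cases "infdist x (C k) < \<delta>")
      case True
      then show ?thesis using lab2[OF that] u01 by simp
    next
      case False
      then have "1 \<le> infdist x (C k) / \<delta>" using \<delta>(1) by simp
      then show ?thesis by (simp add: u_def)
    qed
    show "dist x y \<le> \<epsilon>" if xy: "lab x \<in> K" "lab x = lab y" for x y
    proof -
      define k where "k = lab x"
      obtain p where p: "p \<in> C k" "dist x p < \<delta>" using near[OF xy(1) lab1[OF xy(1)]] k_def by blast
      obtain q where q: "q \<in> C k" "dist y q < \<delta>"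
        using near[of "lab y" y] lab1[of y] xy k_def by auto
      have "dist (c k) p < \<epsilon>/4" "dist (c k) q < \<epsilon>/4" using p q C(1)[of k] by (auto simp: A_def)
      then have "dist p q < \<epsilon>/4 + \<epsilon>/4" using dist_triangle3[of p q "c k"] by linarith
      moreover have "dist x y \<le> dist x p + dist p q + dist y q"
        using dist_triangle[of x y p] dist_triangle[of p y q] dist_commute[of y q] by linarith
      ultimately show ?thesis using p q \<delta>(2) by linarith
    qed
    have CX: "C k \<subseteq> X" for k using C(1) Ab by blast
    have Cs: "C k \<in> sets \<mu>" for k
      unfolding M(2) sets_restrict_space
      by (rule image_eqI[of _ _ "C k"]) (use CX borel_closed[OF compact_imp_closed[OF C(2)]] in auto)
    have As: "A k \<in> sets \<mu>" for k
      unfolding M(2) sets_restrict_space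
      by (rule image_eqI[of _ _ "A k"]) (use Ab in auto)
    have mu_le: "measure \<mu> (C k) \<le> (\<integral>x. u k x \<partial>\<mu>)" if "k \<in> K" for k
    proof -
      have "measure \<mu> (C k) = (\<integral>x. indicator (C k) x \<partial>\<mu>)" using Cs[of k] sets.sets_into_space[OF Cs, of k] by (simp add: Int_absorb2)
      also have "\<dots> \<le> (\<integral>x. u k x \<partial>\<mu>)"
      proof (rule integral_mono)
        show "integrable \<mu> (indicator (C k) :: _ \<Rightarrow> real)"
          by (rule integrable_const_bound[of _ 1]) (use Cs in \<open>auto simp: indicator_def\<close>)
        show "integrable \<mu> (u k)"
          by (rule integrable_bounded_borel[OF \<mu> continuous_bounded_borel[OF X uc]])
        show "indicator (C k) x \<le> u k x" for x
          using u01[of k x] by (auto simp: indicator_def u_def)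
      qed
      finally show ?thesis .
    qed
    have "1 = measure \<mu> (\<Union>j<m. A j)" using prob_space M UA by simp
    also have "\<dots> = (\<Sum>j<m. measure \<mu> (A j))"
      by (rule finite_measure_finite_Union) (use As disjA in \<open>auto simp: disjoint_family_on_def\<close>)
    also have "\<dots> \<le> (\<Sum>j<m. measure \<mu> (C j) + e)" using C(3) by (intro sum_mono) (smt (verit))
    also have "\<dots> = (\<Sum>j<m. measure \<mu> (C j)) + real m * e" by (simp add: sum.distrib)
    also have "real m * e \<le> \<eta>" using \<eta> by (simp add: e_def field_simps)
    also have "(\<Sum>j<m. measure \<mu> (C j)) = (\<Sum>j\<in>K. measure \<mu> (C j))"
      by (rule sum.mono_neutral_right) (auto simp: K_def)
    also have "\<dots> \<le> (\<Sum>k\<in>K. \<integral>x. u k x \<partial>\<mu>)" by (intro sum_mono mu_le)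
    finally show "1 - \<eta> \<le> (\<Sum>k\<in>K. \<integral>x. u k x \<partial>\<mu>)" by simp
  qed
qed

subsection \<open>The limit energy\<close>

locale particle_limit = particle_system +
  fixes \<F> :: "('a \<Rightarrow> real) \<Rightarrow> real"
  assumes min_energy_lim: "\<And>u. continuous_on X u \<Longrightarrow> (\<lambda>N. min_energy N u) \<longlonglongrightarrow> \<F> u"
begin

lemma integrable_continuous:
  "\<mu> \<in> prob_measures X \<Longrightarrow> continuous_on X u \<Longrightarrow> integrable \<mu> (u :: 'a \<Rightarrow> real)"
  by (rule integrable_bounded_borel[OF _ continuous_bounded_borel[OF compact_X]])

text \<open>Put all particles at \<open>y\<close>: the linear term contributes exactly
  \<open>u y\<close> per particle, and the Lipschitz bound compares the rest with the untilted
  minimum. As the right-hand side is independent of \<open>u\<close> and \<open>y\<close>, the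
  energy is finite at every probability measure.\<close>

lemma free_energy_le_pointwise:
  assumes u: "continuous_on X u" and y: "y \<in> X"
  shows "\<F> u - u y \<le> \<F> (\<lambda>_. 0) + L * diameter X"
proof -
  have "min_energy N u - u y \<le> min_energy N (\<lambda>_. 0) + L * diameter X" if N: "N > 0" for N
  proof -
    define x where "x = (\<lambda>i\<in>{..<N}. y)"
    have x: "x \<in> config X N" using y by (auto simp: x_def)
    have "min_energy N u \<le> conf_energy N u x / real N" by (rule min_energy_le[OF u x])
    also have "conf_energy N u x / real N = H N x / real N + u y"
      using N by (simp add: x_def add_divide_distrib)
    finally have 1: "min_energy N u \<le> H N x / real N + u y" .
    have "H N x / real N - L * diameter X \<le> min_energy N (\<lambda>_. 0)"
      unfolding min_energy_def
    proof (rule cINF_greatest[OF config_nonempty])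
      fix z assume z: "z \<in> config X N"
      have "H N x - real N * (L * diameter X) \<le> H N z" using H_diff_le[OF x z] by linarith
      then have "(H N x - real N * (L * diameter X)) / real N \<le> H N z / real N"
        by (intro divide_right_mono) auto
      then show "H N x / real N - L * diameter X \<le> conf_energy N (\<lambda>_. 0) z / real N"
        using N by (simp add: diff_divide_distrib)
    qed
    with 1 show ?thesis by linarith
  qed
  then have "eventually (\<lambda>N. min_energy N u - u y \<le> min_energy N (\<lambda>_. 0) + L * diameter X) sequentially"
    by (rule eventually_mono[OF eventually_gt_at_top[of 0]])
  moreover have "(\<lambda>N. min_energy N u - u y) \<longlonglongrightarrow> \<F> u - u y"
    by (intro tendsto_intros min_energy_lim u)
  moreover have "(\<lambda>N. min_energy N (\<lambda>_. 0) + L * diameter X) \<longlonglongrightarrow> \<F> (\<lambda>_. 0) + L * diameter X"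
    by (intro tendsto_intros min_energy_lim) simp
  ultimately show ?thesis
    using tendsto_le[OF trivial_limit_sequentially] by blast
qed

lemma free_energy_le:
  assumes \<mu>: "\<mu> \<in> prob_measures X" and u: "continuous_on X u"
  shows "\<F> u - (\<integral>x. u x \<partial>\<mu>) \<le> \<F> (\<lambda>_. 0) + L * diameter X"
proof -
  note M = prob_measuresD[OF \<mu>]
  interpret prob_space \<mu> by (rule M)
  have "\<F> u - (\<F> (\<lambda>_. 0) + L * diameter X) \<le> (\<integral>x. u x \<partial>\<mu>)"
  proof (rule integral_ge_const[OF integrable_continuous[OF \<mu> u]])
    show "AE x in \<mu>. \<F> u - (\<F> (\<lambda>_. 0) + L * diameter X) \<le> u x"
      using free_energy_le_pointwise[OF u] M(3) by (intro AE_I2) (auto simp: algebra_simps)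
  qed
  then show ?thesis by linarith
qed

text \<open>Real counterpart of \<open>energy\<close>; the uniform bound
  \<open>free_energy_le\<close> makes the real supremum meaningful on probability measures.\<close>

definition energy_real :: "'a measure \<Rightarrow> real" where
  "energy_real \<mu> = (SUP u\<in>{u. continuous_on X u}. \<F> u - (\<integral>x. u x \<partial>\<mu>))"

lemma energy_real_ge:
  assumes "\<mu> \<in> prob_measures X" "continuous_on X u"
  shows "\<F> u - (\<integral>x. u x \<partial>\<mu>) \<le> energy_real \<mu>"
  unfolding energy_real_def
  by (rule cSUP_upper) (use assms free_energy_le in \<open>auto intro!: bdd_aboveI2\<close>)

lemma energy_real_le:
  assumes "\<And>u. continuous_on X u \<Longrightarrow> \<F> u - (\<integral>x. u x \<partial>\<mu>) \<le> c"
  shows "energy_real \<mu> \<le> c"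
  unfolding energy_real_def
  by (rule cSUP_least) (use assms continuous_on_const in blast)+

lemma energy_eq:
  assumes "\<mu> \<in> prob_measures X"
  shows "energy X \<F> \<mu> = ereal (energy_real \<mu>)"
  unfolding energy_def
proof (rule antisym)
  show "(SUP u\<in>{u. continuous_on X u}. ereal (\<F> u - (\<integral>x. u x \<partial>\<mu>))) \<le> ereal (energy_real \<mu>)"
    by (rule SUP_least) (use energy_real_ge[OF assms] in auto)
  show "ereal (energy_real \<mu>) \<le> (SUP u\<in>{u. continuous_on X u}. ereal (\<F> u - (\<integral>x. u x \<partial>\<mu>)))"
  proof (rule ereal_le_epsilon2)
    fix e :: real assume "e > 0"
    then have "energy_real \<mu> - e < energy_real \<mu>" by simp
    then obtain u where u: "continuous_on X u" "energy_real \<mu> - e < \<F> u - (\<integral>x. u x \<partial>\<mu>)"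
      using energy_real_le[of \<mu> "energy_real \<mu> - e"] by (meson not_le)
    have "ereal (energy_real \<mu>) \<le> ereal (\<F> u - (\<integral>x. u x \<partial>\<mu>)) + ereal e" using u(2) by simp
    also have "\<dots> \<le> (SUP u\<in>{u. continuous_on X u}. ereal (\<F> u - (\<integral>x. u x \<partial>\<mu>))) + ereal e"
      by (intro add_right_mono SUP_upper) (use u(1) in simp)
    finally show "ereal (energy_real \<mu>) \<le> (SUP u\<in>{u. continuous_on X u}. ereal (\<F> u - (\<integral>x. u x \<partial>\<mu>))) + ereal e" .
  qed
qed

text \<open>Minima of pointwise comparable energies are comparable, and a constant shift passes
  through. Used in both directions, this makes \<F> 1-Lipschitz for the supremum norm on
  \<open>X\<close>.\<close>

lemma free_energy_mono:
  assumes u: "continuous_on X u" and v: "continuous_on X v" and c: "\<And>x. x \<in> X \<Longrightarrow> u x \<le> v x + c"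
  shows "\<F> u \<le> \<F> v + c"
proof -
  have "min_energy N u \<le> min_energy N v + c" if N: "N > 0" for N
  proof -
    have "min_energy N u - c \<le> min_energy N v"
      unfolding min_energy_def[of N v]
    proof (rule cINF_greatest[OF config_nonempty])
      fix x assume x: "x \<in> config X N"
      have "(\<Sum>i<N. u (x i)) \<le> (\<Sum>i<N. v (x i) + c)" by (intro sum_mono c) (use x in auto)
      then have "conf_energy N u x \<le> conf_energy N v x + real N * c" by (simp add: sum.distrib)
      then have "conf_energy N u x / real N \<le> (conf_energy N v x + real N * c) / real N"
        by (intro divide_right_mono) auto
      then show "min_energy N u - c \<le> conf_energy N v x / real N"
        using min_energy_le[OF u x] N by (simp add: add_divide_distrib)
    qed
    then show ?thesis by simp
  qed
  then have "eventually (\<lambda>N. min_energy N u \<le> min_energy N v + c) sequentially"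
    by (rule eventually_mono[OF eventually_gt_at_top[of 0]])
  moreover have "(\<lambda>N. min_energy N v + c) \<longlonglongrightarrow> \<F> v + c"
    by (intro tendsto_intros min_energy_lim v)
  ultimately show ?thesis
    using tendsto_le[OF trivial_limit_sequentially _ min_energy_lim[OF u]] by blast
qed

text \<open>Concave differentiability in disguise: a near-minimiser of the energy tilted by \<open>u\<close> is a
  near-supergradient of the finite-\<open>N\<close> free energy at \<open>u\<close>, and the difference quotients converge.\<close>

lemma near_minimiser_mean:
  assumes u: "continuous_on X u" and v: "continuous_on X v"
    and d: "((\<lambda>t. \<F> (\<lambda>x. u x + t * v x)) has_real_derivative d) (at 0)" and \<eta>: "\<eta> > 0"
  obtains \<tau> where "\<tau> > 0" "eventually (\<lambda>N. \<forall>x\<in>config X N.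
    conf_energy N u x / real N < min_energy N u + \<tau> \<longrightarrow> \<bar>(\<Sum>i<N. v (x i)) / real N - d\<bar> < \<eta>) sequentially"
proof -
  define f where "f t = \<F> (\<lambda>x. u x + t * v x)" for t
  have f0: "f 0 = \<F> u" by (simp add: f_def)
  have "(\<lambda>t. (f t - f 0) / (t - 0)) \<midarrow>0\<rightarrow> d"
    using d unfolding f_def has_field_derivative_iff by simp
  from LIM_D[OF this, of "\<eta>/4"] \<eta> obtain s where s: "s > 0"
    "\<And>t. t \<noteq> 0 \<Longrightarrow> \<bar>t\<bar> < s \<Longrightarrow> \<bar>(f t - f 0) / t - d\<bar> < \<eta>/4"
    by auto
  define t where "t = s / 2"
  have t: "t > 0" using s by (simp add: t_def)
  \<comment> \<open>Both signs of the step are kept: they yield the two sides of the final estimate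
    on \<open>V - d\<close>.\<close>
  have ft: "f r - f 0 \<ge> r * d - t * \<eta> / 4" if "r = t \<or> r = - t" for r
  proof -
    have r: "r \<noteq> 0" "\<bar>r\<bar> = t" using that t by auto
    have "\<bar>(f r - f 0) / r - d\<bar> < \<eta>/4" using s r by (simp add: t_def)
    then have "\<bar>r\<bar> * \<bar>(f r - f 0) / r - d\<bar> < t * (\<eta>/4)" using r t by simp
    also have "\<bar>r\<bar> * \<bar>(f r - f 0) / r - d\<bar> = \<bar>f r - f 0 - r * d\<bar>"
    proof -
      have "r * ((f r - f 0) / r - d) = f r - f 0 - r * d" using r by (simp add: field_simps)
      then show ?thesis by (metis abs_mult)
    qed
    finally show ?thesis by linarith
  qed
  have uc: "continuous_on X (\<lambda>x. u x + r * v x)" for r by (intro continuous_intros u v)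
  have ev: "eventually (\<lambda>N. \<bar>min_energy N (\<lambda>x. u x + r * v x) - f r\<bar> < t * \<eta> / 8) sequentially" for r
    using tendstoD[OF min_energy_lim[OF uc], of "t * \<eta> / 8" r] t \<eta> by (simp add: f_def dist_real_def)
  have ev0: "eventually (\<lambda>N. \<bar>min_energy N u - f 0\<bar> < t * \<eta> / 8) sequentially"
    using ev[of 0] by simp
  show thesis
  proof (rule that[of "t * \<eta> / 4"])
    show "t * \<eta> / 4 > 0" using t \<eta> by simp
    show "eventually (\<lambda>N. \<forall>x\<in>config X N.
      conf_energy N u x / real N < min_energy N u + t * \<eta> / 4 \<longrightarrow> \<bar>(\<Sum>i<N. v (x i)) / real N - d\<bar> < \<eta>) sequentially"
      using ev[of t] ev[of "- t"] ev0 eventually_gt_at_top[of 0]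
    proof eventually_elim
      case (elim N)
      show ?case
      proof (intro ballI impI)
        fix x assume x: "x \<in> config X N" and near: "conf_energy N u x / real N < min_energy N u + t * \<eta> / 4"
        define V where "V = (\<Sum>i<N. v (x i)) / real N"
        \<comment> \<open>For fixed \<open>x\<close> the tilted energy is affine in the tilt with
          slope \<open>V\<close>, and it stays above the minimal energy. The loss is
          \<open>t * \<eta> / 4\<close> from \<open>ft\<close>, the same from near-minimality, and
          \<open>t * \<eta> / 8\<close> from each of the two limits.\<close>
        have "r * V \<ge> r * d - 3 * (t * \<eta> / 4)" if r: "r = t \<or> r = - t" for r
        proof -
          have "\<bar>min_energy N (\<lambda>x. u x + r * v x) - f r\<bar> < t * \<eta> / 8" using elim(1,2) r by blast
          moreover have "min_energy N (\<lambda>x. u x + r * v x) \<le> conf_energy N (\<lambda>x. u x + r * v x) x / real N"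
            by (rule min_energy_le[OF uc x])
          moreover have "conf_energy N (\<lambda>x. u x + r * v x) x / real N = conf_energy N u x / real N + r * V"
            by (simp add: V_def sum.distrib add_divide_distrib flip: sum_distrib_left)
          ultimately show ?thesis using ft[OF r] near elim(3) by linarith
        qed
        from this[of t] this[of "- t"] have "t * \<bar>V - d\<bar> \<le> 3 * (t * \<eta> / 4)"
          by (cases "V \<ge> d") (auto simp: algebra_simps)
        also have "\<dots> < t * \<eta>" using t \<eta> by simp
        finally show "\<bar>(\<Sum>i<N. v (x i)) / real N - d\<bar> < \<eta>" using t by (simp add: V_def)
      qed
    qed
  qed
qed

text \<open>Parameters are functions on all of \<open>nat\<close> with the product topology; by
  \<open>free_energy_mono\<close> the value is Lipschitz in the first \<open>m\<close> coordinates,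
  through which it is computed.\<close>

lemma continuous_free_energy_combination:
  fixes v :: "nat \<Rightarrow> 'a \<Rightarrow> real"
  assumes v: "\<And>j. j < m \<Longrightarrow> continuous_on X (v j)"
  shows "continuous_on UNIV (\<lambda>s :: nat \<Rightarrow> real. \<F> (\<lambda>x. \<Sum>j<m. s j * v j x))"
proof -
  have "\<exists>B. \<forall>j<m. \<forall>x\<in>X. \<bar>v j x\<bar> \<le> B j"
  proof -
    have "\<exists>b. j < m \<longrightarrow> (\<forall>x\<in>X. \<bar>v j x\<bar> \<le> b)" for j
      using compact_continuous_bounded[OF compact_X v, of j] by metis
    then show ?thesis by metis
  qed
  then obtain B where B: "\<And>j x. j < m \<Longrightarrow> x \<in> X \<Longrightarrow> \<bar>v j x\<bar> \<le> B j" by blast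
  define \<phi> where "\<phi> s = \<F> (\<lambda>x. \<Sum>j<m. s j * v j x)" for s :: "nat \<Rightarrow> real"
  have c: "continuous_on X (\<lambda>x. \<Sum>j<m. s j * v j x)" for s :: "nat \<Rightarrow> real"
    by (intro continuous_intros v) simp
  have le: "\<phi> s \<le> \<phi> s' + (\<Sum>j<m. \<bar>s j - s' j\<bar> * B j)" for s s' :: "nat \<Rightarrow> real"
    unfolding \<phi>_def
  proof (rule free_energy_mono[OF c c])
    fix x assume x: "x \<in> X"
    have "(\<Sum>j<m. s j * v j x) - (\<Sum>j<m. s' j * v j x) = (\<Sum>j<m. (s j - s' j) * v j x)"
      by (simp add: sum_subtractf left_diff_distrib)
    also have "\<dots> \<le> (\<Sum>j<m. \<bar>s j - s' j\<bar> * B j)"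
    proof (rule sum_mono)
      fix j assume "j \<in> {..<m}"
      then have "\<bar>v j x\<bar> \<le> B j" using B x by simp
      then have "\<bar>s j - s' j\<bar> * \<bar>v j x\<bar> \<le> \<bar>s j - s' j\<bar> * B j" by (intro mult_left_mono) auto
      then show "(s j - s' j) * v j x \<le> \<bar>s j - s' j\<bar> * B j"
        using abs_ge_self[of "(s j - s' j) * v j x"] by (simp add: abs_mult)
    qed
    finally show "(\<Sum>j<m. s j * v j x) \<le> (\<Sum>j<m. s' j * v j x) + (\<Sum>j<m. \<bar>s j - s' j\<bar> * B j)" by simp
  qed
  have "isCont \<phi> s0" for s0
  proof -
    have "isCont (\<lambda>s :: nat \<Rightarrow> real. s j) s0" for j
      by (rule continuous_on_interior[OF continuous_on_product_coordinates]) simp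
    then have g: "isCont (\<lambda>s. \<Sum>j<m. \<bar>s j - s0 j\<bar> * B j) s0"
      by (intro continuous_intros)
    have "((\<lambda>s. \<Sum>j<m. \<bar>s j - s0 j\<bar> * B j) \<longlongrightarrow> 0) (at s0)"
      using g by (simp add: isCont_def)
    then have "((\<lambda>s. \<phi> s - \<phi> s0) \<longlongrightarrow> 0) (at s0)"
    proof (rule Lim_null_comparison[rotated], intro always_eventually allI)
      fix s show "norm (\<phi> s - \<phi> s0) \<le> (\<Sum>j<m. \<bar>s j - s0 j\<bar> * B j)"
        using le[of s s0] le[of s0 s] by (simp add: abs_le_iff abs_minus_commute)
    qed
    then show ?thesis unfolding isCont_def by (rule LIM_zero_cancel)
  qed
  then show ?thesis unfolding \<phi>_def by (simp add: continuous_on_eq_continuous_at)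
qed

text \<open>Without the penalty the supremum may be approached only at infinity. The unpenalised
  part is at most the energy, so outside a box of radius \<open>sqrt (2 * k * G)\<close> the penalty
  pushes \<Phi> below its value at 0, and a maximum over the box is global.\<close>

lemma penalised_maximiser:
  fixes v :: "nat \<Rightarrow> 'a \<Rightarrow> real"
  assumes \<mu>: "\<mu> \<in> prob_measures X" and v: "\<And>j. j < m \<Longrightarrow> continuous_on X (v j)" and k: "k > 0"
    and \<Phi>: "\<Phi> = (\<lambda>s. \<F> (\<lambda>x. \<Sum>j<m. s j * v j x) - (\<Sum>j<m. s j * (\<integral>x. v j x \<partial>\<mu>)) - (\<Sum>j<m. (s j)\<^sup>2) / (2 * k))"
  obtains s where "\<And>s'. \<Phi> s' \<le> \<Phi> s"
proof -
  define E where "E = energy_real \<mu>"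
  have c: "continuous_on X (\<lambda>x. \<Sum>j<m. s j * v j x)" for s :: "nat \<Rightarrow> real"
    by (intro continuous_intros v) simp
  have int: "(\<integral>x. (\<Sum>j<m. s j * v j x) \<partial>\<mu>) = (\<Sum>j<m. s j * (\<integral>x. v j x \<partial>\<mu>))" for s
    using integrable_continuous[OF \<mu> v] by (subst Bochner_Integration.integral_sum) auto
  have up: "\<Phi> s \<le> E - (\<Sum>j<m. (s j)\<^sup>2) / (2 * k)" for s
    using energy_real_ge[OF \<mu> c[of s]] unfolding \<Phi> E_def int by simp
  define G where "G = \<bar>E - \<F> (\<lambda>_. 0)\<bar> + 1"
  define R where "R = sqrt (2 * k * G)"
  have G: "G > 0" "E - \<F> (\<lambda>_. 0) < G" by (auto simp: G_def)
  have R: "R \<ge> 0" "R\<^sup>2 = 2 * k * G" using k G by (auto simp: R_def)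
  \<comment> \<open>Freezing the coordinates from \<open>m\<close> on at 0 makes the box compact and
    does not change the values of \<Phi>.\<close>
  define box where "box = PiE UNIV (\<lambda>j. if j < m then {- R..R} else {0::real})"
  have "compactin (product_topology (\<lambda>_. euclidean) UNIV) box"
    unfolding box_def by (subst compactin_PiE) simp
  then have box: "compact box" by (simp add: euclidean_product_topology)
  have z: "(\<lambda>_. 0) \<in> box" using R by (auto simp: box_def PiE_UNIV_domain)
  have cont: "continuous_on box \<Phi>"
    unfolding \<Phi> using k
    by (intro continuous_on_diff continuous_on_subset[OF continuous_free_energy_combination[OF v]]
        continuous_intros continuous_on_subset[OF continuous_on_product_coordinates]) auto
  obtain s where s: "s \<in> box" "\<And>s'. s' \<in> box \<Longrightarrow> \<Phi> s' \<le> \<Phi> s"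
    using continuous_attains_sup[OF box _ cont] z by blast
  have "\<Phi> s' \<le> \<Phi> s" for s'
  proof (cases "\<forall>j<m. \<bar>s' j\<bar> \<le> R")
    case True
    define t where "t j = (if j < m then s' j else 0)" for j
    have "t \<in> box" using True by (auto simp: box_def PiE_UNIV_domain t_def abs_le_iff)
    moreover have "\<Phi> t = \<Phi> s'" unfolding \<Phi> t_def by simp
    ultimately show ?thesis using s(2) by metis
  next
    case False
    then obtain i where i: "i < m" "R < \<bar>s' i\<bar>" by auto
    have "R\<^sup>2 < \<bar>s' i\<bar>\<^sup>2" using i R by (intro power_strict_mono) auto
    also have "\<bar>s' i\<bar>\<^sup>2 \<le> (\<Sum>j<m. (s' j)\<^sup>2)"
      using member_le_sum[of i "{..<m}" "\<lambda>j. (s' j)\<^sup>2"] i by simp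
    finally have "2 * k * G < (\<Sum>j<m. (s' j)\<^sup>2)" using R by simp
    then have "G < (\<Sum>j<m. (s' j)\<^sup>2) / (2 * k)" using k by (simp add: pos_less_divide_eq mult.commute)
    then have "\<Phi> s' < \<F> (\<lambda>_. 0)" using up[of s'] G by linarith
    also have "\<F> (\<lambda>_. 0) = \<Phi> (\<lambda>_. 0)" by (simp add: \<Phi>)
    also have "\<dots> \<le> \<Phi> s" by (rule s(2)[OF z])
    finally show ?thesis by simp
  qed
  then show thesis using that by blast
qed

end

section \<open>Configurations near a given measure with nearly optimal energy\<close>

locale differentiable_limit = particle_limit +
  assumes gateaux: "gateaux_differentiable_on_C0 X \<F>"
begin

text \<open>Maximising the concave dual problem with a quadratic penalty replaces the
  Bronsted-Rockafellar theorem: at the maximiser the derivative of \<open>\<F>\<close> integrates the test functions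
  like \<open>\<mu>\<close> up to an error that vanishes with the penalty.\<close>

lemma approximate_subgradient:
  fixes v :: "nat \<Rightarrow> 'a \<Rightarrow> real"
  assumes \<mu>: "\<mu> \<in> prob_measures X" and v: "\<And>j. j < m \<Longrightarrow> continuous_on X (v j)" and \<epsilon>: "\<epsilon> > 0"
  obtains s d :: "nat \<Rightarrow> real" where
    "\<And>j. j < m \<Longrightarrow> ((\<lambda>t. \<F> (\<lambda>x. (\<Sum>i<m. s i * v i x) + t * v j x)) has_real_derivative d j) (at 0)"
    "\<And>j. j < m \<Longrightarrow> \<bar>d j - (\<integral>x. v j x \<partial>\<mu>)\<bar> < \<epsilon>"
    "\<F> (\<lambda>x. \<Sum>i<m. s i * v i x) - (\<Sum>j<m. s j * d j) \<le> energy_real \<mu>"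
proof -
  define G where "G = energy_real \<mu> - \<F> (\<lambda>_. 0)"
  have G: "G \<ge> 0"
    using energy_real_ge[OF \<mu>, of "\<lambda>_. 0"] by (simp add: G_def)
  \<comment> \<open>At the maximiser \<open>S \<le> 2 * k * G\<close>, so the error
    \<open>s j / k\<close> in the derivative has square at most \<open>2 * G / k\<close>; this
    \<open>k\<close> brings it below the square of \<epsilon>.\<close>
  define k where "k = 2 * (G + 1) / \<epsilon>\<^sup>2"
  have k: "k > 0" using G \<epsilon> by (simp add: k_def)
  define \<Phi> where "\<Phi> = (\<lambda>s. \<F> (\<lambda>x. \<Sum>j<m. s j * v j x) - (\<Sum>j<m. s j * (\<integral>x. v j x \<partial>\<mu>)) - (\<Sum>j<m. (s j)\<^sup>2) / (2 * k))"
  have "\<exists>s. \<forall>s'. \<Phi> s' \<le> \<Phi> s"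
    by (rule penalised_maximiser[where m=m and v=v, OF \<mu> v k \<Phi>_def]) (assumption, blast)
  then obtain s where s: "\<And>s'. \<Phi> s' \<le> \<Phi> s" by blast
  define u where "u x = (\<Sum>i<m. s i * v i x)" for x
  define S where "S = (\<Sum>j<m. (s j)\<^sup>2)"
  have uc: "continuous_on X u" unfolding u_def by (intro continuous_intros v) simp
  have int: "(\<integral>x. u x \<partial>\<mu>) = (\<Sum>j<m. s j * (\<integral>x. v j x \<partial>\<mu>))"
    unfolding u_def using integrable_continuous[OF \<mu> v] by (subst Bochner_Integration.integral_sum) auto
  have \<Phi>s: "\<Phi> s = \<F> u - (\<integral>x. u x \<partial>\<mu>) - S / (2 * k)"
    unfolding int by (simp add: \<Phi>_def u_def[abs_def] S_def)
  have en: "\<F> u - (\<integral>x. u x \<partial>\<mu>) \<le> energy_real \<mu>" by (rule energy_real_ge[OF \<mu> uc])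
  have "\<F> (\<lambda>_. 0) = \<Phi> (\<lambda>_. 0)" by (simp add: \<Phi>_def)
  then have "S / (2 * k) \<le> G" using s[of "\<lambda>_. 0"] \<Phi>s en unfolding G_def by linarith
  then have SG: "S \<le> 2 * k * G" using k by (simp add: pos_divide_le_eq mult.commute)
  have S0: "S \<ge> 0" by (simp add: S_def sum_nonneg)
  \<comment> \<open>The value that stationarity of \<Phi> imposes on the derivative of \<F> at
    \<open>u\<close> along \<open>v j\<close>: the penalty contributes
    \<open>s j / k\<close>.\<close>
  define d where "d j = (\<integral>x. v j x \<partial>\<mu>) + s j / k" for j
  have der: "((\<lambda>t. \<F> (\<lambda>x. u x + t * v j x)) has_real_derivative d j) (at 0)" if j: "j < m" for j
  proof -
    have "(\<lambda>t. \<F> (\<lambda>x. u x + t * v j x)) differentiable (at 0)"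
      using gateaux uc v[OF j] unfolding gateaux_differentiable_on_C0_def by blast
    then obtain D where D: "((\<lambda>t. \<F> (\<lambda>x. u x + t * v j x)) has_real_derivative D) (at 0)"
      using real_differentiableE by blast
    define \<phi> where "\<phi> t = \<F> (\<lambda>x. u x + t * v j x) - ((\<integral>x. u x \<partial>\<mu>) + t * (\<integral>x. v j x \<partial>\<mu>))
      - (S + 2 * t * s j + t\<^sup>2) / (2 * k)" for t
    have up: "(\<Sum>i<m. (s(j := s j + t)) i * c i) = (\<Sum>i<m. s i * c i) + t * c j" for t and c :: "nat \<Rightarrow> real"
    proof -
      have "(\<Sum>i<m. (s(j := s j + t)) i * c i) = (\<Sum>i<m. s i * c i + (if i = j then t * c j else 0))"
        by (intro sum.cong) (auto simp: distrib_right)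
      then show ?thesis using j by (simp add: sum.distrib)
    qed
    have up2: "(\<Sum>i<m. ((s(j := s j + t)) i)\<^sup>2) = S + 2 * t * s j + t\<^sup>2" for t
    proof -
      have "(\<Sum>i<m. ((s(j := s j + t)) i)\<^sup>2) = (\<Sum>i<m. (s i)\<^sup>2 + (if i = j then 2 * t * s j + t\<^sup>2 else 0))"
        by (intro sum.cong) (auto simp: power2_sum)
      then show ?thesis using j by (simp add: sum.distrib S_def)
    qed
    have \<phi>: "\<phi> t = \<Phi> (s(j := s j + t))" for t
      unfolding \<phi>_def \<Phi>_def up up2 int u_def by simp
    have "\<phi> t \<le> \<phi> 0" for t
      using s[of "s(j := s j + t)"] \<phi>[of t] \<phi>[of 0] by simp
    moreover have "(\<phi> has_real_derivative (D - (\<integral>x. v j x \<partial>\<mu>) - s j / k)) (at 0)"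
      unfolding \<phi>_def using k
      by (auto intro!: derivative_eq_intros D simp: field_simps)
    ultimately have "D - (\<integral>x. v j x \<partial>\<mu>) - s j / k = 0"
      by (intro DERIV_local_max[of \<phi> _ 0 1]) auto
    then have "D = d j" by (simp add: d_def)
    then show ?thesis using D by simp
  qed
  have close: "\<bar>d j - (\<integral>x. v j x \<partial>\<mu>)\<bar> < \<epsilon>" if j: "j < m" for j
  proof -
    have "(s j)\<^sup>2 \<le> S" unfolding S_def using member_le_sum[of j "{..<m}" "\<lambda>j. (s j)\<^sup>2"] j by simp
    then have "(s j)\<^sup>2 \<le> 2 * k * G" using SG by linarith
    also have "\<dots> < k * (2 * (G + 1))" using k by (simp add: algebra_simps)
    also have "\<dots> = k * (k * \<epsilon>\<^sup>2)" using \<epsilon> by (simp add: k_def)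
    also have "\<dots> = (k * \<epsilon>)\<^sup>2" by (simp add: power2_eq_square)
    finally have "\<bar>s j\<bar> < k * \<epsilon>" using k \<epsilon> by (intro power2_less_imp_less[of "\<bar>s j\<bar>"]) auto
    then have "\<bar>s j\<bar> / k < \<epsilon>" using k by (simp add: pos_divide_less_eq mult.commute)
    then show ?thesis using k by (simp add: d_def)
  qed
  \<comment> \<open>The penalty error has a favourable sign: the nonnegative term
    \<open>S / k\<close> only lowers the left-hand side of the energy bound.\<close>
  have "(\<Sum>j<m. s j * d j) = (\<integral>x. u x \<partial>\<mu>) + S / k"
    unfolding int S_def d_def by (simp add: distrib_left sum.distrib sum_divide_distrib power2_eq_square)
  then have "\<F> u - (\<Sum>j<m. s j * d j) \<le> energy_real \<mu>"
    using en divide_nonneg_pos[OF S0 k] by linarith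
  with der close that[of s d] show thesis unfolding u_def[abs_def] by blast
qed

text \<open>Take near-minimisers of the energy tilted by the combination \<open>u\<close> from
  \<open>approximate_subgradient\<close>. By \<open>near_minimiser_mean\<close> their averages of
  \<open>v j\<close> are near \<open>d j\<close>, hence near the integrals, and removing the tilt
  leaves about \<open>\<F> u - (\<Sum>j<m. s j * d j)\<close>, which is at most the energy of
  \<mu>.\<close>

lemma recovery_configurations:
  assumes \<mu>: "\<mu> \<in> prob_measures X" and U: "finite U" "\<And>u. u \<in> U \<Longrightarrow> continuous_on X u" and \<epsilon>: "\<epsilon> > 0"
  shows "eventually (\<lambda>N. \<exists>x\<in>config X N. (\<forall>u\<in>U. \<bar>(\<Sum>i<N. u (x i)) / real N - (\<integral>y. u y \<partial>\<mu>)\<bar> < \<epsilon>) \<and>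
    H N x / real N < energy_real \<mu> + \<epsilon>) sequentially"
proof -
  obtain v :: "nat \<Rightarrow> 'a \<Rightarrow> real" and m where Uv: "U = v ` {..<m}"
    using finite_imp_nat_seg_image_inj_on[OF U(1)] by (auto simp: lessThan_def)
  have v: "continuous_on X (v j)" if "j < m" for j using U(2) Uv that by auto
  have "\<exists>s d :: nat \<Rightarrow> real.
    (\<forall>j<m. ((\<lambda>t. \<F> (\<lambda>x. (\<Sum>i<m. s i * v i x) + t * v j x)) has_real_derivative d j) (at 0)) \<and>
    (\<forall>j<m. \<bar>d j - (\<integral>x. v j x \<partial>\<mu>)\<bar> < \<epsilon> / 2) \<and>
    \<F> (\<lambda>x. \<Sum>i<m. s i * v i x) - (\<Sum>j<m. s j * d j) \<le> energy_real \<mu>"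
    by (rule approximate_subgradient[where m=m and v=v, OF \<mu> v half_gt_zero[OF \<epsilon>]]) (assumption, blast)
  then obtain s d :: "nat \<Rightarrow> real" where
    sd: "\<And>j. j < m \<Longrightarrow> ((\<lambda>t. \<F> (\<lambda>x. (\<Sum>i<m. s i * v i x) + t * v j x)) has_real_derivative d j) (at 0)"
    "\<And>j. j < m \<Longrightarrow> \<bar>d j - (\<integral>x. v j x \<partial>\<mu>)\<bar> < \<epsilon> / 2"
    "\<F> (\<lambda>x. \<Sum>i<m. s i * v i x) - (\<Sum>j<m. s j * d j) \<le> energy_real \<mu>"
    by blast
  define u where "u = (\<lambda>x. \<Sum>i<m. s i * v i x)"
  have uc: "continuous_on X u" unfolding u_def by (intro continuous_intros v) simp
  define T where "T = (\<Sum>j<m. \<bar>s j\<bar>)"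
  have T: "T \<ge> 0" by (simp add: T_def sum_nonneg)
  \<comment> \<open>The first bound complements the \<open>\<epsilon> / 2\<close> between
    \<open>d j\<close> and the integral; the second keeps the error of the removed tilt, at most
    \<open>\<eta> * T\<close>, below \<open>\<epsilon> / 4\<close>.\<close>
  define \<eta> where "\<eta> = min (\<epsilon> / 2) (\<epsilon> / 4 / (T + 1))"
  have \<eta>: "\<eta> > 0" "\<eta> \<le> \<epsilon> / 2"
    using \<epsilon> T unfolding \<eta>_def by (simp, intro min.cobounded1)
  have \<eta>T: "\<eta> * T \<le> \<epsilon> / 4"
  proof -
    have "\<eta> * T \<le> \<epsilon> / 4 / (T + 1) * (T + 1)" using T \<epsilon> \<eta> by (intro mult_mono) (auto simp: \<eta>_def)
    also have "\<dots> = \<epsilon> / 4" using T by (intro nonzero_eq_divide_eq[THEN iffD1, OF _ refl]) simp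
    finally show ?thesis .
  qed
  define Q where "Q j \<tau> \<longleftrightarrow> \<tau> > 0 \<and> eventually (\<lambda>N. \<forall>x\<in>config X N.
      conf_energy N u x / real N < min_energy N u + \<tau> \<longrightarrow> \<bar>(\<Sum>i<N. v j (x i)) / real N - d j\<bar> < \<eta>) sequentially" for j \<tau>
  have "\<exists>\<tau>. Q j \<tau>" if j: "j < m" for j
  proof -
    have "((\<lambda>t. \<F> (\<lambda>x. u x + t * v j x)) has_real_derivative d j) (at 0)"
      using sd(1)[OF j] by (simp add: u_def)
    from near_minimiser_mean[OF uc v[OF j] this \<eta>(1)] show ?thesis unfolding Q_def by blast
  qed
  then obtain \<tau> where Q: "\<And>j. j < m \<Longrightarrow> Q j (\<tau> j)" by metis
  have \<tau>: "\<And>j. j < m \<Longrightarrow> \<tau> j > 0"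
    "\<And>j. j < m \<Longrightarrow> eventually (\<lambda>N. \<forall>x\<in>config X N. conf_energy N u x / real N < min_energy N u + \<tau> j \<longrightarrow>
      \<bar>(\<Sum>i<N. v j (x i)) / real N - d j\<bar> < \<eta>) sequentially"
    using Q unfolding Q_def by blast+
  define \<tau>0 where "\<tau>0 = Min (insert (\<epsilon> / 4) (\<tau> ` {..<m}))"
  have \<tau>0: "\<tau>0 > 0" "\<tau>0 \<le> \<epsilon> / 4" "\<And>j. j < m \<Longrightarrow> \<tau>0 \<le> \<tau> j"
  proof -
    show "\<tau>0 > 0" unfolding \<tau>0_def using \<epsilon> \<tau>(1) by (subst Min_gr_iff) auto
    show "\<tau>0 \<le> \<epsilon> / 4" "\<And>j. j < m \<Longrightarrow> \<tau>0 \<le> \<tau> j" unfolding \<tau>0_def by (intro Min_le; simp)+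
  qed
  have "eventually (\<lambda>N. \<forall>j\<in>{..<m}. \<forall>x\<in>config X N. conf_energy N u x / real N < min_energy N u + \<tau> j \<longrightarrow>
      \<bar>(\<Sum>i<N. v j (x i)) / real N - d j\<bar> < \<eta>) sequentially"
    using \<tau>(2) by (intro eventually_ball_finite) auto
  moreover have "eventually (\<lambda>N. \<bar>min_energy N u - \<F> u\<bar> < \<epsilon> / 4) sequentially"
    using tendstoD[OF min_energy_lim[OF uc], of "\<epsilon> / 4"] \<epsilon> by (simp add: dist_real_def)
  ultimately show ?thesis
  proof eventually_elim
    case (elim N)
    obtain x where x: "x \<in> config X N" "conf_energy N u x / real N < min_energy N u + \<tau>0"
      using min_energy_approx[OF \<tau>0(1)] by metis
    define V where "V j = (\<Sum>i<N. v j (x i)) / real N" for j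
    have V: "\<bar>V j - d j\<bar> < \<eta>" if "j < m" for j
      using elim(1) x \<tau>0(3)[OF that] that unfolding V_def by fastforce
    have "\<bar>V j - (\<integral>y. v j y \<partial>\<mu>)\<bar> < \<epsilon>" if "j < m" for j
      using V[OF that] sd(2)[OF that] \<eta>(2) by linarith
    then have 1: "\<forall>u\<in>U. \<bar>(\<Sum>i<N. u (x i)) / real N - (\<integral>y. u y \<partial>\<mu>)\<bar> < \<epsilon>"
      unfolding Uv V_def by auto
    have "(\<Sum>i<N. u (x i)) = (\<Sum>j<m. s j * (\<Sum>i<N. v j (x i)))"
      unfolding u_def by (subst sum.swap) (simp add: sum_distrib_left)
    then have "(\<Sum>i<N. u (x i)) / real N = (\<Sum>j<m. s j * V j)"
      by (simp add: V_def sum_divide_distrib[where A="{..<m}"])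
    then have 2: "H N x / real N + (\<Sum>j<m. s j * V j) < \<F> u + \<epsilon> / 2"
    proof -
      have "H N x / real N + (\<Sum>j<m. s j * V j) < min_energy N u + \<tau>0"
        using x(2) \<open>(\<Sum>i<N. u (x i)) / real N = (\<Sum>j<m. s j * V j)\<close> by (simp add: add_divide_distrib)
      then show ?thesis using elim(2) \<tau>0(2) by linarith
    qed
    have "(\<Sum>j<m. s j * d j) - (\<Sum>j<m. s j * V j) \<le> (\<Sum>j<m. \<eta> * \<bar>s j\<bar>)"
      unfolding sum_subtractf[symmetric]
    proof (rule sum_mono)
      fix j assume j: "j \<in> {..<m}"
      have "s j * (d j - V j) \<le> \<bar>s j\<bar> * \<bar>d j - V j\<bar>" by (metis abs_ge_self abs_mult)
      then have "s j * d j - s j * V j \<le> \<bar>s j\<bar> * \<bar>V j - d j\<bar>"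
        by (simp add: right_diff_distrib abs_minus_commute[of "d j"])
      also have "\<dots> \<le> \<bar>s j\<bar> * \<eta>" using V j by (intro mult_left_mono) (auto intro: less_imp_le)
      finally show "s j * d j - s j * V j \<le> \<eta> * \<bar>s j\<bar>" by (simp add: mult.commute)
    qed
    also have "\<dots> \<le> \<epsilon> / 4" using \<eta>T by (simp add: T_def sum_distrib_left)
    finally have "H N x / real N < energy_real \<mu> + \<epsilon>"
      using 2 sd(3) \<epsilon> unfolding u_def by linarith
    with 1 x(1) show ?case by blast
  qed
qed

text \<open>Points of a configuration in the same small cell can be matched by a permutation, so the energy
  per particle is nearly a function of the weak neighbourhood of the empirical measure.\<close>

lemma energy_le_near:
  assumes \<mu>: "\<mu> \<in> prob_measures X" and \<epsilon>: "\<epsilon> > 0"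
  obtains U \<eta> where "finite U" "\<And>u. u \<in> U \<Longrightarrow> continuous_on X u" "\<eta> > (0::real)"
    "eventually (\<lambda>N. \<forall>y\<in>config X N. (\<forall>u\<in>U. \<bar>(\<Sum>i<N. u (y i)) / real N - (\<integral>y. u y \<partial>\<mu>)\<bar> < \<eta>) \<longrightarrow>
      H N y / real N < energy_real \<mu> + \<epsilon>) sequentially"
proof -
  define D where "D = diameter X"
  have D: "D \<ge> 0" by (simp add: D_def diameter_ge_0 compact_imp_bounded[OF compact_X])
  \<comment> \<open>Budget per particle: matched pairs at distance at most
    \<open>\<epsilon>1\<close> cost \<open>\<epsilon> / 4\<close>; the unmatched particles, a
    fraction of at most \<open>2 * \<eta>1\<close> displaced by at most \<open>D\<close>, cost
    another \<open>\<epsilon> / 4\<close>.\<close>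
  define \<epsilon>1 where "\<epsilon>1 = \<epsilon> / 4 / (L + 1)"
  define \<eta>1 where "\<eta>1 = \<epsilon> / 8 / (L * D + 1)"
  have LD: "L * D \<ge> 0" using L_nonneg D by simp
  have \<epsilon>1: "\<epsilon>1 > 0" "L * \<epsilon>1 \<le> \<epsilon> / 4"
  proof -
    show "\<epsilon>1 > 0" using \<epsilon> L_nonneg by (simp add: \<epsilon>1_def)
    then have "L * \<epsilon>1 \<le> (L + 1) * \<epsilon>1" by (intro mult_right_mono) auto
    also have "(L + 1) * \<epsilon>1 = \<epsilon> / 4" using L_nonneg unfolding \<epsilon>1_def mult.commute[of "L + 1"]
      by (intro nonzero_eq_divide_eq[THEN iffD1, OF _ refl]) simp
    finally show "L * \<epsilon>1 \<le> \<epsilon> / 4" .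
  qed
  have \<eta>1: "\<eta>1 > 0" "L * D * \<eta>1 \<le> \<epsilon> / 8"
  proof -
    show "\<eta>1 > 0" using \<epsilon> LD by (simp add: \<eta>1_def)
    then have "L * D * \<eta>1 \<le> (L * D + 1) * \<eta>1" by (intro mult_right_mono) auto
    also have "(L * D + 1) * \<eta>1 = \<epsilon> / 8" using LD unfolding \<eta>1_def mult.commute[of "L * D + 1"]
      by (intro nonzero_eq_divide_eq[THEN iffD1, OF _ refl]) simp
    finally show "L * D * \<eta>1 \<le> \<epsilon> / 8" .
  qed
  obtain K :: "nat set" and u :: "nat \<Rightarrow> 'a \<Rightarrow> real" and lab :: "'a \<Rightarrow> nat" where cells:
    "finite K" "\<And>k S. k \<in> K \<Longrightarrow> continuous_on S (u k)"
    "\<And>k x. k \<in> K \<Longrightarrow> u k x \<le> (if lab x = k then 1 else 0)"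
    "\<And>x y. lab x \<in> K \<Longrightarrow> lab x = lab y \<Longrightarrow> dist x y \<le> \<epsilon>1"
    "1 - \<eta>1 \<le> (\<Sum>k\<in>K. \<integral>x. u k x \<partial>\<mu>)"
    using cell_functions[OF compact_X \<mu> \<epsilon>1(1) \<eta>1(1)] by metis
  define \<eta> where "\<eta> = min (\<epsilon> / 4) (\<eta>1 / (real (card K) + 1))"
  have \<eta>: "\<eta> > 0" "\<eta> \<le> \<epsilon> / 4"
    using \<epsilon> \<eta>1(1) unfolding \<eta>_def by (simp, intro min.cobounded1)
  have K\<eta>: "real (card K) * \<eta> \<le> \<eta>1"
  proof -
    have "real (card K) * \<eta> \<le> (real (card K) + 1) * (\<eta>1 / (real (card K) + 1))"
      using \<eta> by (intro mult_mono) (auto simp: \<eta>_def)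
    then show ?thesis by simp
  qed
  \<comment> \<open>The passage from weak closeness to counting: the average of a bump is a lower
    bound for the share of particles carrying its label.\<close>
  have count: "real N * ((\<integral>y. u k y \<partial>\<mu>) - \<eta>) \<le> real (card {i. i < N \<and> lab (x i) = k})"
    if k: "k \<in> K" and N: "N > 0" and x: "\<bar>(\<Sum>i<N. u k (x i)) / real N - (\<integral>y. u k y \<partial>\<mu>)\<bar> < \<eta>" for N x k
  proof -
    have "(\<integral>y. u k y \<partial>\<mu>) - \<eta> \<le> (\<Sum>i<N. u k (x i)) / real N" using x by linarith
    then have "real N * ((\<integral>y. u k y \<partial>\<mu>) - \<eta>) \<le> (\<Sum>i<N. u k (x i))"
      using N by (simp add: pos_le_divide_eq mult.commute)
    also have "\<dots> \<le> (\<Sum>i<N. if lab (x i) = k then 1 else 0)"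
      by (intro sum_mono cells(3) k)
    also have "\<dots> = real (card {i \<in> {..<N}. lab (x i) = k})"
      by (subst sum.inter_filter[symmetric]) simp_all
    also have "{i \<in> {..<N}. lab (x i) = k} = {i. i < N \<and> lab (x i) = k}" by auto
    finally show ?thesis .
  qed
  show thesis
  proof (rule that[of "u ` K" \<eta>])
    show "finite (u ` K)" "\<And>w. w \<in> u ` K \<Longrightarrow> continuous_on X w" "\<eta> > 0" using cells(1,2) \<eta> by auto
    have "eventually (\<lambda>N. \<exists>x\<in>config X N. (\<forall>w\<in>u ` K. \<bar>(\<Sum>i<N. w (x i)) / real N - (\<integral>y. w y \<partial>\<mu>)\<bar> < \<eta>) \<and>
      H N x / real N < energy_real \<mu> + \<eta>) sequentially"
      by (rule recovery_configurations[OF \<mu> _ _ \<eta>(1)]) (use cells(1,2) in auto)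
    then show "eventually (\<lambda>N. \<forall>y\<in>config X N. (\<forall>w\<in>u ` K. \<bar>(\<Sum>i<N. w (y i)) / real N - (\<integral>y. w y \<partial>\<mu>)\<bar> < \<eta>) \<longrightarrow>
      H N y / real N < energy_real \<mu> + \<epsilon>) sequentially"
      using eventually_gt_at_top[of 0]
    proof eventually_elim
      case (elim N)
      then have N: "N > 0" by simp
      obtain x where x: "x \<in> config X N" "\<And>k. k \<in> K \<Longrightarrow> \<bar>(\<Sum>i<N. u k (x i)) / real N - (\<integral>y. u k y \<partial>\<mu>)\<bar> < \<eta>"
        "H N x / real N < energy_real \<mu> + \<eta>"
        using elim(1) by blast
      show ?case
      proof (intro ballI impI)
        fix y assume y: "y \<in> config X N" "\<forall>w\<in>u ` K. \<bar>(\<Sum>i<N. w (y i)) / real N - (\<integral>y. w y \<partial>\<mu>)\<bar> < \<eta>"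
        define a where "a k = min (card {i. i < N \<and> lab (x i) = k}) (card {i. i < N \<and> lab (y i) = k})" for k
        obtain \<pi> S where \<pi>: "\<pi> permutes {..<N}" "S \<subseteq> {..<N}" "card S = (\<Sum>k\<in>K. a k)"
          "\<And>i. i \<in> S \<Longrightarrow> lab (x i) \<in> K \<and> lab (y (\<pi> i)) = lab (x i)"
          using matching_permutation[of K a N "\<lambda>i. lab (x i)" "\<lambda>i. lab (y i)"] cells(1) unfolding a_def
          by (metis (no_types, lifting) min.cobounded1 min.cobounded2)
        have yp: "y \<circ> \<pi> \<in> config X N"
          using y(1) permutes_in_image[OF \<pi>(1)] permutes_not_in[OF \<pi>(1)] by (auto simp: PiE_iff extensional_def)
        \<comment> \<open>The bumps miss mass at most \<open>\<eta>1\<close>, and the inexact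
          averages lose at most \<open>real (card K) * \<eta> \<le> \<eta>1\<close>; all other
          particles can be matched.\<close>
        have "real N * (1 - 2 * \<eta>1) \<le> real N * ((\<Sum>k\<in>K. \<integral>x. u k x \<partial>\<mu>) - real (card K) * \<eta>)"
          using cells(5) K\<eta> by (intro mult_left_mono) auto
        also have "\<dots> = (\<Sum>k\<in>K. real N * ((\<integral>x. u k x \<partial>\<mu>) - \<eta>))"
          by (simp add: sum_subtractf right_diff_distrib sum_distrib_left)
        also have "\<dots> \<le> (\<Sum>k\<in>K. real (a k))"
          using count[OF _ N x(2)] count[OF _ N, of _ y] y(2) by (intro sum_mono) (simp add: a_def min_def)
        also have "\<dots> = real (card S)" using \<pi>(3) by simp
        finally have cS: "real N * (1 - 2 * \<eta>1) \<le> real (card S)" .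
        have cSN: "card S \<le> N" using card_mono[OF _ \<pi>(2)] by simp
        have "(\<Sum>i<N. norm ((y \<circ> \<pi>) i - x i)) = (\<Sum>i\<in>S. norm ((y \<circ> \<pi>) i - x i)) + (\<Sum>i\<in>{..<N} - S. norm ((y \<circ> \<pi>) i - x i))"
          using \<pi>(2) by (subst sum.subset_diff[of S]) auto
        also have "\<dots> \<le> (\<Sum>i\<in>S. \<epsilon>1) + (\<Sum>i\<in>{..<N} - S. D)"
        proof (intro add_mono sum_mono)
          fix i assume "i \<in> S"
          then show "norm ((y \<circ> \<pi>) i - x i) \<le> \<epsilon>1"
            using \<pi>(4) cells(4)[of "y (\<pi> i)" "x i"] by (simp add: dist_norm)
        next
          fix i assume "i \<in> {..<N} - S"
          then have "(y \<circ> \<pi>) i \<in> X" "x i \<in> X"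
            using PiE_mem[OF yp, of i] PiE_mem[OF x(1), of i] by blast+
          then show "norm ((y \<circ> \<pi>) i - x i) \<le> D"
            unfolding D_def dist_norm[symmetric]
            by (intro diameter_bounded_bound compact_imp_bounded compact_X)
        qed
        also have "\<dots> = real (card S) * \<epsilon>1 + (real N - real (card S)) * D"
          using \<pi>(2) cSN by (simp add: card_Diff_subset finite_subset[OF \<pi>(2)] of_nat_diff)
        also have "\<dots> \<le> real N * \<epsilon>1 + (real N * (2 * \<eta>1)) * D"
          using cS cSN \<epsilon>1(1) D by (intro add_mono mult_right_mono) (auto simp: algebra_simps)
        finally have "L * (\<Sum>i<N. norm ((y \<circ> \<pi>) i - x i)) \<le> L * (real N * \<epsilon>1 + (real N * (2 * \<eta>1)) * D)"
          using L_nonneg by (rule mult_left_mono)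
        also have "\<dots> = real N * (L * \<epsilon>1 + 2 * (L * D * \<eta>1))" by (simp add: algebra_simps)
        also have "\<dots> \<le> real N * (\<epsilon> / 2)" using \<epsilon>1(2) \<eta>1(2) by (intro mult_left_mono) auto
        finally have "H N (y \<circ> \<pi>) \<le> H N x + real N * (\<epsilon> / 2)" using lip[OF yp x(1)] by linarith
        moreover have "H N (y \<circ> \<pi>) = H N y" using ham[of N] \<pi>(1) y(1) by (simp add: is_hamiltonian_def)
        ultimately have "H N y / real N \<le> (H N x + real N * (\<epsilon> / 2)) / real N" by (intro divide_right_mono) auto
        also have "\<dots> = H N x / real N + \<epsilon> / 2" using N by (simp add: add_divide_distrib)
        finally show "H N y / real N < energy_real \<mu> + \<epsilon>" using x(3) \<eta>(2) \<epsilon> by linarith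
      qed
    qed
  qed
qed

end

subsection \<open>Independent samples\<close>

text \<open>Lifts the change of measure from one particle to independent samples; checked on
  rectangles, where both sides factor.\<close>

lemma PiM_density:
  fixes f :: "'a \<Rightarrow> real"
  assumes M: "prob_space M" and f[measurable]: "f \<in> borel_measurable M" and f0: "\<And>x. 0 \<le> f x"
    and D: "prob_space (density M f)" and I: "finite I"
  shows "density (PiM I (\<lambda>_. M)) (\<lambda>x. ennreal (\<Prod>i\<in>I. f (x i))) = PiM I (\<lambda>_. density M f)"
proof -
  interpret M: prob_space M by fact
  interpret D: prob_space "density M f" by fact
  interpret PM: product_sigma_finite "\<lambda>_. M" ..
  interpret PD: product_sigma_finite "\<lambda>_. density M f" ..
  show ?thesis
  proof (rule PD.PiM_eqI[OF I])
    show "sets (density (PiM I (\<lambda>_. M)) (\<lambda>x. ennreal (\<Prod>i\<in>I. f (x i)))) = sets (PiM I (\<lambda>_. density M f))"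
      by (simp, intro sets_PiM_cong) auto
    fix A assume "\<And>i. i \<in> I \<Longrightarrow> A i \<in> sets (density M f)"
    then have A: "\<And>i. i \<in> I \<Longrightarrow> A i \<in> sets M" by simp
    have "emeasure (density (PiM I (\<lambda>_. M)) (\<lambda>x. ennreal (\<Prod>i\<in>I. f (x i)))) (Pi\<^sub>E I A)
        = (\<integral>\<^sup>+x. ennreal (\<Prod>i\<in>I. f (x i)) * indicator (Pi\<^sub>E I A) x \<partial>PiM I (\<lambda>_. M))"
      using A I by (intro emeasure_density) auto
    also have "\<dots> = (\<integral>\<^sup>+x. (\<Prod>i\<in>I. ennreal (f (x i)) * indicator (A i) (x i)) \<partial>PiM I (\<lambda>_. M))"
    proof (rule nn_integral_cong)
      fix x assume "x \<in> space (PiM I (\<lambda>_. M))"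
      then have "indicator (Pi\<^sub>E I A) x = (\<Prod>i\<in>I. indicator (A i) (x i) :: ennreal)"
        using I by (auto simp: indicator_def PiE_iff space_PiM prod_zero_iff)
      then show "ennreal (\<Prod>i\<in>I. f (x i)) * indicator (Pi\<^sub>E I A) x
          = (\<Prod>i\<in>I. ennreal (f (x i)) * indicator (A i) (x i))"
        using f0 by (simp add: prod.distrib prod_ennreal)
    qed
    also have "\<dots> = (\<Prod>i\<in>I. \<integral>\<^sup>+x. ennreal (f x) * indicator (A i) x \<partial>M)"
      using A by (intro PM.product_nn_integral_prod[OF I]) auto
    also have "\<dots> = (\<Prod>i\<in>I. emeasure (density M f) (A i))"
      using A by (intro prod.cong refl) (simp add: emeasure_density)
    finally show "emeasure (density (PiM I (\<lambda>_. M)) (\<lambda>x. ennreal (\<Prod>i\<in>I. f (x i)))) (Pi\<^sub>E I A)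
      = (\<Prod>i\<in>I. emeasure (density M f) (A i))" .
  qed
qed

lemma integral_PiM_component:
  fixes g :: "'a \<Rightarrow> real"
  assumes M: "prob_space M" and g: "g \<in> borel_measurable M" and i: "i \<in> I"
  shows "integrable (PiM I (\<lambda>_. M)) (\<lambda>x. g (x i)) \<longleftrightarrow> integrable M g"
    and "(\<integral>x. g (x i) \<partial>PiM I (\<lambda>_. M)) = (\<integral>x. g x \<partial>M)"
proof -
  have d: "distr (PiM I (\<lambda>_. M)) M (\<lambda>x. x i) = M"
    using distr_PiM_component[of I "\<lambda>_. M" i] M i by simp
  have m: "(\<lambda>x. x i) \<in> measurable (PiM I (\<lambda>_. M)) M" using i by simp
  show "integrable (PiM I (\<lambda>_. M)) (\<lambda>x. g (x i)) \<longleftrightarrow> integrable M g"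
    using integrable_distr_eq[OF m g] d by simp
  show "(\<integral>x. g (x i) \<partial>PiM I (\<lambda>_. M)) = (\<integral>x. g x \<partial>M)"
    using integral_distr[OF m g] d by simp
qed

text \<open>Additivity of entropy. The logarithm of the product splits where all factors are
  positive, which is almost everywhere for the measure with density \<open>f\<close>.\<close>

lemma entropy_PiM_density:
  fixes f :: "'a \<Rightarrow> real"
  assumes M: "prob_space M" and f[measurable]: "f \<in> borel_measurable M" and f0: "\<And>x. 0 \<le> f x"
    and D: "prob_space (density M f)" and I: "finite I"
    and ln_int: "integrable (density M f) (\<lambda>x. ln (f x))"
  shows "integrable (PiM I (\<lambda>_. density M f)) (\<lambda>x. ln (\<Prod>i\<in>I. f (x i)))"
    and "(\<integral>x. ln (\<Prod>i\<in>I. f (x i)) \<partial>PiM I (\<lambda>_. density M f)) = real (card I) * (\<integral>x. ln (f x) \<partial>density M f)"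
proof -
  let ?D = "density M f" and ?R = "PiM I (\<lambda>_. density M f)"
  interpret D: prob_space ?D by fact
  have pos: "AE x in ?D. f x > 0" using f0 by (simp add: AE_density less_le)
  have posI: "AE x in ?R. \<forall>i\<in>I. f (x i) > 0"
    using I by (intro AE_finite_allI AE_PiM_component[where M="\<lambda>_. ?D" and P="\<lambda>y. f y > 0"] D pos)
  have eq: "AE x in ?R. ln (\<Prod>i\<in>I. f (x i)) = (\<Sum>i\<in>I. ln (f (x i)))"
    using posI by eventually_elim (intro ln_prod I, auto)
  have c: "integrable ?R (\<lambda>x. ln (f (x i)))" "(\<integral>x. ln (f (x i)) \<partial>?R) = (\<integral>x. ln (f x) \<partial>?D)" if "i \<in> I" for i
    using integral_PiM_component[OF D _ that, of "\<lambda>x. ln (f x)"] ln_int by simp_all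
  have m: "(\<lambda>x. ln (\<Prod>i\<in>I. f (x i))) \<in> borel_measurable ?R" by measurable
  have si: "integrable ?R (\<lambda>x. \<Sum>i\<in>I. ln (f (x i)))" using c by auto
  show "integrable ?R (\<lambda>x. ln (\<Prod>i\<in>I. f (x i)))"
    using si by (subst integrable_cong_AE[OF m _ eq]) auto
  have "(\<integral>x. ln (\<Prod>i\<in>I. f (x i)) \<partial>?R) = (\<integral>x. (\<Sum>i\<in>I. ln (f (x i))) \<partial>?R)"
    by (rule integral_cong_AE[OF m _ eq]) (use si in auto)
  also have "\<dots> = real (card I) * (\<integral>x. ln (f x) \<partial>?D)"
    using c by (subst Bochner_Integration.integral_sum) auto
  finally show "(\<integral>x. ln (\<Prod>i\<in>I. f (x i)) \<partial>?R) = real (card I) * (\<integral>x. ln (f x) \<partial>?D)" .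
qed

text \<open>Hoeffding's inequality bounds the probability by a quantity that decays exponentially in
  \<open>N\<close>.\<close>

lemma iid_weak_law:
  fixes u :: "'a \<Rightarrow> real"
  assumes M: "prob_space M" and u[measurable]: "u \<in> borel_measurable M"
    and B: "\<And>x. x \<in> space M \<Longrightarrow> \<bar>u x\<bar> \<le> B" and \<eta>: "\<eta> > 0"
  shows "(\<lambda>N. measure (PiM {..<N} (\<lambda>_. M))
    {x \<in> space (PiM {..<N} (\<lambda>_. M)). \<eta> \<le> \<bar>(\<Sum>i<N. u (x i)) / real N - (\<integral>x. u x \<partial>M)\<bar>}) \<longlonglongrightarrow> 0"
proof -
  \<comment> \<open>Strictly positive, so that the interval from \<open>- B'\<close> to
    \<open>B'\<close> is nondegenerate and the Hoeffding exponent has a nonzero denominator.\<close>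
  define B' where "B' = \<bar>B\<bar> + 1"
  have B': "\<bar>u x\<bar> \<le> B'" if "x \<in> space M" for x using B[OF that] by (simp add: B'_def)
  have "measure (PiM {..<N} (\<lambda>_. M))
    {x \<in> space (PiM {..<N} (\<lambda>_. M)). \<eta> \<le> \<bar>(\<Sum>i<N. u (x i)) / real N - (\<integral>x. u x \<partial>M)\<bar>}
      \<le> 2 * exp (-2 * real N * \<eta>\<^sup>2 / (B' - - B')\<^sup>2)" if N: "N > 0" for N
  proof -
    let ?R = "PiM {..<N} (\<lambda>_. M)"
    interpret R: prob_space ?R by (rule prob_space_PiM) (rule M)
    have cm: "(\<lambda>x. x i) \<in> measurable ?R M" if "i \<in> {..<N}" for i using that by simp
    have ind: "R.indep_vars (\<lambda>_. M) (\<lambda>i x. x i) {..<N}"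
    proof (subst R.indep_vars_iff_distr_eq_PiM')
      have "distr ?R ?R (\<lambda>x. \<lambda>i\<in>{..<N}. x i) = distr ?R ?R (\<lambda>x. x)"
        by (rule distr_cong) (auto simp: space_PiM PiE_restrict)
      also have "\<dots> = ?R" by (simp add: distr_id2)
      also have "\<dots> = (\<Pi>\<^sub>M i\<in>{..<N}. distr ?R M (\<lambda>x. x i))"
        using distr_PiM_component[of "{..<N}" "\<lambda>_. M"] M by (intro PiM_cong) simp_all
      finally show "distr ?R ?R (\<lambda>x. \<lambda>i\<in>{..<N}. x i) = (\<Pi>\<^sub>M i\<in>{..<N}. distr ?R M (\<lambda>x. x i))" .
    qed (use N cm in auto)
    have d: "distr ?R borel (\<lambda>x. u (x i)) = distr M borel u" if "i \<in> {..<N}" for i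
      using distr_PiM_component[of "{..<N}" "\<lambda>_. M" i] M that distr_distr[OF u cm[OF that]]
      by (simp add: comp_def)
    have "iid_interval_bounded_random_variables ?R {..<N} (\<lambda>i x. u (x i)) (\<lambda>x. u (x 0)) (- B') B'"
    proof (unfold_locales)
      show "R.indep_vars (\<lambda>_. borel) (\<lambda>i x. u (x i)) {..<N}"
        by (rule R.indep_vars_compose2[OF ind]) simp
      show "AE x in ?R. u (x 0) \<in> {- B'..B'}"
        using B' N by (intro AE_I2) (force simp: space_PiM PiE_iff abs_le_iff)
      show "distr ?R borel (\<lambda>x. u (x i)) = distr ?R borel (\<lambda>x. u (x 0))" if "i \<in> {..<N}" for i
        unfolding d[OF that] using d[of 0] N by simp
      show "(\<lambda>x. u (x 0)) \<in> borel_measurable ?R"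
        using measurable_compose[OF cm[of 0] u] N by simp
    qed (rule finite_lessThan)
    note hoeffding = Hoeffding_ineq_iid.Hoeffding_ineq_abs_ge'[OF Hoeffding_ineq_iid.intro[OF this]]
    have e: "R.expectation (\<lambda>x. u (x 0)) = (\<integral>x. u x \<partial>M)"
      using integral_PiM_component(2)[OF M u, of 0 "{..<N}"] N by simp
    show ?thesis
      using hoeffding[of \<eta>] \<eta> N unfolding e by (simp add: B'_def lessThan_empty_iff)
  qed
  then have ev: "eventually (\<lambda>N. measure (PiM {..<N} (\<lambda>_. M))
    {x \<in> space (PiM {..<N} (\<lambda>_. M)). \<eta> \<le> \<bar>(\<Sum>i<N. u (x i)) / real N - (\<integral>x. u x \<partial>M)\<bar>}
      \<le> 2 * exp (-2 * real N * \<eta>\<^sup>2 / (B' - - B')\<^sup>2)) sequentially"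
    by (rule eventually_mono[OF eventually_gt_at_top[of 0]])
  define c where "c = 2 * \<eta>\<^sup>2 / (B' - - B')\<^sup>2"
  have c: "c > 0" using \<eta> by (simp add: c_def B'_def)
  have "(\<lambda>N. exp (- (c * real N))) \<longlonglongrightarrow> 0"
    by (intro filterlim_compose[OF exp_at_bot] filterlim_compose[OF filterlim_uminus_at_bot_at_top]
        filterlim_tendsto_pos_mult_at_top[OF tendsto_const c filterlim_real_sequentially])
  then have "(\<lambda>N. 2 * exp (- (c * real N))) \<longlonglongrightarrow> 2 * 0" by (intro tendsto_intros)
  moreover have "2 * exp (-2 * real N * \<eta>\<^sup>2 / (B' - - B')\<^sup>2) = 2 * exp (- (c * real N))" for N
    by (simp add: c_def)
  ultimately have lim: "(\<lambda>N. 2 * exp (-2 * real N * \<eta>\<^sup>2 / (B' - - B')\<^sup>2)) \<longlonglongrightarrow> 0" by simp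
  show ?thesis
    by (rule tendsto_sandwich[OF _ ev tendsto_const lim]) simp
qed

subsection \<open>Large deviations\<close>

locale gibbs_limit = differentiable_limit +
  fixes \<mu>0 :: "'a measure" and \<beta> :: real
  assumes \<mu>0: "\<mu>0 \<in> prob_measures X" and \<beta>: "\<beta> > 0"
begin

sublocale M0: prob_space \<mu>0
  by (rule prob_measuresD[OF \<mu>0])

definition cumulant :: "('a \<Rightarrow> real) \<Rightarrow> real" where
  "cumulant w = ln (\<integral>x. exp (w x) \<partial>\<mu>0)"

text \<open>One affine minorant, as a function of the mean \<open>l\<close>: the supremum over all
  admissible \<open>u\<close> and \<open>w\<close> at a probability measure is \<beta> times its
  energy plus its relative entropy.\<close>

definition dual :: "('a \<Rightarrow> real) \<Rightarrow> ('a \<Rightarrow> real) \<Rightarrow> (('a \<Rightarrow> real) \<Rightarrow> real) \<Rightarrow> real" where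
  "dual u w l = \<beta> * (\<F> u - l u) + l w - cumulant w"

text \<open>The rate functional multiplied by \<beta>, before its constant is subtracted; in this
  scale all exponents take the form \<open>real N * a\<close>.\<close>

definition rate :: "'a measure \<Rightarrow> ereal" where
  "rate \<mu> = ereal (\<beta> * energy_real \<mu>) + rel_entropy \<mu>0 \<mu>"

lemma exp_bounded_borel:
  assumes w: "w \<in> bounded_borel X"
  shows "integrable \<mu>0 (\<lambda>x. exp (w x))" "(\<integral>x. exp (w x) \<partial>\<mu>0) > 0"
proof -
  obtain B where B: "\<And>x. x \<in> X \<Longrightarrow> \<bar>w x\<bar> \<le> B" using bounded_borelE[OF w] by blast
  have [measurable]: "w \<in> borel_measurable \<mu>0"
    unfolding prob_measuresD(4)[OF \<mu>0] by (rule bounded_borel_measurable[OF w])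
  show i: "integrable \<mu>0 (\<lambda>x. exp (w x))"
    by (rule M0.integrable_const_bound[of _ "exp B"])
      (use B prob_measuresD(3)[OF \<mu>0] in \<open>auto simp: abs_le_iff\<close>)
  have "exp (- B) \<le> (\<integral>x. exp (w x) \<partial>\<mu>0)"
    by (rule M0.integral_ge_const[OF i])
      (use B prob_measuresD(3)[OF \<mu>0] in \<open>force simp: abs_le_iff\<close>)
  then show "(\<integral>x. exp (w x) \<partial>\<mu>0) > 0" using exp_gt_zero[of "- B"] by linarith
qed

lemma rel_entropy_le_iff:
  assumes \<mu>: "\<mu> \<in> prob_measures X"
  shows "rel_entropy \<mu>0 \<mu> \<le> ereal d \<longleftrightarrow> (\<forall>w\<in>bounded_borel X. (\<integral>x. w x \<partial>\<mu>) - cumulant w \<le> d)"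
proof
  note M = prob_measuresD[OF \<mu>] and M0 = prob_measuresD[OF \<mu>0]
  have s: "sets \<mu> = sets \<mu>0" using M M0 by simp
  show "rel_entropy \<mu>0 \<mu> \<le> ereal d" if *: "\<forall>w\<in>bounded_borel X. (\<integral>x. w x \<partial>\<mu>) - cumulant w \<le> d"
  proof (rule M0.rel_entropy_le_if_variational_bound[OF M(1) s])
    fix w :: "'a \<Rightarrow> real" and B assume w: "w \<in> borel_measurable \<mu>0" "\<And>x. x \<in> space \<mu>0 \<Longrightarrow> \<bar>w x\<bar> \<le> B"
    have "w \<in> bounded_borel X" by (rule bounded_borelI[of _ _ B]) (use w M0 in auto)
    then show "(\<integral>x. w x \<partial>\<mu>) - ln (\<integral>x. exp (w x) \<partial>\<mu>0) \<le> d"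
      using * unfolding cumulant_def by blast
  qed
  show "\<forall>w\<in>bounded_borel X. (\<integral>x. w x \<partial>\<mu>) - cumulant w \<le> d" if *: "rel_entropy \<mu>0 \<mu> \<le> ereal d"
  proof
    fix w assume w: "w \<in> bounded_borel X"
    have "rel_entropy \<mu>0 \<mu> \<noteq> \<infinity>" using * by auto
    then obtain f :: "'a \<Rightarrow> real" where f: "f \<in> borel_measurable \<mu>0" "\<And>x. 0 \<le> f x" "\<mu> = density \<mu>0 f"
      "integrable (density \<mu>0 f) (\<lambda>x. ln (f x))"
      using M0.rel_entropy_finiteE[OF M(1) s] by metis
    obtain B where B: "\<And>x. x \<in> X \<Longrightarrow> \<bar>w x\<bar> \<le> B" using bounded_borelE[OF w] by blast
    have "(\<integral>x. w x \<partial>density \<mu>0 f) \<le> (\<integral>x. ln (f x) \<partial>density \<mu>0 f) + ln (\<integral>x. exp (w x) \<partial>\<mu>0)"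
      by (rule M0.entropy_variational_le[where B=B])
        (use f M M0 B bounded_borel_measurable[OF w] in auto)
    moreover have "(\<integral>x. ln (f x) \<partial>density \<mu>0 f) \<le> d"
      using * M0.rel_entropy_density[OF f(1) f(2) f(4)] f(3) by simp
    ultimately show "(\<integral>x. w x \<partial>\<mu>) - cumulant w \<le> d"
      unfolding cumulant_def f(3) by linarith
  qed
qed

lemma rel_entropy_nonneg:
  assumes \<mu>: "\<mu> \<in> prob_measures X"
  shows "rel_entropy \<mu>0 \<mu> \<ge> 0"
proof (rule ccontr)
  assume "\<not> ?thesis"
  moreover have "rel_entropy \<mu>0 \<mu> \<noteq> - \<infinity>" by (simp add: rel_entropy_def)
  ultimately obtain d where d: "rel_entropy \<mu>0 \<mu> = ereal d" "d < 0"
    by (cases "rel_entropy \<mu>0 \<mu>") auto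
  then have "(\<integral>x. 0 \<partial>\<mu>) - cumulant (\<lambda>_. 0) \<le> d"
    using rel_entropy_le_iff[OF \<mu>, of d] bounded_borel_const[of 0 X] by auto
  then show False using d(2) M0.prob_space by (simp add: cumulant_def)
qed

text \<open>As \<open>u\<close> and \<open>w\<close> vary independently, a bound for all pairs is a
  bound on the sum of the two suprema. Phrasing it through real levels covers infinite entropy as
  well.\<close>

lemma rate_le_iff:
  assumes \<mu>: "\<mu> \<in> prob_measures X"
  shows "rate \<mu> \<le> ereal a \<longleftrightarrow>
    (\<forall>(u :: 'a \<Rightarrow> real) w. continuous_on X u \<longrightarrow> w \<in> bounded_borel X \<longrightarrow> dual u w (\<lambda>v. \<integral>x. v x \<partial>\<mu>) \<le> a)"
proof -
  have "rate \<mu> \<le> ereal a \<longleftrightarrow> rel_entropy \<mu>0 \<mu> \<le> ereal (a - \<beta> * energy_real \<mu>)"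
    unfolding rate_def by (cases "rel_entropy \<mu>0 \<mu>") auto
  also have "\<dots> \<longleftrightarrow> (\<forall>w\<in>bounded_borel X. (\<integral>x. w x \<partial>\<mu>) - cumulant w \<le> a - \<beta> * energy_real \<mu>)"
    by (rule rel_entropy_le_iff[OF \<mu>])
  also have "\<dots> \<longleftrightarrow> (\<forall>(u :: 'a \<Rightarrow> real) w. continuous_on X u \<longrightarrow> w \<in> bounded_borel X \<longrightarrow> dual u w (\<lambda>v. \<integral>x. v x \<partial>\<mu>) \<le> a)"
  proof (intro iffI allI impI ballI)
    fix u w :: "'a \<Rightarrow> real" assume *: "\<forall>w\<in>bounded_borel X. (\<integral>x. w x \<partial>\<mu>) - cumulant w \<le> a - \<beta> * energy_real \<mu>"
      and u: "continuous_on X u" and w: "w \<in> bounded_borel X"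
    have "\<beta> * (\<F> u - (\<integral>x. u x \<partial>\<mu>)) \<le> \<beta> * energy_real \<mu>"
      using energy_real_ge[OF \<mu> u] \<beta> by (intro mult_left_mono) auto
    moreover have "(\<integral>x. w x \<partial>\<mu>) - cumulant w \<le> a - \<beta> * energy_real \<mu>" using * w by blast
    ultimately show "dual u w (\<lambda>v. \<integral>x. v x \<partial>\<mu>) \<le> a" unfolding dual_def by linarith
  next
    fix w assume *: "\<forall>(u :: 'a \<Rightarrow> real) w. continuous_on X u \<longrightarrow> w \<in> bounded_borel X \<longrightarrow> dual u w (\<lambda>v. \<integral>x. v x \<partial>\<mu>) \<le> a"
      and w: "w \<in> bounded_borel X"
    have "energy_real \<mu> \<le> (a - ((\<integral>x. w x \<partial>\<mu>) - cumulant w)) / \<beta>"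
    proof (rule energy_real_le)
      fix u :: "'a \<Rightarrow> real" assume u: "continuous_on X u"
      have "dual u w (\<lambda>v. \<integral>x. v x \<partial>\<mu>) \<le> a" using * u w by blast
      then have "(\<F> u - (\<integral>x. u x \<partial>\<mu>)) * \<beta> \<le> a - ((\<integral>x. w x \<partial>\<mu>) - cumulant w)"
        unfolding dual_def by (simp add: mult.commute)
      then show "\<F> u - (\<integral>x. u x \<partial>\<mu>) \<le> (a - ((\<integral>x. w x \<partial>\<mu>) - cumulant w)) / \<beta>"
        using \<beta> by (simp add: pos_le_divide_eq)
    qed
    then have "energy_real \<mu> * \<beta> \<le> a - ((\<integral>x. w x \<partial>\<mu>) - cumulant w)"
      using \<beta> by (simp add: pos_le_divide_eq)
    then show "(\<integral>x. w x \<partial>\<mu>) - cumulant w \<le> a - \<beta> * energy_real \<mu>" by (simp add: mult.commute)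
  qed
  finally show ?thesis .
qed

text \<open>Embeds the probability measures into the compact space of means, with the same value 0
  off \<open>bounded_borel\<close>.\<close>

definition of_measure :: "'a measure \<Rightarrow> ('a \<Rightarrow> real) \<Rightarrow> real" where
  "of_measure \<mu> w = (if w \<in> bounded_borel X then \<integral>x. w x \<partial>\<mu> else 0)"

lemma of_measure_in: "\<mu> \<in> prob_measures X \<Longrightarrow> of_measure \<mu> \<in> mean_functionals X"
  using integral_in_mean_functionals unfolding of_measure_def[abs_def] .

lemma dual_of_measure:
  "continuous_on X u \<Longrightarrow> w \<in> bounded_borel X \<Longrightarrow> dual u w (of_measure \<mu>) = dual u w (\<lambda>v. \<integral>x. v x \<partial>\<mu>)"
  by (simp add: dual_def of_measure_def continuous_bounded_borel[OF compact_X])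

lemma continuous_on_dual: "continuous_on S (dual u w)"
  unfolding dual_def
  by (intro continuous_intros continuous_on_subset[OF continuous_on_product_coordinates]) auto

text \<open>The dual bounds with \<open>u = 0\<close> are the cumulant bounds that make
  \<open>l\<close> countably additive, with constant
  \<open>a - \<beta> * \<F> (\<lambda>_. 0)\<close>. All dual bounds together then control the rate
  of the resulting measure.\<close>

lemma mean_functional_rate:
  assumes l: "l \<in> mean_functionals X"
    and le: "\<And>u w. continuous_on X u \<Longrightarrow> w \<in> bounded_borel X \<Longrightarrow> dual u w l \<le> a"
  obtains \<mu> where "\<mu> \<in> prob_measures X" "rate \<mu> \<le> ereal a" "l = of_measure \<mu>"
proof -
  have bound: "l w \<le> (a - \<beta> * \<F> (\<lambda>_. 0)) + ln (\<integral>x. exp (w x) \<partial>\<mu>0)" if "w \<in> bounded_borel X" for w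
    using le[of "\<lambda>_. 0" w] that mean_functional_const[OF l, of 0] by (simp add: dual_def cumulant_def)
  obtain \<mu> where \<mu>: "\<mu> \<in> prob_measures X" "\<And>w. w \<in> bounded_borel X \<Longrightarrow> l w = (\<integral>x. w x \<partial>\<mu>)"
    using mean_functional_is_integral[OF l \<mu>0 bound] by blast
  have eq: "l = of_measure \<mu>"
    using \<mu>(2) l by (auto simp: of_measure_def mean_functionals_def fun_eq_iff)
  have "rate \<mu> \<le> ereal a"
    unfolding rate_le_iff[OF \<mu>(1)] using le dual_of_measure eq by metis
  with \<mu>(1) eq that show thesis by blast
qed

text \<open>Cover the compact set of means: one that satisfies all dual bounds with \<open>a\<close> is a measure of rate at
  most \<open>a\<close>, hence lies off \<open>A\<close>.\<close>

lemma closed_dual_cover: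
  assumes A: "closedin (weak_topology X) A" and rate: "\<And>\<mu>. \<mu> \<in> A \<Longrightarrow> \<not> rate \<mu> \<le> ereal a"
  obtains T a' where "finite T" "a < a'" "\<And>u w. (u, w) \<in> T \<Longrightarrow> continuous_on X u \<and> w \<in> bounded_borel X"
    "\<And>\<mu>. \<mu> \<in> A \<Longrightarrow> \<exists>(u, w)\<in>T. a' < dual u w (\<lambda>v. \<integral>x. v x \<partial>\<mu>)"
proof -
  \<comment> \<open>Each pair carries a level strictly above \<open>a\<close>: finitely many such
    levels have a minimum above \<open>a\<close>, which produces the uniform gap.\<close>
  define I where "I = {(u :: 'a \<Rightarrow> real, w, c). continuous_on X u \<and> w \<in> bounded_borel X \<and> a < (c::real)}"
  define O1 where "O1 = (\<lambda>(u, w, c). {l. c < dual u w l})"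
  \<comment> \<open>Open sets of means containing no measure from \<open>A\<close>. They take care
    of the means satisfying all dual bounds with \<open>a\<close>, which lie in none of the
    half-spaces.\<close>
  define V where "V = {W. open W \<and> (\<forall>\<nu>\<in>prob_measures X. of_measure \<nu> \<in> W \<longrightarrow> \<nu> \<notin> A)}"
  have AX: "A \<subseteq> prob_measures X" using closedin_subset[OF A] by (simp add: topspace_weak_topology)
  have "open (O1 i)" for i
  proof -
    obtain u w c where i: "i = (u, w, c)" by (metis prod_cases3)
    have "open {l. c < dual u w l}"
      by (rule open_Collect_less) (auto intro: continuous_on_const continuous_on_dual)
    then show ?thesis by (simp add: O1_def i)
  qed
  then have op: "\<And>B. B \<in> O1 ` I \<union> V \<Longrightarrow> open B" by (auto simp: V_def)
  have cov: "mean_functionals X \<subseteq> \<Union>(O1 ` I \<union> V)"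
  proof
    fix l assume l: "l \<in> mean_functionals X"
    show "l \<in> \<Union>(O1 ` I \<union> V)"
    proof (cases "\<exists>(u :: 'a \<Rightarrow> real) w. continuous_on X u \<and> w \<in> bounded_borel X \<and> a < dual u w l")
      case True
      then obtain u w where uw: "continuous_on X u" "w \<in> bounded_borel X" "a < dual u w l" by blast
      obtain c where "a < c" "c < dual u w l" using dense[OF uw(3)] by blast
      then have "(u, w, c) \<in> I" "l \<in> O1 (u, w, c)" using uw by (auto simp: I_def O1_def)
      then show ?thesis by blast
    next
      case False
      then have le: "dual u w l \<le> a" if "continuous_on X u" "w \<in> bounded_borel X" for u w
        using that by (meson not_le)
      obtain \<mu> where \<mu>: "\<mu> \<in> prob_measures X" "rate \<mu> \<le> ereal a" "l = of_measure \<mu>"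
        using mean_functional_rate[OF l le] by blast
      have "\<mu> \<in> prob_measures X - A" using \<mu> rate by blast
      moreover have "openin (weak_topology X) (prob_measures X - A)"
        using A by (simp add: closedin_def topspace_weak_topology)
      ultimately obtain U \<eta> where U: "finite U" "\<And>u. u \<in> U \<Longrightarrow> continuous_on X u" "\<eta> > (0::real)"
        "\<And>\<nu>. \<nu> \<in> prob_measures X \<Longrightarrow> (\<And>u. u \<in> U \<Longrightarrow> \<bar>(\<integral>x. u x \<partial>\<nu>) - (\<integral>x. u x \<partial>\<mu>)\<bar> < \<eta>) \<Longrightarrow> \<nu> \<in> prob_measures X - A"
        using weak_topology_neighbourhood[of X "prob_measures X - A" \<mu>] by blast
      define W where "W = (\<Inter>u\<in>U. {l. \<bar>l u - (\<integral>x. u x \<partial>\<mu>)\<bar> < \<eta>})"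
      have "open W" unfolding W_def
        by (intro open_INT U ballI open_Collect_less continuous_intros continuous_on_product_coordinates)
      moreover have "\<nu> \<notin> A" if "\<nu> \<in> prob_measures X" "of_measure \<nu> \<in> W" for \<nu>
        using U(4)[OF that(1)] that(2) continuous_bounded_borel[OF compact_X U(2)]
        by (auto simp: W_def of_measure_def)
      ultimately have "W \<in> V" by (simp add: V_def)
      moreover have "l \<in> W" unfolding W_def \<mu>(3) using U(2,3)
        by (auto simp: of_measure_def continuous_bounded_borel[OF compact_X])
      ultimately show ?thesis by blast
    qed
  qed
  obtain \<D> where D: "\<D> \<subseteq> O1 ` I \<union> V" "finite \<D>" "mean_functionals X \<subseteq> \<Union>\<D>"
    using compactE[OF compact_mean_functionals cov op] by blast
  obtain J where J: "J \<subseteq> I" "finite J" "\<D> \<inter> O1 ` I = O1 ` J"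
    using finite_subset_image[of "\<D> \<inter> O1 ` I" O1 I] D(2) by auto
  define a' where "a' = Min (insert (a + 1) ((\<lambda>(u, w, c). c) ` J))"
  show thesis
  proof (rule that[of "(\<lambda>(u, w, c). (u, w)) ` J" a'])
    show "finite ((\<lambda>(u, w, c). (u, w)) ` J)" using J by simp
    show "a < a'" unfolding a'_def using J by (subst Min_gr_iff) (auto simp: I_def)
    show "continuous_on X u \<and> w \<in> bounded_borel X" if "(u, w) \<in> (\<lambda>(u, w, c). (u, w)) ` J" for u w
      using that J(1) by (auto simp: I_def)
    fix \<mu> assume \<mu>: "\<mu> \<in> A"
    then have \<mu>X: "\<mu> \<in> prob_measures X" using AX by blast
    obtain B where B: "B \<in> \<D>" "of_measure \<mu> \<in> B" using D(3) of_measure_in[OF \<mu>X] by blast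
    have "B \<notin> V" using B(2) \<mu> \<mu>X by (auto simp: V_def)
    then have "B \<in> O1 ` J" using B(1) D(1) J(3) by blast
    then obtain u w c where uwc: "(u, w, c) \<in> J" "B = O1 (u, w, c)" by auto
    have "a' \<le> c" unfolding a'_def using J(2) uwc(1) by (intro Min_le) force+
    moreover have "c < dual u w (of_measure \<mu>)" using B(2) uwc(2) by (simp add: O1_def)
    moreover have "dual u w (of_measure \<mu>) = dual u w (\<lambda>v. \<integral>x. v x \<partial>\<mu>)"
      using uwc(1) J(1) by (intro dual_of_measure) (auto simp: I_def)
    ultimately show "\<exists>(u, w)\<in>(\<lambda>(u, w, c). (u, w)) ` J. a' < dual u w (\<lambda>v. \<integral>x. v x \<partial>\<mu>)"
      using uwc(1) by (intro bexI[of _ "(u, w)"]) (auto intro: image_eqI[of _ _ "(u, w, c)"])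
  qed
qed

text \<open>The sublevel set is the image of the compact set of means that satisfy all dual bounds.
  Sending such a mean to its measure is continuous, because the weak topology tests only integrals
  of continuous functions, and these are coordinates of the mean.\<close>

lemma compactin_rate_le: "compactin (weak_topology X) {\<mu> \<in> prob_measures X. rate \<mu> \<le> ereal a}"
proof -
  define P where "P = {l \<in> mean_functionals X. \<forall>(u :: 'a \<Rightarrow> real) w. continuous_on X u \<longrightarrow> w \<in> bounded_borel X \<longrightarrow> dual u w l \<le> a}"
  have "closed {l. \<forall>(u :: 'a \<Rightarrow> real) w. continuous_on X u \<longrightarrow> w \<in> bounded_borel X \<longrightarrow> dual u w l \<le> a}"
    by (intro closed_Collect_all closed_Collect_imp closed_Collect_le continuous_on_dual continuous_on_const open_Collect_const)
  then have P: "compact P"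
    unfolding P_def using compact_Int_closed[OF compact_mean_functionals, of "{l. \<forall>(u :: 'a \<Rightarrow> real) w.
      continuous_on X u \<longrightarrow> w \<in> bounded_borel X \<longrightarrow> dual u w l \<le> a}" X] by (simp add: Int_def)
  have "\<exists>\<mu>. \<mu> \<in> prob_measures X \<and> rate \<mu> \<le> ereal a \<and> l = of_measure \<mu>" if "l \<in> P" for l
    using mean_functional_rate[of l a] that unfolding P_def by blast
  then obtain m where m: "\<And>l. l \<in> P \<Longrightarrow> m l \<in> prob_measures X" "\<And>l. l \<in> P \<Longrightarrow> rate (m l) \<le> ereal a"
    "\<And>l. l \<in> P \<Longrightarrow> l = of_measure (m l)"
    by metis
  have "continuous_map (top_of_set P) (weak_topology X) m"
    unfolding weak_topology_def
  proof (rule continuous_on_generated_topo)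
    let ?S = "{{\<mu> \<in> prob_measures X. (\<integral>x. u x \<partial>\<mu>) \<in> U} | (u :: 'a \<Rightarrow> real) U. continuous_on X u \<and> open U}"
    fix W assume "W \<in> ?S"
    then obtain u :: "'a \<Rightarrow> real" and U where u: "continuous_on X u" "open U"
      "W = {\<mu> \<in> prob_measures X. (\<integral>x. u x \<partial>\<mu>) \<in> U}" by blast
    have "(\<integral>x. u x \<partial>m l) = l u" if "l \<in> P" for l
      using m(3)[OF that] continuous_bounded_borel[OF compact_X u(1)] by (metis of_measure_def)
    then have "m -` W \<inter> topspace (top_of_set P) = P \<inter> (\<lambda>l. l u) -` U"
      using m(1) u(3) by auto
    also have "openin (top_of_set P) \<dots>"
      by (rule continuous_openin_preimage_gen[OF _ u(2)])
        (intro continuous_on_subset[OF continuous_on_product_coordinates] subset_UNIV)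
    finally show "openin (top_of_set P) (m -` W \<inter> topspace (top_of_set P))" .
  next
    show "m ` topspace (top_of_set P) \<subseteq>
      \<Union> {{\<mu> \<in> prob_measures X. (\<integral>x. u x \<partial>\<mu>) \<in> U} | (u :: 'a \<Rightarrow> real) U. continuous_on X u \<and> open U}"
      using topspace_weak_topology[of X] m(1)
      unfolding weak_topology_def topology_generated_by_topspace by auto
  qed
  moreover have "compactin (top_of_set P) P" using P by (simp add: compactin_subtopology)
  ultimately have "compactin (weak_topology X) (m ` P)" by (rule image_compactin[rotated])
  moreover have "m ` P = {\<mu> \<in> prob_measures X. rate \<mu> \<le> ereal a}"
  proof
    show "m ` P \<subseteq> {\<mu> \<in> prob_measures X. rate \<mu> \<le> ereal a}" using m by auto
    show "{\<mu> \<in> prob_measures X. rate \<mu> \<le> ereal a} \<subseteq> m ` P"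
    proof
      fix \<mu> assume \<mu>: "\<mu> \<in> {\<mu> \<in> prob_measures X. rate \<mu> \<le> ereal a}"
      then have "of_measure \<mu> \<in> P"
        using of_measure_in dual_of_measure rate_le_iff[of \<mu> a] unfolding P_def by auto
      moreover from m(3)[OF this] have "m (of_measure \<mu>) = \<mu>"
        using prob_measures_eqI[OF X_borel m(1)[OF \<open>of_measure \<mu> \<in> P\<close>], of \<mu>] \<mu>
          continuous_bounded_borel[OF compact_X] by (auto simp: of_measure_def fun_eq_iff) metis
      ultimately show "\<mu> \<in> m ` P" by (metis imageI)
    qed
  qed
  ultimately show ?thesis by simp
qed

lemma closedin_rate_le: "closedin (weak_topology X) {\<mu> \<in> prob_measures X. rate \<mu> \<le> ereal a}"
  by (rule compactin_imp_closedin[OF Hausdorff_weak_topology[OF X_borel] compactin_rate_le])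

section \<open>Unnormalised Gibbs weights of sets of measures\<close>

abbreviation base :: "nat \<Rightarrow> (nat \<Rightarrow> 'a) measure" where
  "base N \<equiv> \<Pi>\<^sub>M i\<in>{..<N}. \<mu>0"

abbreviation partition :: "nat \<Rightarrow> real" where
  "partition N \<equiv> partition_function \<mu>0 N (H N) \<beta>"

abbreviation law :: "nat \<Rightarrow> 'a measure measure" where
  "law N \<equiv> empirical_law X \<mu>0 N (H N) \<beta>"

abbreviation free :: "real \<Rightarrow> 'a measure \<Rightarrow> ereal" where
  "free c \<equiv> free_energy_functional X \<mu>0 \<F> \<beta> (c / \<beta>)"

text \<open>Gibbs mass before division by the partition function. For \<open>N > 0\<close> the full
  space has the partition function as its weight, so bounds on weights also settle the
  normalisation.\<close>

definition weight :: "nat \<Rightarrow> 'a measure set \<Rightarrow> real" where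
  "weight N A = (\<integral>x. exp (- \<beta> * H N x) * indicator A (empirical_measure X N x) \<partial>base N)"

lemma prob_space_base: "prob_space (base N)"
  by (rule prob_space_PiM) (rule M0.prob_space_axioms)

lemma indicator_empirical_measurable:
  assumes "N > 0" "A \<in> sets (borel_of_topology (weak_topology X))"
  shows "(\<lambda>x. indicator A (empirical_measure X N x) :: real) \<in> borel_measurable (base N)"
proof -
  have "empirical_measure X N \<in> measurable (base N) (borel_of_topology (weak_topology X))"
    unfolding measurable_PiM_config[OF \<mu>0] by (rule measurable_empirical_measure[OF assms(1)])
  then show ?thesis using assms(2) by (rule measurable_compose[OF _ borel_measurable_indicator])
qed

lemma integrable_exp_H: "integrable (base N) (\<lambda>x. exp (- \<beta> * H N x))"
  using integrable_exp_conf_energy[OF \<mu>0, of "\<lambda>_. 0" N \<beta>] by simp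

lemma integrable_weight:
  assumes "N > 0" "A \<in> sets (borel_of_topology (weak_topology X))"
  shows "integrable (base N) (\<lambda>x. exp (- \<beta> * H N x) * indicator A (empirical_measure X N x))"
proof (rule Bochner_Integration.integrable_bound[OF integrable_exp_H])
  show "(\<lambda>x. exp (- \<beta> * H N x) * indicator A (empirical_measure X N x)) \<in> borel_measurable (base N)"
    using borel_measurable_integrable[OF integrable_exp_H] indicator_empirical_measurable[OF assms]
    by (rule borel_measurable_times)
qed (simp add: indicator_def)

text \<open>By independence the integral factors into normalised exponential moments. These
  functions of mean 1 are the majorants in the Chebyshev bound.\<close>

lemma integral_exp_sum:
  assumes w: "w \<in> bounded_borel X"
  shows "integrable (base N) (\<lambda>x. exp (\<Sum>i<N. w (x i) - cumulant w))"
    and "(\<integral>x. exp (\<Sum>i<N. w (x i) - cumulant w) \<partial>base N) = 1"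
proof -
  interpret PM: product_sigma_finite "\<lambda>_. \<mu>0" ..
  have i: "integrable \<mu>0 (\<lambda>x. exp (w x - cumulant w))" "(\<integral>x. exp (w x - cumulant w) \<partial>\<mu>0) = 1"
    using exp_bounded_borel[OF w] by (simp_all add: exp_diff cumulant_def)
  have eq: "exp (\<Sum>i<N. w (x i) - cumulant w) = (\<Prod>i<N. exp (w (x i) - cumulant w))" for x
    by (rule exp_sum) simp
  show "integrable (base N) (\<lambda>x. exp (\<Sum>i<N. w (x i) - cumulant w))"
    unfolding eq by (rule PM.product_integrable_prod) (use i in auto)
  have "(\<integral>x. (\<Prod>i<N. exp (w (x i) - cumulant w)) \<partial>base N) = (\<Prod>i<N. \<integral>x. exp (w x - cumulant w) \<partial>\<mu>0)"
    by (rule PM.product_integral_prod) (use i in auto)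
  then show "(\<integral>x. exp (\<Sum>i<N. w (x i) - cumulant w) \<partial>base N) = 1"
    unfolding eq using i(2) by simp
qed

text \<open>Exponential Chebyshev bounds over the finitely many half-spaces of \<open>closed_dual_cover\<close>.\<close>

lemma weight_upper:
  assumes A: "closedin (weak_topology X) A" and rate: "\<And>\<mu>. \<mu> \<in> A \<Longrightarrow> \<not> rate \<mu> \<le> ereal a"
  obtains a' where "a < a'" "\<And>\<mu>. \<mu> \<in> A \<Longrightarrow> \<not> rate \<mu> \<le> ereal a'"
    "eventually (\<lambda>N. weight N A \<le> exp (- (real N * a'))) sequentially"
proof -
  obtain T a1 where T: "finite T" "a < a1" "\<And>u w. (u, w) \<in> T \<Longrightarrow> continuous_on X u \<and> w \<in> bounded_borel X"
    "\<And>\<mu>. \<mu> \<in> A \<Longrightarrow> \<exists>(u, w)\<in>T. a1 < dual u w (\<lambda>v. \<integral>x. v x \<partial>\<mu>)"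
    using closed_dual_cover[OF A rate] by blast
  \<comment> \<open>Half of the gap \<open>a1 - a\<close> is given up as
    \<open>2 * \<delta>\<close>: one \<delta> for replacing \<open>min_energy\<close> by its limit,
    one for the number of half-spaces.\<close>
  define \<delta> where "\<delta> = (a1 - a) / 4"
  define a' where "a' = (a + a1) / 2"
  have \<delta>: "\<delta> > 0" "a' = a1 - 2 * \<delta>" using T(2) by (simp_all add: \<delta>_def a'_def field_simps)
  have As: "A \<in> sets (borel_of_topology (weak_topology X))" by (rule closedin_borel_of_topology[OF A])
  have AX: "A \<subseteq> prob_measures X" using closedin_subset[OF A] by (simp add: topspace_weak_topology)
  show thesis
  proof (rule that[of a'])
    show "a < a'" using T(2) by (simp add: a'_def)
    \<comment> \<open>That the larger level is still below every rate on \<open>A\<close> is what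
      later shows that the infimum of the rate is attained.\<close>
    show "\<not> rate \<mu> \<le> ereal a'" if \<mu>: "\<mu> \<in> A" for \<mu>
    proof
      assume le: "rate \<mu> \<le> ereal a'"
      obtain u w where uw: "(u, w) \<in> T" "a1 < dual u w (\<lambda>v. \<integral>x. v x \<partial>\<mu>)" using T(4)[OF \<mu>] by blast
      have "\<mu> \<in> prob_measures X" using \<mu> AX by blast
      from rate_le_iff[OF this, of a'] le have "dual u w (\<lambda>v. \<integral>x. v x \<partial>\<mu>) \<le> a'"
        using T(3)[OF uw(1)] by blast
      then show False using uw(2) \<delta> by linarith
    qed
    have "eventually (\<lambda>N. \<forall>p\<in>T. \<beta> * \<bar>min_energy N (fst p) - \<F> (fst p)\<bar> < \<delta>) sequentially"
    proof (intro eventually_ball_finite T(1) ballI)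
      fix p assume p: "p \<in> T"
      have u: "continuous_on X (fst p)" using T(3)[of "fst p" "snd p"] p by simp
      have "eventually (\<lambda>N. dist (min_energy N (fst p)) (\<F> (fst p)) < \<delta> / \<beta>) sequentially"
        using tendstoD[OF min_energy_lim[OF u]] \<delta> \<beta> by simp
      then show "eventually (\<lambda>N. \<beta> * \<bar>min_energy N (fst p) - \<F> (fst p)\<bar> < \<delta>) sequentially"
        by (rule eventually_mono) (use \<beta> in \<open>simp add: dist_real_def pos_less_divide_eq mult.commute\<close>)
    qed
    moreover have "eventually (\<lambda>N. real (card T) \<le> exp (real N * \<delta>)) sequentially"
    proof -
      have "filterlim (\<lambda>N. exp (\<delta> * real N)) at_top sequentially"
        by (intro filterlim_compose[OF exp_at_top]
            filterlim_tendsto_pos_mult_at_top[OF tendsto_const \<delta>(1) filterlim_real_sequentially])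
      then show ?thesis by (simp add: filterlim_at_top mult.commute)
    qed
    ultimately show "eventually (\<lambda>N. weight N A \<le> exp (- (real N * a'))) sequentially"
      using eventually_gt_at_top[of 0]
    proof eventually_elim
      case (elim N)
      then have N: "N > 0" by simp
      define g where "g p x = exp (real N * (\<delta> - a1)) * exp (\<Sum>i<N. snd p (x i) - cumulant (snd p))"
        for p :: "('a \<Rightarrow> real) \<times> ('a \<Rightarrow> real)" and x :: "nat \<Rightarrow> 'a"
      have gi: "integrable (base N) (g p)" "(\<integral>x. g p x \<partial>base N) = exp (real N * (\<delta> - a1))" if "p \<in> T" for p
      proof -
        have "snd p \<in> bounded_borel X" using T(3)[of "fst p" "snd p"] that by simp
        from integral_exp_sum[OF this, of N]
        show "integrable (base N) (g p)" "(\<integral>x. g p x \<partial>base N) = exp (real N * (\<delta> - a1))"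
          unfolding g_def by simp_all
      qed
      \<comment> \<open>Choose a half-space containing the empirical measure and replace
        \<open>\<F> u\<close> by \<open>min_energy N u\<close>, which is at most the tilted energy
        per particle. The averages of \<open>u\<close> then cancel, leaving an exponential of the
        sum of \<open>w\<close> alone.\<close>
      have pt: "exp (- \<beta> * H N x) * indicator A (empirical_measure X N x) \<le> (\<Sum>p\<in>T. g p x)"
        if x: "x \<in> config X N" for x
      proof (cases "empirical_measure X N x \<in> A")
        case True
        obtain u w where uw: "(u, w) \<in> T" "a1 < dual u w (\<lambda>v. \<integral>y. v y \<partial>empirical_measure X N x)"
          using T(4)[OF True] by blast
        have u: "continuous_on X u" and w: "w \<in> bounded_borel X" using T(3)[OF uw(1)] by auto
        define su where "su = (\<Sum>i<N. u (x i))"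
        define sw where "sw = (\<Sum>i<N. w (x i))"
        have iu: "(\<integral>y. u y \<partial>empirical_measure X N x) = su / real N"
          unfolding su_def by (rule integral_empirical_measure[OF x N borel_measurable_continuous_on_restrict[OF u]])
        have iw: "(\<integral>y. w y \<partial>empirical_measure X N x) = sw / real N"
          unfolding sw_def by (rule integral_empirical_measure[OF x N bounded_borel_measurable[OF w]])
        have "real N * a1 \<le> real N * (\<beta> * (\<F> u - su / real N) + sw / real N - cumulant w)"
          using uw(2) unfolding dual_def iu iw by (intro mult_left_mono) auto
        also have "\<dots> = real N * (\<beta> * \<F> u) - \<beta> * su + sw - real N * cumulant w"
          using N by (simp add: field_simps)
        finally have 1: "real N * a1 \<le> real N * (\<beta> * \<F> u) - \<beta> * su + sw - real N * cumulant w" .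
        have "real N * min_energy N u \<le> H N x + su"
          using min_energy_le[OF u x] N unfolding su_def by (simp add: pos_le_divide_eq mult.commute)
        then have "\<beta> * (real N * min_energy N u) \<le> \<beta> * (H N x + su)" using \<beta> by (intro mult_left_mono) auto
        then have 2: "- \<beta> * H N x \<le> \<beta> * su - real N * (\<beta> * min_energy N u)" by (simp add: algebra_simps)
        have "\<beta> * \<bar>min_energy N u - \<F> u\<bar> < \<delta>" using elim(1) uw(1) by force
        moreover have "\<beta> * (\<F> u - min_energy N u) \<le> \<beta> * \<bar>min_energy N u - \<F> u\<bar>"
          using \<beta> by (intro mult_left_mono) auto
        ultimately have "real N * (\<beta> * (\<F> u - min_energy N u)) \<le> real N * \<delta>" by (intro mult_left_mono) auto
        then have 3: "real N * (\<beta> * \<F> u) - real N * (\<beta> * min_energy N u) \<le> real N * \<delta>"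
          by (simp add: right_diff_distrib)
        have "- \<beta> * H N x \<le> real N * (\<delta> - a1) + (sw - real N * cumulant w)"
          using 1 2 3 by (simp add: right_diff_distrib)
        also have "sw - real N * cumulant w = (\<Sum>i<N. w (x i) - cumulant w)"
          by (simp add: sw_def sum_subtractf)
        finally have "exp (- \<beta> * H N x) \<le> g (u, w) x" unfolding g_def by (simp flip: exp_add)
        also have "\<dots> \<le> (\<Sum>p\<in>T. g p x)"
          by (rule member_le_sum[OF uw(1)]) (use T(1) in \<open>auto simp: g_def\<close>)
        finally show ?thesis using True by simp
      qed (simp add: sum_nonneg g_def)
      have "weight N A \<le> (\<integral>x. (\<Sum>p\<in>T. g p x) \<partial>base N)"
        unfolding weight_def
        by (rule integral_mono[OF integrable_weight[OF N As]])
          (use gi pt space_PiM_config[OF \<mu>0] in auto)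
      also have "\<dots> = real (card T) * exp (real N * (\<delta> - a1))"
        using gi by (subst Bochner_Integration.integral_sum) auto
      also have "\<dots> \<le> exp (real N * \<delta>) * exp (real N * (\<delta> - a1))"
        using elim(2) by (intro mult_right_mono) auto
      also have "\<dots> = exp (- (real N * a'))"
        unfolding \<delta>(2) by (simp add: algebra_simps flip: exp_add)
      finally show ?case .
    qed
  qed
qed

text \<open>The variational inequality for the product measures, with test function \<open>c 1\<^sub>S\<close> where \<open>e\<^sup>-\<^sup>c\<close> is the
  probability of \<open>S\<close> under \<open>\<mu>0\<close>.\<close>

lemma log_probability_lower:
  fixes f :: "'a \<Rightarrow> real"
  assumes f: "f \<in> borel_measurable \<mu>0" "\<And>x. 0 \<le> f x" "prob_space (density \<mu>0 f)"
    "integrable (density \<mu>0 f) (\<lambda>x. ln (f x))"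
    and S: "S \<in> sets (base N)" and q: "measure (\<Pi>\<^sub>M i\<in>{..<N}. density \<mu>0 f) S > 0"
  shows "measure (base N) S > 0"
    "- ln (measure (base N) S) * measure (\<Pi>\<^sub>M i\<in>{..<N}. density \<mu>0 f) S
      \<le> real N * (\<integral>x. ln (f x) \<partial>density \<mu>0 f) + ln 2"
proof -
  interpret B: prob_space "base N" by (rule prob_space_base)
  let ?g = "\<lambda>x. \<Prod>i<N. f (x i)" and ?R = "\<Pi>\<^sub>M i\<in>{..<N}. density \<mu>0 f"
  have R: "density (base N) (\<lambda>x. ennreal (?g x)) = ?R"
    by (rule PiM_density[OF M0.prob_space_axioms f(1-3)]) simp
  interpret R: prob_space ?R by (rule prob_space_PiM) (rule f(3))
  note [measurable] = f(1)
  have gm: "?g \<in> borel_measurable (base N)" by measurable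
  have SR: "S \<in> sets ?R" using S unfolding R[symmetric] by simp
  show p: "measure (base N) S > 0"
  proof (rule ccontr)
    assume "\<not> ?thesis"
    then have "S \<in> null_sets (base N)"
      using S by (auto simp: B.emeasure_eq_measure null_sets_def zero_less_measure_iff)
    moreover have "absolutely_continuous (base N) ?R"
      unfolding R[symmetric] by (rule absolutely_continuousI_density) (use gm in simp)
    ultimately have "S \<in> null_sets ?R" by (auto simp: absolutely_continuous_def)
    then show False using q by (simp add: null_sets_def R.emeasure_eq_measure)
  qed
  define c where "c = - ln (measure (base N) S)"
  have c: "c \<ge> 0" using p by (simp add: c_def)
  have "(\<integral>x. c * indicator S x \<partial>density (base N) (\<lambda>x. ennreal (?g x)))
      \<le> (\<integral>x. ln (?g x) \<partial>density (base N) (\<lambda>x. ennreal (?g x))) + ln (\<integral>x. exp (c * indicator S x) \<partial>base N)"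
  proof (rule B.entropy_variational_le[where B=c])
    show "integrable (density (base N) (\<lambda>x. ennreal (?g x))) (\<lambda>x. ln (?g x))"
      unfolding R by (rule entropy_PiM_density(1)[OF M0.prob_space_axioms f(1-3) _ f(4)]) simp
    show "prob_space (density (base N) (\<lambda>x. ennreal (?g x)))" unfolding R by (rule R.prob_space_axioms)
  qed (use gm S c f(2) in \<open>auto simp: indicator_def intro: prod_nonneg\<close>)
  \<comment> \<open>Since \<open>exp c\<close> is the inverse of the probability of
    \<open>S\<close>, the moment equals \<open>2 - measure (base N) S\<close>; hence the term
    \<open>ln 2\<close>, negligible per particle.\<close>
  moreover have "(\<integral>x. exp (c * indicator S x) \<partial>base N) \<le> 2"
  proof -
    have "(\<integral>x. exp (c * indicator S x) \<partial>base N) = (\<integral>x. 1 + (exp c - 1) * indicator S x \<partial>base N)"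
      by (intro Bochner_Integration.integral_cong) (auto simp: indicator_def)
    also have "\<dots> = 1 + (exp c - 1) * measure (base N) S"
    proof -
      have "integrable (base N) (indicator S :: _ \<Rightarrow> real)"
        by (rule B.integrable_const_bound[of _ 1]) (use S in \<open>auto simp: indicator_def\<close>)
      then show ?thesis using S B.prob_space
        by (subst Bochner_Integration.integral_add) (auto simp: sets.Int_space_eq2)
    qed
    also have "exp c * measure (base N) S = 1" using p by (simp add: c_def exp_minus)
    then have "1 + (exp c - 1) * measure (base N) S \<le> 2" by (simp add: left_diff_distrib)
    finally show ?thesis .
  qed
  moreover have "(\<integral>x. exp (c * indicator S x) \<partial>base N) \<ge> 1"
  proof (rule B.integral_ge_const)
    show "integrable (base N) (\<lambda>x. exp (c * indicator S x))"
      by (rule B.integrable_const_bound[of _ "exp c"]) (use S c in \<open>auto simp: indicator_def\<close>)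
  qed (use c in simp)
  ultimately have "(\<integral>x. c * indicator S x \<partial>?R) \<le> (\<integral>x. ln (?g x) \<partial>?R) + ln 2"
    unfolding R by (smt (verit) ln_le_cancel_iff)
  then show "- ln (measure (base N) S) * measure ?R S \<le> real N * (\<integral>x. ln (f x) \<partial>density \<mu>0 f) + ln 2"
    using entropy_PiM_density(2)[OF M0.prob_space_axioms f(1-3) _ f(4), of "{..<N}"] SR
    by (simp add: c_def sets.Int_space_eq2)
qed

text \<open>Consider the configurations whose averages of finitely many test functions are close to
  the \<mu>-integrals. Their empirical measures lie in \<open>G\<close> and their energy per
  particle is nearly at most that of \<mu>. For samples from \<mu> this event has probability
  tending to 1, so for samples from \<mu>0 its probability decays at most at the rate of the
  relative entropy.\<close>

lemma weight_lower:
  assumes G: "openin (weak_topology X) G" "\<mu> \<in> G" and a: "rate \<mu> \<le> ereal a" and \<epsilon>: "\<epsilon> > 0"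
  shows "eventually (\<lambda>N. exp (- (real N * (a + \<epsilon>))) \<le> weight N G) sequentially"
proof -
  have \<mu>: "\<mu> \<in> prob_measures X" using openin_subset[OF G(1)] G(2) by (auto simp: topspace_weak_topology)
  note M = prob_measuresD[OF \<mu>] and M0' = prob_measuresD[OF \<mu>0]
  have Gs: "G \<in> sets (borel_of_topology (weak_topology X))" by (rule openin_borel_of_topology[OF G(1)])
  have "rel_entropy \<mu>0 \<mu> \<noteq> \<infinity>" using a by (auto simp: rate_def)
  then obtain f :: "'a \<Rightarrow> real" where f: "f \<in> borel_measurable \<mu>0" "\<And>x. 0 \<le> f x" "\<mu> = density \<mu>0 f"
    "integrable (density \<mu>0 f) (\<lambda>x. ln (f x))"
    using M0.rel_entropy_finiteE[OF M(1), of thesis] M(2) M0'(2) by metis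
  have pf: "prob_space (density \<mu>0 f)" using M(1) f(3) by simp
  define D where "D = (\<integral>x. ln (f x) \<partial>density \<mu>0 f)"
  have D: "rel_entropy \<mu>0 \<mu> = ereal D" unfolding D_def f(3) by (rule M0.rel_entropy_density[OF f(1,2,4)])
  have aD: "\<beta> * energy_real \<mu> + D \<le> a" using a by (simp add: rate_def D)
  obtain U1 \<eta>1 where U1: "finite U1" "\<And>u. u \<in> U1 \<Longrightarrow> continuous_on X u" "\<eta>1 > (0::real)"
    "\<And>\<nu>. \<nu> \<in> prob_measures X \<Longrightarrow> (\<And>u. u \<in> U1 \<Longrightarrow> \<bar>(\<integral>x. u x \<partial>\<nu>) - (\<integral>x. u x \<partial>\<mu>)\<bar> < \<eta>1) \<Longrightarrow> \<nu> \<in> G"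
    using weak_topology_neighbourhood[OF G] by blast
  \<comment> \<open>Multiplied by \<beta> this is \<open>\<epsilon> / 2\<close>; the entropy term
    receives the other half.\<close>
  define \<epsilon>1 where "\<epsilon>1 = \<epsilon> / (2 * \<beta>)"
  have \<epsilon>1: "\<epsilon>1 > 0" "\<beta> * \<epsilon>1 = \<epsilon> / 2" using \<epsilon> \<beta> by (simp_all add: \<epsilon>1_def)
  obtain U2 \<eta>2 where U2: "finite U2" "\<And>u. u \<in> U2 \<Longrightarrow> continuous_on X u" "\<eta>2 > (0::real)"
    "eventually (\<lambda>N. \<forall>y\<in>config X N. (\<forall>u\<in>U2. \<bar>(\<Sum>i<N. u (y i)) / real N - (\<integral>y. u y \<partial>\<mu>)\<bar> < \<eta>2) \<longrightarrow>
      H N y / real N < energy_real \<mu> + \<epsilon>1) sequentially"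
    using energy_le_near[OF \<mu> \<epsilon>1(1)] by blast
  define U where "U = U1 \<union> U2"
  define \<eta> where "\<eta> = min \<eta>1 \<eta>2"
  have U: "finite U" "\<And>u. u \<in> U \<Longrightarrow> continuous_on X u" and \<eta>: "\<eta> > 0" "\<eta> \<le> \<eta>1" "\<eta> \<le> \<eta>2"
    using U1 U2 by (auto simp: U_def \<eta>_def)
  define bad where "bad u N = {x \<in> config X N. \<eta> \<le> \<bar>(\<Sum>i<N. u (x i)) / real N - (\<integral>x. u x \<partial>\<mu>)\<bar>}" for u N
  define S where "S N = config X N - (\<Union>u\<in>U. bad u N)" for N
  let ?R = "\<lambda>N. \<Pi>\<^sub>M i\<in>{..<N}. \<mu>"
  have bad_sets: "bad u N \<in> sets (\<Pi>\<^sub>M i\<in>{..<N}. \<nu>)" if "u \<in> U" "\<nu> \<in> prob_measures X" for u N \<nu>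
  proof -
    have "(\<lambda>x. (\<Sum>i<N. u (x i)) / real N) \<in> borel_measurable (\<Pi>\<^sub>M i\<in>{..<N}. \<nu>)"
      unfolding measurable_PiM_config[OF that(2)]
      by (intro borel_measurable_divide borel_measurable_const continuous_on_config_measurable
          continuous_on_config_sum U(2) that(1))
    then have "{x \<in> space (\<Pi>\<^sub>M i\<in>{..<N}. \<nu>). \<eta> \<le> \<bar>(\<Sum>i<N. u (x i)) / real N - (\<integral>x. u x \<partial>\<mu>)\<bar>} \<in> sets (\<Pi>\<^sub>M i\<in>{..<N}. \<nu>)"
      by measurable
    then show ?thesis by (simp add: bad_def space_PiM_config[OF that(2)])
  qed
  have S_sets: "S N \<in> sets (\<Pi>\<^sub>M i\<in>{..<N}. \<nu>)" if "\<nu> \<in> prob_measures X" for N \<nu>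
    unfolding S_def space_PiM_config[OF that, symmetric]
    by (intro sets.Diff sets.top sets.finite_UN U(1) bad_sets that)
  define q where "q N = measure (?R N) (S N)" for N
  have pR: "prob_space (?R N)" for N by (rule prob_space_PiM) (rule M(1))
  have q_le: "q N \<le> 1" for N
  proof -
    interpret prob_space "?R N" by (rule pR)
    show ?thesis unfolding q_def by (rule prob_le_1)
  qed
  have q_ge: "1 - (\<Sum>u\<in>U. measure (?R N) (bad u N)) \<le> q N" for N
  proof -
    interpret prob_space "?R N" by (rule pR)
    have "q N = 1 - measure (?R N) (\<Union>u\<in>U. bad u N)"
      unfolding q_def S_def space_PiM_config[OF \<mu>, symmetric]
      by (rule prob_compl) (intro sets.finite_UN U(1) bad_sets \<mu>)
    moreover have "measure (?R N) (\<Union>u\<in>U. bad u N) \<le> (\<Sum>u\<in>U. measure (?R N) (bad u N))"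
      by (rule finite_measure_subadditive_finite) (use U(1) bad_sets[OF _ \<mu>] in auto)
    ultimately show ?thesis by linarith
  qed
  have bad_lim: "(\<lambda>N. measure (?R N) (bad u N)) \<longlonglongrightarrow> 0" if u: "u \<in> U" for u
  proof -
    have ub: "u \<in> bounded_borel X" by (rule continuous_bounded_borel[OF compact_X U(2)[OF u]])
    obtain B where B: "\<And>x. x \<in> X \<Longrightarrow> \<bar>u x\<bar> \<le> B" using bounded_borelE[OF ub] by blast
    have "u \<in> borel_measurable \<mu>" unfolding M(4) by (rule bounded_borel_measurable[OF ub])
    from iid_weak_law[OF M(1) this, of B \<eta>] B \<eta>(1) show ?thesis
      by (simp add: bad_def space_PiM_config[OF \<mu>] M(3))
  qed
  have q_lim: "q \<longlonglongrightarrow> 1"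
  proof (rule tendsto_sandwich[OF _ _ _ tendsto_const])
    have "(\<lambda>N. 1 - (\<Sum>u\<in>U. measure (?R N) (bad u N))) \<longlonglongrightarrow> 1 - (\<Sum>u\<in>U. 0)"
      by (intro tendsto_intros bad_lim)
    then show "(\<lambda>N. 1 - (\<Sum>u\<in>U. measure (?R N) (bad u N))) \<longlonglongrightarrow> 1" by simp
  qed (use q_ge q_le in auto)
  \<comment> \<open>\<open>log_probability_lower\<close> bounds \<open>- ln p\<close> only after
    division by \<open>q N\<close>, so the limit 1 is needed here, not just a positive lower
    bound.\<close>
  have "(\<lambda>N. (D + ln 2 / real N) / q N) \<longlonglongrightarrow> (D + 0) / 1"
    by (intro tendsto_intros q_lim tendsto_divide_0[OF tendsto_const] filterlim_at_top_imp_at_infinity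
        filterlim_real_sequentially) simp
  then have "eventually (\<lambda>N. (D + ln 2 / real N) / q N < D + \<epsilon> / 2) sequentially"
    using \<epsilon> by (intro order_tendstoD(2)) auto
  moreover have "eventually (\<lambda>N. q N > 1 / 2) sequentially"
    using order_tendstoD(1)[OF q_lim, of "1 / 2"] by simp
  ultimately show ?thesis using U2(4) eventually_gt_at_top[of 0]
  proof eventually_elim
    case (elim N)
    then have N: "N > 0" by simp
    define p where "p = measure (base N) (S N)"
    have q0: "q N > 0" using elim(2) by simp
    have qR: "q N = measure (\<Pi>\<^sub>M i\<in>{..<N}. density \<mu>0 f) (S N)" unfolding q_def f(3) ..
    have lp: "p > 0" "- ln p * q N \<le> real N * D + ln 2"
      using log_probability_lower[OF f(1,2) pf f(4) S_sets[OF \<mu>0]] q0 unfolding qR p_def D_def by auto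
    have "- ln p \<le> (real N * D + ln 2) / q N" using lp(2) q0 by (simp add: pos_le_divide_eq)
    also have "real N * D + ln 2 = real N * (D + ln 2 / real N)" using N by (simp add: distrib_left)
    also have "\<dots> / q N = real N * ((D + ln 2 / real N) / q N)" by simp
    also have "\<dots> \<le> real N * (D + \<epsilon> / 2)" using elim(1) by (intro mult_left_mono) auto
    finally have "- (real N * (D + \<epsilon> / 2)) \<le> ln p" by linarith
    then have p_ge: "exp (- (real N * (D + \<epsilon> / 2))) \<le> p" using lp(1) by (simp add: ln_ge_iff)
    have inS: "empirical_measure X N x \<in> G \<and> H N x \<le> real N * (energy_real \<mu> + \<epsilon>1)" if x: "x \<in> S N" for x
    proof -
      have xc: "x \<in> config X N" using x by (simp add: S_def)
      have near: "\<bar>(\<Sum>i<N. u (x i)) / real N - (\<integral>x. u x \<partial>\<mu>)\<bar> < \<eta>" if "u \<in> U" for u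
        using x that xc unfolding S_def bad_def by (auto simp: not_le)
      have "empirical_measure X N x \<in> G"
      proof (rule U1(4)[OF empirical_measure_in_prob_measures[OF xc N]])
        fix u assume u: "u \<in> U1"
        have "(\<integral>y. u y \<partial>empirical_measure X N x) = (\<Sum>i<N. u (x i)) / real N"
          by (rule integral_empirical_measure[OF xc N borel_measurable_continuous_on_restrict[OF U1(2)[OF u]]])
        then show "\<bar>(\<integral>y. u y \<partial>empirical_measure X N x) - (\<integral>y. u y \<partial>\<mu>)\<bar> < \<eta>1"
          using near[of u] u \<eta>(2) by (simp add: U_def)
      qed
      moreover have "\<forall>u\<in>U2. \<bar>(\<Sum>i<N. u (x i)) / real N - (\<integral>x. u x \<partial>\<mu>)\<bar> < \<eta>2"
        using near \<eta>(3) by (force simp: U_def)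
      then have "H N x / real N < energy_real \<mu> + \<epsilon>1" using elim(3) xc by blast
      then have "H N x \<le> real N * (energy_real \<mu> + \<epsilon>1)" using N by (simp add: pos_divide_less_eq mult.commute)
      ultimately show ?thesis by blast
    qed
    have "exp (- (real N * (a + \<epsilon>))) \<le> exp (- \<beta> * (real N * (energy_real \<mu> + \<epsilon>1))) * exp (- (real N * (D + \<epsilon> / 2)))"
    proof -
      have "real N * (\<beta> * energy_real \<mu> + D + \<epsilon>) \<le> real N * (a + \<epsilon>)" using aD by (intro mult_left_mono) auto
      moreover have "- \<beta> * (real N * (energy_real \<mu> + \<epsilon>1)) + - (real N * (D + \<epsilon> / 2))
          = - (real N * (\<beta> * energy_real \<mu> + D + (\<beta> * \<epsilon>1 + \<epsilon> / 2)))" by (simp add: algebra_simps)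
      ultimately show ?thesis unfolding exp_add[symmetric] using \<epsilon>1(2) by simp
    qed
    also have "\<dots> \<le> exp (- \<beta> * (real N * (energy_real \<mu> + \<epsilon>1))) * p" using p_ge by (intro mult_left_mono) auto
    also have "\<dots> = (\<integral>x. exp (- \<beta> * (real N * (energy_real \<mu> + \<epsilon>1))) * indicator (S N) x \<partial>base N)"
      unfolding p_def using S_sets[OF \<mu>0] by (simp add: sets.Int_space_eq2)
    also have "\<dots> \<le> weight N G"
      unfolding weight_def
    proof (rule integral_mono[OF _ integrable_weight[OF N Gs]])
      interpret B: prob_space "base N" by (rule prob_space_base)
      have "integrable (base N) (indicator (S N) :: _ \<Rightarrow> real)"
        by (rule B.integrable_const_bound[of _ 1]) (use S_sets[OF \<mu>0] in \<open>auto simp: indicator_def\<close>)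
      then show "integrable (base N) (\<lambda>x. exp (- \<beta> * (real N * (energy_real \<mu> + \<epsilon>1))) * indicator (S N) x)"
        by (rule integrable_mult_right)
      show "exp (- \<beta> * (real N * (energy_real \<mu> + \<epsilon>1))) * indicator (S N) x
        \<le> exp (- \<beta> * H N x) * indicator G (empirical_measure X N x)" for x
        using inS[of x] \<beta> by (cases "x \<in> S N") auto
    qed
    finally show ?case .
  qed
qed

section \<open>Existence and uniqueness of the minimiser of the rate\<close>

lemma rate_lower_bound:
  assumes \<mu>: "\<mu> \<in> prob_measures X" and "rate \<mu> \<le> ereal a"
  shows "\<beta> * \<F> (\<lambda>_. 0) \<le> a"
proof -
  have "dual (\<lambda>_. 0) (\<lambda>_. 0) (\<lambda>v. \<integral>x. v x \<partial>\<mu>) \<le> a"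
    using assms(2) rate_le_iff[OF \<mu>, of a] bounded_borel_const[of 0 X] continuous_on_const by blast
  then show ?thesis using M0.prob_space by (simp add: dual_def cumulant_def)
qed

text \<open>The entropy of \<mu>0 relative to itself vanishes, so the infimum of the rate is not
  infinite.\<close>

lemma rate_base: "rate \<mu>0 = ereal (\<beta> * energy_real \<mu>0)"
proof -
  have 1: "density \<mu>0 (\<lambda>x. ennreal 1) = \<mu>0" by (simp add: density_1)
  have "rel_entropy \<mu>0 (density \<mu>0 (\<lambda>x. ennreal 1)) = ereal (\<integral>x. ln 1 \<partial>density \<mu>0 (\<lambda>x. ennreal 1))"
    by (rule M0.rel_entropy_density) auto
  then show ?thesis unfolding 1 by (simp add: rate_def)
qed

text \<open>If no measure attained the infimum \<open>c\<close>, then \<open>weight_upper\<close> on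
  the full space would give a level above \<open>c\<close> that is still below every rate.
  Uniqueness: the energy, a supremum of affine functions, is convex, and the entropy is strictly
  convex at midpoints.\<close>

lemma rate_minimiser:
  obtains m c where "m \<in> prob_measures X" "rate m = ereal c"
    "\<And>\<mu>. \<mu> \<in> prob_measures X \<Longrightarrow> ereal c \<le> rate \<mu>"
    "\<And>\<mu>. \<mu> \<in> prob_measures X \<Longrightarrow> rate \<mu> \<le> ereal c \<Longrightarrow> \<mu> = m"
proof -
  define I where "I = (INF \<mu>\<in>prob_measures X. rate \<mu>)"
  have "I \<le> ereal (\<beta> * energy_real \<mu>0)"
    unfolding I_def rate_base[symmetric] by (rule INF_lower[OF \<mu>0])
  moreover have "ereal (\<beta> * \<F> (\<lambda>_. 0)) \<le> I"
    unfolding I_def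
  proof (rule INF_greatest)
    fix \<mu> assume \<mu>: "\<mu> \<in> prob_measures X"
    show "ereal (\<beta> * \<F> (\<lambda>_. 0)) \<le> rate \<mu>"
    proof (cases "rate \<mu>")
      case MInf
      then have "\<beta> * \<F> (\<lambda>_. 0) \<le> \<beta> * \<F> (\<lambda>_. 0) - 1" by (intro rate_lower_bound[OF \<mu>]) simp
      then show ?thesis by simp
    qed (use rate_lower_bound[OF \<mu>] in auto)
  qed
  ultimately obtain c where c: "I = ereal c" by (cases I) auto
  have lower: "ereal c \<le> rate \<mu>" if "\<mu> \<in> prob_measures X" for \<mu>
    unfolding c[symmetric] I_def by (rule INF_lower[OF that])
  have "\<exists>m\<in>prob_measures X. rate m \<le> ereal c"
  proof (rule ccontr)
    assume no: "\<not> ?thesis"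
    have cl: "closedin (weak_topology X) (prob_measures X)"
      using closedin_topspace[of "weak_topology X"] by (simp add: topspace_weak_topology)
    obtain a' where a': "c < a'" "\<And>\<mu>. \<mu> \<in> prob_measures X \<Longrightarrow> \<not> rate \<mu> \<le> ereal a'"
      using weight_upper[OF cl, of c] no by blast
    have "ereal a' \<le> I" unfolding I_def using a'(2) by (intro INF_greatest) (meson linear)
    then show False using a'(1) c by simp
  qed
  then obtain m where m: "m \<in> prob_measures X" "rate m \<le> ereal c" by blast
  have "\<mu> = m" if \<mu>: "\<mu> \<in> prob_measures X" "rate \<mu> \<le> ereal c" for \<mu>
  proof (rule ccontr)
    assume ne: "\<mu> \<noteq> m"
    note M = prob_measuresD[OF \<mu>(1)] and N = prob_measuresD[OF m(1)] and M0' = prob_measuresD[OF \<mu>0]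
    obtain d1 where d1: "rel_entropy \<mu>0 \<mu> = ereal d1"
      using \<mu>(2) rel_entropy_nonneg[OF \<mu>(1)] unfolding rate_def by (cases "rel_entropy \<mu>0 \<mu>") auto
    obtain d2 where d2: "rel_entropy \<mu>0 m = ereal d2"
      using m(2) rel_entropy_nonneg[OF m(1)] unfolding rate_def by (cases "rel_entropy \<mu>0 m") auto
    have s: "sets \<mu> = sets \<mu>0" "sets m = sets \<mu>0" using M N M0' by simp_all
    obtain \<nu> where \<nu>: "prob_space \<nu>" "sets \<nu> = sets \<mu>0" "rel_entropy \<mu>0 \<nu> < ereal ((d1 + d2) / 2)"
      "\<And>(u::'a \<Rightarrow> real) B. u \<in> borel_measurable \<mu>0 \<Longrightarrow> (\<And>x. x \<in> space \<mu>0 \<Longrightarrow> \<bar>u x\<bar> \<le> B) \<Longrightarrow>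
      (\<integral>x. u x \<partial>\<nu>) = ((\<integral>x. u x \<partial>\<mu>) + (\<integral>x. u x \<partial>m)) / 2"
      using M0.rel_entropy_strict_midpoint[OF M(1) s(1) N(1) s(2) d1 d2 ne] by blast
    have \<nu>X: "\<nu> \<in> prob_measures X" using \<nu>(1,2) M0'(2) by (simp add: prob_measures_def)
    have "energy_real \<nu> \<le> (energy_real \<mu> + energy_real m) / 2"
    proof (rule energy_real_le)
      fix u :: "'a \<Rightarrow> real" assume u: "continuous_on X u"
      obtain B where B: "\<And>x. x \<in> X \<Longrightarrow> \<bar>u x\<bar> \<le> B" using compact_continuous_bounded[OF compact_X u] by blast
      have "u \<in> borel_measurable \<mu>0" unfolding M0'(4) by (rule borel_measurable_continuous_on_restrict[OF u])
      then have "(\<integral>x. u x \<partial>\<nu>) = ((\<integral>x. u x \<partial>\<mu>) + (\<integral>x. u x \<partial>m)) / 2"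
        using \<nu>(4)[of u B] B M0'(3) by simp
      then show "\<F> u - (\<integral>x. u x \<partial>\<nu>) \<le> (energy_real \<mu> + energy_real m) / 2"
        using energy_real_ge[OF \<mu>(1) u] energy_real_ge[OF m(1) u] by simp
    qed
    then have "\<beta> * energy_real \<nu> \<le> \<beta> * ((energy_real \<mu> + energy_real m) / 2)" using \<beta> by simp
    then have e: "\<beta> * energy_real \<nu> \<le> (\<beta> * energy_real \<mu> + \<beta> * energy_real m) / 2"
      by (simp add: distrib_left)
    obtain d where d: "rel_entropy \<mu>0 \<nu> = ereal d" "d < (d1 + d2) / 2"
      using \<nu>(3) rel_entropy_nonneg[OF \<nu>X] by (cases "rel_entropy \<mu>0 \<nu>") auto
    have "c \<le> \<beta> * energy_real \<nu> + d" using lower[OF \<nu>X] by (simp add: rate_def d)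
    moreover have "\<beta> * energy_real \<mu> + d1 \<le> c" "\<beta> * energy_real m + d2 \<le> c"
      using \<mu>(2) m(2) by (simp_all add: rate_def d1 d2)
    moreover have False if "c \<le> x + d" "y + d1 \<le> c" "z + d2 \<le> c" "x \<le> (y + z) / 2" for x y z :: real
      using that d(2) by (simp add: field_simps)
    ultimately show False using e by blast
  qed
  moreover have "rate m = ereal c" using m lower[OF m(1)] by (simp add: antisym)
  ultimately show thesis using that m(1) lower by blast
qed

lemma partition_function_eq_weight:
  assumes N: "N > 0"
  shows "partition N = weight N (prob_measures X)"
  unfolding partition_function_def weight_def
proof (rule Bochner_Integration.integral_cong[OF refl])
  fix x assume "x \<in> space (base N)"
  then have "empirical_measure X N x \<in> prob_measures X"
    using empirical_measure_in_prob_measures[OF _ N] by (simp add: space_PiM_config[OF \<mu>0])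
  then show "exp (- \<beta> * H N x) = exp (- \<beta> * H N x) * indicator (prob_measures X) (empirical_measure X N x)"
    by simp
qed

lemma partition_function_pos: "partition N > 0"
proof -
  interpret B: prob_space "base N" by (rule prob_space_base)
  obtain C where C: "\<And>x. x \<in> config X N \<Longrightarrow> \<bar>conf_energy N (\<lambda>_. 0) x\<bar> \<le> C"
    using conf_energy_bounded[of "\<lambda>_. 0" N] continuous_on_const by blast
  have "exp (- \<beta> * C) \<le> (\<integral>x. exp (- \<beta> * H N x) \<partial>base N)"
  proof (rule B.integral_ge_const[OF integrable_exp_H])
    have "exp (- \<beta> * C) \<le> exp (- \<beta> * H N x)" if "x \<in> config X N" for x
      using C[OF that] \<beta> by (simp add: abs_le_iff)
    then show "AE x in base N. exp (- \<beta> * C) \<le> exp (- \<beta> * H N x)"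
      using space_PiM_config[OF \<mu>0] by (intro AE_I2) auto
  qed
  then show ?thesis unfolding partition_function_def using exp_gt_zero[of "- \<beta> * C"] by linarith
qed

lemma measure_empirical_law:
  assumes N: "N > 0" and A: "A \<in> sets (borel_of_topology (weak_topology X))"
  shows "measure (law N) A = weight N A / partition N"
proof -
  define Z where "Z = partition N"
  have Z: "Z > 0" unfolding Z_def by (rule partition_function_pos)
  let ?e = "empirical_measure X N" and ?S = "empirical_measure X N -` A \<inter> space (base N)"
  have em: "?e \<in> measurable (base N) (borel_of_topology (weak_topology X))"
    unfolding measurable_PiM_config[OF \<mu>0] by (rule measurable_empirical_measure[OF N])
  have S: "?S \<in> sets (base N)" by (rule measurable_sets[OF em A])
  have gm: "(\<lambda>x. exp (- \<beta> * H N x) / Z) \<in> borel_measurable (base N)"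
    using borel_measurable_integrable[OF integrable_exp_H] by simp
  have em': "?e \<in> measurable (gibbs_measure \<mu>0 N (H N) \<beta>) (borel_of_topology (weak_topology X))"
    unfolding gibbs_measure_def using em by simp
  have "emeasure (law N) A = emeasure (gibbs_measure \<mu>0 N (H N) \<beta>) ?S"
    unfolding empirical_law_def by (subst emeasure_distr[OF em' A]) (simp add: gibbs_measure_def)
  also have "\<dots> = (\<integral>\<^sup>+x. ennreal (exp (- \<beta> * H N x) / Z) * indicator ?S x \<partial>base N)"
    unfolding gibbs_measure_def Z_def[symmetric] using gm S by (intro emeasure_density) auto
  also have "\<dots> = (\<integral>\<^sup>+x. ennreal (exp (- \<beta> * H N x) * indicator A (?e x) / Z) \<partial>base N)"
    by (intro nn_integral_cong) (auto simp: indicator_def)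
  also have "\<dots> = ennreal (\<integral>x. exp (- \<beta> * H N x) * indicator A (?e x) / Z \<partial>base N)"
    using integrable_weight[OF N A] Z by (intro nn_integral_eq_integral) auto
  also have "(\<integral>x. exp (- \<beta> * H N x) * indicator A (?e x) / Z \<partial>base N) = weight N A / Z"
    unfolding weight_def by simp
  finally have "emeasure (law N) A = ennreal (weight N A / Z)" .
  moreover have "weight N A / Z \<ge> 0"
    using Z unfolding weight_def by (intro divide_nonneg_pos integral_nonneg_AE) auto
  ultimately show ?thesis by (simp add: measure_def Z_def)
qed

section \<open>Normalisation, large deviation bounds and convergence in probability\<close>

context
  fixes m c
  assumes m: "m \<in> prob_measures X" "rate m = ereal c"
    and lower: "\<And>\<mu>. \<mu> \<in> prob_measures X \<Longrightarrow> ereal c \<le> rate \<mu>"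
begin

text \<open>The full space is open and contains the minimiser. Together with
  \<open>partition_function_upper\<close> this makes the partition function decay like
  \<open>exp (- (real N * c))\<close>, which identifies \<open>c / \<beta>\<close> as the
  normalising constant.\<close>

lemma partition_function_lower:
  assumes "\<epsilon> > 0"
  shows "eventually (\<lambda>N. exp (- (real N * (c + \<epsilon>))) \<le> partition N) sequentially"
proof -
  have o: "openin (weak_topology X) (prob_measures X)"
    using openin_topspace[of "weak_topology X"] by (simp add: topspace_weak_topology)
  have "rate m \<le> ereal c" using m(2) by simp
  from weight_lower[OF o m(1) this assms] eventually_gt_at_top[of 0] show ?thesis
    by eventually_elim (simp only: partition_function_eq_weight)
qed

lemma partition_function_upper:
  assumes "\<epsilon> > 0"
  shows "eventually (\<lambda>N. partition N \<le> exp (- (real N * (c - \<epsilon>)))) sequentially"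
proof -
  have cl: "closedin (weak_topology X) (prob_measures X)"
    using closedin_topspace[of "weak_topology X"] by (simp add: topspace_weak_topology)
  have "\<not> rate \<mu> \<le> ereal (c - \<epsilon>)" if "\<mu> \<in> prob_measures X" for \<mu>
    using lower[OF that] assms by (metis diff_less_eq dual_order.trans ereal_less_eq(3) less_add_same_cancel1 not_le)
  then obtain a' where a': "c - \<epsilon> < a'"
    "eventually (\<lambda>N. weight N (prob_measures X) \<le> exp (- (real N * a'))) sequentially"
    using weight_upper[OF cl, of "c - \<epsilon>"] by blast
  show ?thesis
    using a'(2) eventually_gt_at_top[of 0]
  proof eventually_elim
    case (elim N)
    have "real N * (c - \<epsilon>) \<le> real N * a'" using a'(1) by (intro mult_left_mono) auto
    then have "exp (- (real N * a')) \<le> exp (- (real N * (c - \<epsilon>)))" by (simp only: exp_le_cancel_iff neg_le_iff_le)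
    with elim(1) show ?case unfolding partition_function_eq_weight[OF elim(2)] by (rule order_trans)
  qed
qed

text \<open>Half of the gap gained in \<open>weight_upper\<close> pays for the partition function;
  the other half survives as the strict inequality \<open>a - c < s\<close>, on which convergence in
  probability rests.\<close>

lemma law_upper:
  assumes A: "closedin (weak_topology X) A" and rate: "\<And>\<mu>. \<mu> \<in> A \<Longrightarrow> \<not> rate \<mu> \<le> ereal a"
  obtains s where "a - c < s"
    "eventually (\<lambda>N. measure (law N) A \<le> exp (- (real N * s))) sequentially"
proof -
  obtain a' where a': "a < a'" "eventually (\<lambda>N. weight N A \<le> exp (- (real N * a'))) sequentially"
    using weight_upper[OF A rate] by blast
  define \<epsilon> where "\<epsilon> = (a' - a) / 2"
  have \<epsilon>: "\<epsilon> > 0" using a'(1) by (simp add: \<epsilon>_def)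
  show thesis
  proof (rule that[of "a' - c - \<epsilon>"])
    show "a - c < a' - c - \<epsilon>" using a'(1) by (simp add: \<epsilon>_def field_simps)
    show "eventually (\<lambda>N. measure (law N) A \<le> exp (- (real N * (a' - c - \<epsilon>)))) sequentially"
      using a'(2) partition_function_lower[OF \<epsilon>] eventually_gt_at_top[of 0]
    proof eventually_elim
      case (elim N)
      have "measure (law N) A = weight N A / partition N"
        using measure_empirical_law[OF _ closedin_borel_of_topology[OF A]] elim(3) by simp
      also have "\<dots> \<le> exp (- (real N * a')) / exp (- (real N * (c + \<epsilon>)))"
        using elim(1,2) by (intro frac_le) auto
      also have "\<dots> = exp (- (real N * (a' - c - \<epsilon>)))"
        by (simp add: algebra_simps flip: exp_diff)
      finally show ?case .
    qed
  qed
qed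

lemma law_lower:
  assumes G: "openin (weak_topology X) G" "\<mu> \<in> G" and a: "rate \<mu> \<le> ereal a" and \<epsilon>: "\<epsilon> > 0"
  shows "eventually (\<lambda>N. exp (- (real N * (a - c + \<epsilon>))) \<le> measure (law N) G) sequentially"
proof -
  have e2: "\<epsilon> / 2 > 0" using \<epsilon> by simp
  show ?thesis
    using weight_lower[OF G a e2] partition_function_upper[OF e2] eventually_gt_at_top[of 0]
  proof eventually_elim
    case (elim N)
    have "exp (- (real N * (a - c + \<epsilon>))) = exp (- (real N * (a + \<epsilon> / 2))) / exp (- (real N * (c - \<epsilon> / 2)))"
      by (simp add: algebra_simps flip: exp_diff)
    also have "\<dots> \<le> weight N G / partition N"
      using elim(1,2) partition_function_pos by (intro frac_le) (auto intro: order_trans[OF _ elim(1)])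
    also have "\<dots> = measure (law N) G"
      using measure_empirical_law[OF _ openin_borel_of_topology[OF G(1)]] elim(3) by simp
    finally show ?case .
  qed
qed

lemma free_energy_functional_eq:
  assumes \<mu>: "\<mu> \<in> prob_measures X"
  shows "free c \<mu> = (rate \<mu> - ereal c) / ereal \<beta>"
proof (cases "rel_entropy \<mu>0 \<mu>")
  case (real d)
  have "energy_real \<mu> + 1 / \<beta> * d - c / \<beta> = (\<beta> * energy_real \<mu> + d - c) / \<beta>"
    using \<beta> by (simp add: field_simps)
  then show ?thesis unfolding free_energy_functional_def rate_def energy_eq[OF \<mu>] real using \<beta> by simp
next
  case PInf
  then show ?thesis unfolding free_energy_functional_def rate_def energy_eq[OF \<mu>] using \<beta> by simp
next
  case MInf
  then show ?thesis using rel_entropy_nonneg[OF \<mu>] by simp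
qed

lemma free_energy_functional_le_iff:
  assumes \<mu>: "\<mu> \<in> prob_measures X"
  shows "free c \<mu> \<le> ereal t \<longleftrightarrow> rate \<mu> \<le> ereal (\<beta> * t + c)"
proof (cases "rate \<mu>")
  case (real r)
  then show ?thesis unfolding free_energy_functional_eq[OF \<mu>] using \<beta>
    by (simp add: pos_divide_le_eq mult.commute diff_le_eq)
next
  case PInf
  then show ?thesis unfolding free_energy_functional_eq[OF \<mu>] using \<beta> by simp
next
  case MInf
  then show ?thesis using lower[OF \<mu>] by simp
qed

lemma free_energy_sublevel:
  "{\<mu> \<in> topspace (weak_topology X). free c \<mu> \<le> ereal t}
    = {\<mu> \<in> prob_measures X. rate \<mu> \<le> ereal (\<beta> * t + c)}"
  using free_energy_functional_le_iff by (auto simp: topspace_weak_topology)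

lemma law_satisfies_LDP: "satisfies_LDP (weak_topology X) (\<lambda>N. law N)
  (\<lambda>N. \<beta> * real N) (free c)"
  unfolding satisfies_LDP_def
proof (intro conjI allI impI)
  show "lower_semicontinuous_fun (weak_topology X) (free c)"
    unfolding lower_semicontinuous_fun_def free_energy_sublevel using closedin_rate_le by blast
  fix A assume A: "closedin (weak_topology X) A"
  have AX: "A \<subseteq> prob_measures X" using closedin_subset[OF A] by (simp add: topspace_weak_topology)
  \<comment> \<open>Working with real levels strictly below the infimum also covers an infinite
    infimum, in particular that of the empty set.\<close>
  have up: "limsup (\<lambda>N. ereal (1 / (\<beta> * real N)) * log_ereal (measure (law N) A)) \<le> ereal (- t)"
    if t: "ereal t < (INF x\<in>A. free c x)" for t
  proof (rule Limsup_bounded)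
    have "\<not> rate \<mu> \<le> ereal (\<beta> * t + c)" if \<mu>: "\<mu> \<in> A" for \<mu>
    proof -
      have "\<not> free c \<mu> \<le> ereal t" using less_INF_D[OF t \<mu>] by (simp add: not_le)
      moreover have "\<mu> \<in> prob_measures X" using \<mu> AX by blast
      ultimately show ?thesis using free_energy_functional_le_iff by blast
    qed
    from law_upper[OF A this] obtain s where s: "\<beta> * t + c - c < s"
      "eventually (\<lambda>N. measure (law N) A \<le> exp (- (real N * s))) sequentially" by blast
    show "eventually (\<lambda>N. ereal (1 / (\<beta> * real N)) * log_ereal (measure (law N) A) \<le> ereal (- t)) sequentially"
      using s(2) eventually_gt_at_top[of 0]
    proof eventually_elim
      case (elim N)
      show ?case
      \<comment> \<open>A set of measure 0 has logarithm \<open>-\<infinity>\<close>; the prefactor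
        is positive because \<open>N = 0\<close>, where it would be 0 by convention, has been
        excluded.\<close>
      proof (cases "measure (law N) A = 0")
        case True
        then show ?thesis using elim(2) \<beta> by (simp add: log_ereal_def)
      next
        case False
        then have pos: "measure (law N) A > 0" by (simp add: zero_less_measure_iff)
        then have "ln (measure (law N) A) \<le> - (real N * s)" using elim(1) by (metis exp_gt_zero ln_exp ln_le_cancel_iff)
        also have "\<dots> \<le> - (real N * (\<beta> * t))" using s(1) by (simp add: mult_left_mono)
        finally have "1 / (\<beta> * real N) * ln (measure (law N) A) \<le> 1 / (\<beta> * real N) * (- (real N * (\<beta> * t)))"
          using \<beta> by (intro mult_left_mono) auto
        also have "\<dots> = - t" using \<beta> elim(2) by simp
        finally show ?thesis using False by (simp add: log_ereal_def)
      qed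
    qed
  qed
  show "limsup (\<lambda>N. ereal (1 / (\<beta> * real N)) * log_ereal (measure (law N) A)) \<le> - (INF x\<in>A. free c x)"
  proof (rule ccontr)
    let ?L = "limsup (\<lambda>N. ereal (1 / (\<beta> * real N)) * log_ereal (measure (law N) A))"
    assume "\<not> ?thesis"
    then have "- ?L < (INF x\<in>A. free c x)" by (simp add: not_le ereal_uminus_less_reorder)
    then obtain t where t: "- ?L < ereal t" "ereal t < (INF x\<in>A. free c x)" using ereal_dense2 by blast
    from up[OF t(2)] have "- ereal (- t) \<le> - ?L" by (simp only: ereal_minus_le_minus)
    then have "ereal t \<le> - ?L" by simp
    then show False using t(1) by simp
  qed
next
  fix G assume G: "openin (weak_topology X) G"
  have GX: "G \<subseteq> prob_measures X" using openin_subset[OF G] by (simp add: topspace_weak_topology)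
  let ?L = "liminf (\<lambda>N. ereal (1 / (\<beta> * real N)) * log_ereal (measure (law N) G))"
  have low: "ereal (- t) \<le> ?L" if \<mu>: "\<mu> \<in> G" and t: "free c \<mu> < ereal t" for \<mu> t
  proof (rule Liminf_bounded)
    \<comment> \<open>The intermediate level leaves the positive slack
      \<open>\<beta> * (t - t')\<close> that \<open>law_lower\<close> requires.\<close>
    obtain t' where t': "free c \<mu> < ereal t'" "t' < t" using ereal_dense2[OF t] by auto
    have "\<mu> \<in> prob_measures X" using GX \<mu> by blast
    then have "rate \<mu> \<le> ereal (\<beta> * t' + c)"
      using free_energy_functional_le_iff less_imp_le[OF t'(1)] by blast
    from law_lower[OF G \<mu> this, of "\<beta> * (t - t')"]
    have "eventually (\<lambda>N. exp (- (real N * (\<beta> * t))) \<le> measure (law N) G) sequentially"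
      using t'(2) \<beta> by (simp add: algebra_simps)
    then show "eventually (\<lambda>N. ereal (- t) \<le> ereal (1 / (\<beta> * real N)) * log_ereal (measure (law N) G)) sequentially"
      using eventually_gt_at_top[of 0]
    proof eventually_elim
      case (elim N)
      have pos: "measure (law N) G > 0" using elim(1) exp_gt_zero less_le_trans by blast
      then have "- (real N * (\<beta> * t)) \<le> ln (measure (law N) G)" using elim(1) by (simp add: ln_ge_iff)
      then have "1 / (\<beta> * real N) * (- (real N * (\<beta> * t))) \<le> 1 / (\<beta> * real N) * ln (measure (law N) G)"
        using \<beta> by (intro mult_left_mono) auto
      moreover have "1 / (\<beta> * real N) * (- (real N * (\<beta> * t))) = - t" using \<beta> elim(2) by simp
      ultimately show ?case using pos by (simp add: log_ereal_def)
    qed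
  qed
  have "- ?L \<le> (INF x\<in>G. free c x)"
  proof (rule INF_greatest)
    fix \<mu> assume \<mu>: "\<mu> \<in> G"
    show "- ?L \<le> free c \<mu>"
    proof (rule ccontr)
      assume "\<not> ?thesis"
      then have "free c \<mu> < - ?L" by simp
      then obtain t where t: "free c \<mu> < ereal t" "ereal t < - ?L" using ereal_dense2 by blast
      from low[OF \<mu> t(1)] have "- ?L \<le> ereal t" by (simp add: ereal_uminus_le_reorder)
      then show False using t(2) by simp
    qed
  qed
  then show "- (INF x\<in>G. free c x) \<le> ?L" by (simp add: ereal_uminus_le_reorder)
qed

text \<open>The complement of a neighbourhood of \<open>m\<close> is closed and, by uniqueness, has
  rate above \<open>c\<close> at each point; \<open>law_upper\<close> turns this into a uniform gap
  and so into exponential decay.\<close>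

lemma convergence_in_probability:
  assumes unique: "\<And>\<mu>. \<mu> \<in> prob_measures X \<Longrightarrow> rate \<mu> \<le> ereal c \<Longrightarrow> \<mu> = m"
  shows "converges_in_probability_to (weak_topology X) (\<lambda>N. law N) m"
  unfolding converges_in_probability_to_def
proof (intro allI impI)
  fix U assume U: "openin (weak_topology X) U \<and> m \<in> U"
  have cl: "closedin (weak_topology X) (topspace (weak_topology X) - U)" using U by blast
  have "\<not> rate \<mu> \<le> ereal c" if "\<mu> \<in> topspace (weak_topology X) - U" for \<mu>
    using unique[of \<mu>] that U by (auto simp: topspace_weak_topology)
  from law_upper[OF cl this] obtain s where s: "c - c < s"
    "eventually (\<lambda>N. measure (law N) (topspace (weak_topology X) - U) \<le> exp (- (real N * s))) sequentially"
    by blast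
  have "(\<lambda>N. exp (- (s * real N))) \<longlonglongrightarrow> 0"
    by (intro filterlim_compose[OF exp_at_bot] filterlim_compose[OF filterlim_uminus_at_bot_at_top]
        filterlim_tendsto_pos_mult_at_top[OF tendsto_const _ filterlim_real_sequentially]) (use s in simp)
  then have "(\<lambda>N. exp (- (real N * s))) \<longlonglongrightarrow> 0" by (simp add: mult.commute)
  from tendsto_sandwich[OF _ s(2) tendsto_const this]
  show "(\<lambda>N. measure (law N) (topspace (weak_topology X) - U)) \<longlonglongrightarrow> 0" by simp
qed

end

lemma gibbs_large_deviations:
  "\<exists>C::real. (INF \<mu>\<in>prob_measures X. free_energy_functional X \<mu>0 \<F> \<beta> C \<mu>) = 0 \<and>
    good_rate_functional (weak_topology X) (free_energy_functional X \<mu>0 \<F> \<beta> C) \<and>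
    satisfies_LDP (weak_topology X) (\<lambda>N. empirical_law X \<mu>0 N (H N) \<beta>)
      (\<lambda>N. \<beta> * real N) (free_energy_functional X \<mu>0 \<F> \<beta> C) \<and>
    (\<exists>m. {\<mu>. is_arg_min (free_energy_functional X \<mu>0 \<F> \<beta> C) (\<lambda>\<nu>. \<nu> \<in> prob_measures X) \<mu>} = {m} \<and>
      converges_in_probability_to (weak_topology X) (\<lambda>N. empirical_law X \<mu>0 N (H N) \<beta>) m)"
proof -
  obtain m c where m: "m \<in> prob_measures X" "rate m = ereal c"
    and lower: "\<And>\<mu>. \<mu> \<in> prob_measures X \<Longrightarrow> ereal c \<le> rate \<mu>"
    and unique: "\<And>\<mu>. \<mu> \<in> prob_measures X \<Longrightarrow> rate \<mu> \<le> ereal c \<Longrightarrow> \<mu> = m"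
    using rate_minimiser by blast
  let ?F = "free_energy_functional X \<mu>0 \<F> \<beta> (c / \<beta>)"
  have le_iff: "?F \<mu> \<le> ereal t \<longleftrightarrow> rate \<mu> \<le> ereal (\<beta> * t + c)" if "\<mu> \<in> prob_measures X" for \<mu> t
    by (rule free_energy_functional_le_iff[OF m lower that])
  have Fm: "?F m = 0" using free_energy_functional_eq[OF m lower m(1)] \<beta> by (simp add: m(2))
  have F0: "0 \<le> ?F \<mu>" if \<mu>: "\<mu> \<in> prob_measures X" for \<mu>
    using free_energy_functional_eq[OF m lower \<mu>] lower[OF \<mu>] \<beta>
    by (cases "rate \<mu>") auto
  have Fu: "\<mu> = m" if \<mu>: "\<mu> \<in> prob_measures X" "?F \<mu> \<le> 0" for \<mu>
    using le_iff[OF \<mu>(1), of 0] \<mu> unique by (simp add: zero_ereal_def)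
  have "(INF \<mu>\<in>prob_measures X. ?F \<mu>) = 0"
    by (rule antisym) (use INF_lower[OF m(1), of ?F] Fm F0 in \<open>auto intro: INF_greatest\<close>)
  moreover have "good_rate_functional (weak_topology X) ?F"
  proof -
    have "{\<mu> \<in> topspace (weak_topology X). ?F \<mu> \<le> ereal t} = {\<mu> \<in> prob_measures X. rate \<mu> \<le> ereal (\<beta> * t + c)}" for t
      using le_iff by (auto simp: topspace_weak_topology)
    then show ?thesis unfolding good_rate_functional_def by (simp only: compactin_rate_le simp_thms)
  qed
  moreover have "{\<mu>. is_arg_min ?F (\<lambda>\<nu>. \<nu> \<in> prob_measures X) \<mu>} = {m}"
  proof (intro equalityI subsetI)
    fix \<mu> assume "\<mu> \<in> {\<mu>. is_arg_min ?F (\<lambda>\<nu>. \<nu> \<in> prob_measures X) \<mu>}"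
    then have "\<mu> \<in> prob_measures X" "?F \<mu> \<le> ?F m" using m(1) by (auto simp: is_arg_min_def not_less)
    then show "\<mu> \<in> {m}" using Fu Fm by simp
  next
    fix \<mu> assume "\<mu> \<in> {m}"
    then show "\<mu> \<in> {\<mu>. is_arg_min ?F (\<lambda>\<nu>. \<nu> \<in> prob_measures X) \<mu>}"
      using m(1) Fm F0 by (auto simp: is_arg_min_def not_less)
  qed
  ultimately show ?thesis
    using law_satisfies_LDP[OF m lower] convergence_in_probability[OF m lower unique] by blast
qed

end

theorem theorem1p4:
  fixes X :: "(real ^ 'n) set"
    and \<mu>0 :: "(real ^ 'n) measure"
    and H :: "nat \<Rightarrow> (nat \<Rightarrow> real ^ 'n) \<Rightarrow> real"
    and b :: "nat \<Rightarrow> real"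
    and \<F> :: "((real ^ 'n) \<Rightarrow> real) \<Rightarrow> real"
    and \<beta> :: real
  assumes "compact X"
    and "\<mu>0 \<in> prob_measures X" and "measure_support \<mu>0 = X"
    and "\<And>N. is_hamiltonian X N (H N)"
    and "uniformly_lipschitz X H"
    and "\<And>N. b N > 0" and "filterlim b at_top sequentially"
    and "converges_to_free_energy X \<mu>0 H b \<F>"
    and "gateaux_differentiable_on_C0 X \<F>"
    and "\<beta> > 0"
  shows "(\<exists>C::real.
            (INF \<mu>\<in>prob_measures X. free_energy_functional X \<mu>0 \<F> \<beta> C \<mu>) = 0 \<and>
            good_rate_functional (weak_topology X) (free_energy_functional X \<mu>0 \<F> \<beta> C) \<and>
            satisfies_LDP (weak_topology X) (\<lambda>N. empirical_law X \<mu>0 N (H N) \<beta>)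
              (\<lambda>N. \<beta> * real N) (free_energy_functional X \<mu>0 \<F> \<beta> C) \<and>
            (\<exists>m. {\<mu>. is_arg_min (free_energy_functional X \<mu>0 \<F> \<beta> C)
                        (\<lambda>\<nu>. \<nu> \<in> prob_measures X) \<mu>} = {m} \<and>
                 converges_in_probability_to (weak_topology X)
                   (\<lambda>N. empirical_law X \<mu>0 N (H N) \<beta>) m))
         \<and> (\<forall>\<nu>0 b'. \<nu>0 \<in> prob_measures X \<and> measure_support \<nu>0 = X \<and>
              (\<forall>N. b' N > 0) \<and> filterlim b' at_top sequentially \<longrightarrow>
              (\<exists>\<F>'. converges_to_free_energy X \<nu>0 H b' \<F>' \<and>
                    (\<forall>\<mu>\<in>prob_measures X. energy X \<F>' \<mu> = energy X \<F> \<mu>)))"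
proof -
  interpret M0: prob_space \<mu>0 by (rule prob_measuresD[OF assms(2)])
  have "X \<noteq> {}" using M0.not_empty prob_measuresD(3)[OF assms(2)] by simp
  obtain L where L: "\<And>N x y. x \<in> config X N \<Longrightarrow> y \<in> config X N \<Longrightarrow>
      \<bar>H N x - H N y\<bar> \<le> L * (\<Sum>i<N. norm (x i - y i))"
    using assms(5) unfolding uniformly_lipschitz_def by blast
  \<comment> \<open>\<open>uniformly_lipschitz\<close> leaves the sign of its constant open;
    enlarging it to a nonnegative one keeps the bound, as the sum of norms is nonnegative.\<close>
  have lip: "\<bar>H N x - H N y\<bar> \<le> max L 0 * (\<Sum>i<N. norm (x i - y i))"
    if "x \<in> config X N" "y \<in> config X N" for N x y
    using L[OF that] mult_right_mono[of L "max L 0" "\<Sum>i<N. norm (x i - y i)"]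
    by (simp add: sum_nonneg)
  interpret particle_system X H "max L 0"
    by unfold_locales (use assms \<open>X \<noteq> {}\<close> lip in auto)
  have lim: "(\<lambda>N. min_energy N u) \<longlonglongrightarrow> \<F> u" if "continuous_on X u" for u
    using converges_to_free_energy_iff[where b=b, OF assms(2,3,6,7)] assms(8) that by blast
  interpret gibbs_limit X H "max L 0" \<F> \<mu>0 \<beta>
    by unfold_locales (use assms lim in auto)
  \<comment> \<open>For any other reference measure with support \<open>X\<close> and any other
    sequence the limit is \<F> itself, so \<F> is the witness and the energies coincide.\<close>
  have "converges_to_free_energy X \<nu>0 H b' \<F>"
    if "\<nu>0 \<in> prob_measures X" "measure_support \<nu>0 = X" "\<forall>N. b' N > 0" "filterlim b' at_top sequentially" for \<nu>0 b'
    using converges_to_free_energy_iff[where b=b', OF that(1,2) _ that(4)] that(3) lim by blast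
  then show ?thesis using gibbs_large_deviations by blast
qed

end
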